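(* Let $\nu_0=1$ and let $\nu_1,\nu_2,\ldots\in\mathbb N$ be fixed. Let $n(\alpha)$ and $\ell_j(\alpha)$, $j\in\mathbb N$, be sequences of positive integers indexed by $\alpha\in\mathbb N$ that go to infinity as $\alpha\to\infty$ in such a way that $n(\alpha)\ll\ell_j(\alpha)$ for each $j\in\mathbb N$. Set $$f_\alpha(q,x)=\left(q,\ \frac{x}{n(\alpha)\prod_{j=1}^q(\ell_j(\alpha)+\nu_j)}\right).$$ Then for every $q,r\in\mathbb N$, $$\frac{(n(\alpha))^{-1}\prod_{j=1}^r\Gamma(\nu_j+\ell_j(\alpha))}{\prod_{j=1}^r(\ell_j(\alpha)+\nu_j)\ \prod_{j=1}^q\Gamma(\nu_j+\ell_j(\alpha))}\;K^{\mathscr T}_{n(\alpha),\vec\nu,\vec\ell(\alpha)}\big(f_\alpha(q,x);f_\alpha(r,y)\big)\xrightarrow[\alpha\to\infty]{}K^{\mathscr H}_{\vec\nu}(q,x;r,y)$$ uniformly for $x,y$ in compact subsets of $(0,\infty)$, where $K^{\mathscr T}$ is the truncated-unitary product-matrix kernel and $K^{\mathscr H}_{\vec\nu}$ the extended hard-edge kernel (both defined in the context).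
   Context: For positive sequences, $u(\alpha)\ll v(\alpha)$ means that there is $\delta\in(0,1)$ such that $u(\alpha)^{1+\delta}\le v(\alpha)$ for all sufficiently large $\alpha$. For $n\in\mathbb N$, $\nu_0=1$, $\ell_0=-n$, $\nu_k,\ell_k\in\mathbb N$ with $\ell_1\ge n$, and $x,y\in(0,1)$, $q,r\in\mathbb N$, the truncated-unitary product-matrix kernel is $$K^{\mathscr T}_{n,\vec\nu,\vec\ell}(q,x;r,y)=-\frac{1_{r>q}}{x}G^{r-q,0}_{r-q,r-q}\!\left(\begin{matrix}\nu_{q+1}+\ell_{q+1}-1,\ldots,\nu_r+\ell_r-1\\ \nu_{q+1}-1,\ldots,\nu_r-1\end{matrix}\Big|\frac yx\right)$$ $$\qquad+\int_{S_\sigma}\frac{d\sigma}{2\pi i}\int_{S^{(n)}_\zeta}\frac{d\zeta}{2\pi i}\frac{\prod_{j=0}^r\Gamma(\nu_j+\sigma)}{\prod_{j=0}^q\Gamma(\nu_j+\zeta)}\frac{\prod_{j=0}^q\Gamma(\nu_j+\ell_j+\zeta)}{\prod_{j=0}^r\Gamma(\nu_j+\ell_j+\sigma)}\frac{x^\zeta y^{-\sigma-1}}{\sigma-\zeta}.$$ The extended hard-edge kernel is, for $x,y>0$, $$K^{\mathscr H}_{\vec\nu}(q,x;r,y)=-\frac{1_{r>q}}{x}G^{r-q,0}_{0,r-q}\!\left(\begin{matrix}-\\ \nu_{q+1}-1,\ldots,\nu_r-1\end{matrix}\Big|\frac yx\right)+\int_{S_\sigma}\frac{d\sigma}{2\pi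 i}\int_{S_\zeta}\frac{d\zeta}{2\pi i}\frac{\prod_{j=1}^r\Gamma(\sigma+\nu_j)}{\prod_{j=1}^q\Gamma(\zeta+\nu_j)}\frac{\Gamma(-\zeta)}{\Gamma(-\sigma)}\frac{x^\zeta y^{-\sigma-1}}{\sigma-\zeta}.$$ Meijer functions ($p\ge1$, $z>0$): $G^{p,0}_{0,p}\!\left(\begin{matrix}-\\ b_1,\ldots,b_p\end{matrix}\Big|z\right)=\frac1{2\pi i}\int_\gamma\prod_{j=1}^p\Gamma(b_j+\eta)z^{-\eta}d\eta$ with $\gamma$ an upward vertical line to the right of all poles; and $G^{p,0}_{p,p}\!\left(\begin{matrix}a_1,\ldots,a_p\\ b_1,\ldots,b_p\end{matrix}\Big|z\right)=\frac1{2\pi i}\int_\gamma\prod_{j=1}^p\frac{\Gamma(b_j+\eta)}{\Gamma(a_j+\eta)}z^{-\eta}d\eta$, where for $0<z<1$ $\gamma$ is a loop beginning and ending at $-\infty$ and encircling all poles of the $\Gamma(b_j+\eta)$ once counterclockwise, and for $z>1$ the function is $0$. Contours: $S_\sigma$ comes from $-\infty-i\delta$ horizontally to $-c-i\delta$, goes up to $-c+i\delta$, and returns horizontally to $-\infty+i\delta$ ($\delta>0$, $0<c<1$), encircling $-1,-2,\ldots$ counterclockwise. $S_\zeta^{(n)}$ is a closed counterclockwise rectangular contour enclosing $0,1,\ldots,n-1$ and no other integers. $S_\zeta$ comes from $+\infty+i\delta$ horizontally to $-c'+i\delta$, goes down to $-c'-i\delta$, and then horizontally to $+\infty-i\delta$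 ($0<c'<c$), encircling $0,1,2,\ldots$ counterclockwise. Both $S_\zeta$ and $S_\zeta^{(n)}$ lie to the right of, and do not intersect, $S_\sigma$. *)

theory Defs
  imports "HOL-Complex_Analysis.Complex_Analysis"
begin

definition much_less :: "(nat \<Rightarrow> real) \<Rightarrow> (nat \<Rightarrow> real) \<Rightarrow> bool"  (infix "\<lless>" 50)
  where "u \<lless> v \<longleftrightarrow>
    (\<exists>\<delta>. 0 < \<delta> \<and> \<delta> < 1 \<and> (\<forall>\<^sub>F \<alpha> in sequentially. u \<alpha> powr (1 + \<delta>) \<le> v \<alpha>))"


text \<open>Integrals along unbounded contours made of straight pieces. The bounded pieces are library
  contour integrals, the unbounded ones are Lebesgue integrals in the real or imaginary part.\<close>

text \<open>Contour \<open>-\<infinity> - i d \<rightarrow> a - i d \<rightarrow> a + i d \<rightarrow> -\<infinity> + i d\<close>.\<close>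

definition left_loop_integral :: "real \<Rightarrow> real \<Rightarrow> (complex \<Rightarrow> complex) \<Rightarrow> complex"
  where "left_loop_integral a d f =
      (LINT t:{..a}|lborel. f (Complex t (- d)))
    + contour_integral (linepath (Complex a (- d)) (Complex a d)) f
    - (LINT t:{..a}|lborel. f (Complex t d))"

text \<open>Contour \<open>+\<infinity> + i d \<rightarrow> a + i d \<rightarrow> a - i d \<rightarrow> +\<infinity> - i d\<close>.\<close>

definition right_loop_integral :: "real \<Rightarrow> real \<Rightarrow> (complex \<Rightarrow> complex) \<Rightarrow> complex"
  where "right_loop_integral a d f =
    - (LINT t:{a..}|lborel. f (Complex t d))
    + contour_integral (linepath (Complex a d) (Complex a (- d))) f
    + (LINT t:{a..}|lborel. f (Complex t (- d)))"

text \<open>Upward vertical line \<open>Re \<eta> = g\<close>.\<close>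

definition vertical_line_integral :: "real \<Rightarrow> (complex \<Rightarrow> complex) \<Rightarrow> complex"
  where "vertical_line_integral g f = \<i> * (LINT t|lborel. f (Complex g t))"


text \<open>The poles of \<open>\<Gamma>(b + \<eta>)\<close> are \<open>\<eta> = -b, -b - 1, \<dots>\<close>.\<close>

definition right_of_poles :: "real list \<Rightarrow> real \<Rightarrow> bool"
  where "right_of_poles bs g \<longleftrightarrow> (\<forall>b \<in> set bs. - b < g)"

text \<open>The Meijer functions \<open>G\<^bsup>p,0\<^esup>\<^bsub>0,p\<^esub>\<close> and \<open>G\<^bsup>p,0\<^esup>\<^bsub>p,p\<^esub>\<close>, where \<open>p\<close> is the length of the
  parameter lists. The arguments \<open>g\<close> and \<open>d\<close> only specify the contour, which is admissible if
  \<open>right_of_poles bs g\<close> and \<open>0 < d\<close>. The value of \<open>G\<^bsup>p,0\<^esup>\<^bsub>p,p\<^esub>\<close> at \<open>z = 1\<close> is a convention.\<close>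

definition meijer_G_p0_0p :: "real \<Rightarrow> real list \<Rightarrow> real \<Rightarrow> complex"
  where "meijer_G_p0_0p g bs z =
    1 / (2 * of_real pi * \<i>) * vertical_line_integral g
      (\<lambda>\<eta>. (\<Prod>b\<leftarrow>bs. Gamma (of_real b + \<eta>)) * of_real z powr (- \<eta>))"

definition meijer_G_p0_pp :: "real \<Rightarrow> real \<Rightarrow> real list \<Rightarrow> real list \<Rightarrow> real \<Rightarrow> complex"
  where "meijer_G_p0_pp g d as bs z =
    (if z < 1 then
       1 / (2 * of_real pi * \<i>) * left_loop_integral g d
         (\<lambda>\<eta>. (\<Prod>(a, b)\<leftarrow>zip as bs. Gamma (of_real b + \<eta>) / Gamma (of_real a + \<eta>))
               * of_real z powr (- \<eta>))
     else 0)"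


text \<open>The conditions on the contours of the two kernels: \<open>S\<^sub>\<sigma>\<close> is the left loop given by
  \<open>a = -c\<close> and \<open>d = \<delta>\<close>, \<open>S\<^sub>\<zeta>\<close> is the right loop given by \<open>a = -c'\<close> and \<open>d = \<delta>'\<close>, and the
  rectangle \<open>S\<^sub>\<zeta>\<^bsup>(n)\<^esup>\<close> is \<^term>\<open>rectpath s t\<close>, which runs counterclockwise when \<open>s\<close> is the
  lower left and \<open>t\<close> the upper right corner. Since \<open>S\<^sub>\<sigma>\<close> lies in \<open>Re \<le> -c\<close>, the other two
  contours lie to its right and do not meet it.\<close>

definition sigma_contour :: "real \<Rightarrow> real \<Rightarrow> bool"
  where "sigma_contour c \<delta> \<longleftrightarrow> 0 < c \<and> c < 1 \<and> 0 < \<delta>"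

definition zeta_contour :: "real \<Rightarrow> real \<Rightarrow> real \<Rightarrow> bool"
  where "zeta_contour c c' \<delta>' \<longleftrightarrow> 0 < c' \<and> c' < c \<and> 0 < \<delta>'"

definition zeta_rectangle :: "real \<Rightarrow> nat \<Rightarrow> complex \<Rightarrow> complex \<Rightarrow> bool"
  where "zeta_rectangle c n s t \<longleftrightarrow>
    - c < Re s \<and> Re s < 0 \<and> real n - 1 < Re t \<and> Re t < real n \<and> Im s < 0 \<and> 0 < Im t"


text \<open>A sequence \<open>l\<close> supplies \<open>\<ell>\<^sub>1, \<ell>\<^sub>2, \<dots>\<close>; its value at \<open>0\<close> is replaced by \<open>\<ell>\<^sub>0 = -n\<close>.\<close>

definition with_ell0 :: "nat \<Rightarrow> (nat \<Rightarrow> nat) \<Rightarrow> nat \<Rightarrow> int"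
  where "with_ell0 n l j = (if j = 0 then - int n else int (l j))"

text \<open>The kernels. The arguments before \<open>n\<close> and \<open>\<nu>\<close>, respectively, only specify the contours:
  \<open>g, d\<close> (or \<open>g\<close>) that of the Meijer function, \<open>c, \<delta>\<close> that of \<open>\<sigma>\<close>, and \<open>s, t\<close> (or \<open>c', \<delta>'\<close>)
  that of \<open>\<zeta>\<close>. In \<open>truncated_kernel\<close>, \<open>\<nu> 0 = 1\<close> is meant. Library conventions make
  \<^term>\<open>1 / Gamma z\<close> zero at the poles of \<^term>\<open>Gamma\<close>, in agreement with the entire function
  \<open>1/\<Gamma>\<close>; no contour passes through a pole of a Gamma function in a numerator.\<close>

fun truncated_kernel ::
  "real \<Rightarrow> real \<Rightarrow> real \<Rightarrow> real \<Rightarrow> complex \<Rightarrow> complex \<Rightarrow> nat \<Rightarrow> (nat \<Rightarrow> nat) \<Rightarrow> (nat \<Rightarrow> nat)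
    \<Rightarrow> nat \<times> real \<Rightarrow> nat \<times> real \<Rightarrow> complex"
  where "truncated_kernel g d c \<delta> s t n \<nu> l (q, x) (r, y) =
    - (if r > q then
         1 / of_real x * meijer_G_p0_pp g d
           (map (\<lambda>j. real (\<nu> j) + real (l j) - 1) [q+1..<r+1])
           (map (\<lambda>j. real (\<nu> j) - 1) [q+1..<r+1]) (y / x)
       else 0)
    + 1 / (2 * of_real pi * \<i>) * left_loop_integral (- c) \<delta> (\<lambda>\<sigma>.
        1 / (2 * of_real pi * \<i>) * contour_integral (rectpath s t) (\<lambda>\<zeta>.
          (\<Prod>j=0..r. Gamma (of_nat (\<nu> j) + \<sigma>)) / (\<Prod>j=0..q. Gamma (of_nat (\<nu> j) + \<zeta>))
          * ((\<Prod>j=0..q. Gamma (of_nat (\<nu> j) + of_int (with_ell0 n l j) + \<zeta>))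
             / (\<Prod>j=0..r. Gamma (of_nat (\<nu> j) + of_int (with_ell0 n l j) + \<sigma>)))
          * (of_real x powr \<zeta> * of_real y powr (- \<sigma> - 1) / (\<sigma> - \<zeta>))))"

fun hard_edge_kernel ::
  "real \<Rightarrow> real \<Rightarrow> real \<Rightarrow> real \<Rightarrow> real \<Rightarrow> (nat \<Rightarrow> nat) \<Rightarrow> nat \<times> real \<Rightarrow> nat \<times> real \<Rightarrow> complex"
  where "hard_edge_kernel g c \<delta> c' \<delta>' \<nu> (q, x) (r, y) =
    - (if r > q then
         1 / of_real x * meijer_G_p0_0p g (map (\<lambda>j. real (\<nu> j) - 1) [q+1..<r+1]) (y / x)
       else 0)
    + 1 / (2 * of_real pi * \<i>) * left_loop_integral (- c) \<delta> (\<lambda>\<sigma>.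
        1 / (2 * of_real pi * \<i>) * right_loop_integral (- c') \<delta>' (\<lambda>\<zeta>.
          (\<Prod>j=1..r. Gamma (\<sigma> + of_nat (\<nu> j))) / (\<Prod>j=1..q. Gamma (\<zeta> + of_nat (\<nu> j)))
          * (Gamma (- \<zeta>) / Gamma (- \<sigma>))
          * (of_real x powr \<zeta> * of_real y powr (- \<sigma> - 1) / (\<sigma> - \<zeta>))))"

fun hard_edge_scaling :: "nat \<Rightarrow> (nat \<Rightarrow> nat) \<Rightarrow> (nat \<Rightarrow> nat) \<Rightarrow> nat \<times> real \<Rightarrow> nat \<times> real"
  where "hard_edge_scaling n \<nu> l (q, x) = (q, x / (real n * (\<Prod>j=1..q. real (l j) + real (\<nu> j))))"

definition hard_edge_prefactor :: "nat \<Rightarrow> (nat \<Rightarrow> nat) \<Rightarrow> (nat \<Rightarrow> nat) \<Rightarrow> nat \<Rightarrow> nat \<Rightarrow> real"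
  where "hard_edge_prefactor n \<nu> l q r =
    (1 / real n * (\<Prod>j=1..r. Gamma (real (\<nu> j) + real (l j))))
    / ((\<Prod>j=1..r. real (l j) + real (\<nu> j)) * (\<Prod>j=1..q. Gamma (real (\<nu> j) + real (l j))))"

end

theory Submission
  imports Defs
begin

text \<open>
  Write \<open>L\<^sub>j = \<nu>\<^sub>j + \<ell>\<^sub>j\<close>. After rescaling, everything in the truncated kernel that depends on \<open>\<alpha>\<close> is
  built from two of Euler's finite products,
  \<open>\<Gamma>(L) L\<^sup>\<sigma> \<Gamma>(\<nu> + \<sigma>) / \<Gamma>(L + \<sigma>)\<close>, which tends to \<open>\<Gamma>(\<nu> + \<sigma>)\<close>, and
  \<open>n\<^sup>\<sigma> (- \<sigma>) (1 - \<sigma>) \<cdots> (n - 1 - \<sigma>) / (n - 1)!\<close>, which tends to \<open>1 / \<Gamma>(- \<sigma>)\<close>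
  (\<open>trunc_Gamma\<close> and \<open>trunc_rGamma\<close>). The limit is therefore clear pointwise, and the content
  of the proof is domination on unbounded contours.

  The integral over \<open>\<zeta>\<close> needs no estimate on a contour: as a function of \<open>\<zeta>\<close> the integrand of the
  truncated kernel has only the simple poles \<open>0, \<dots>, n - 1\<close>, and that of the hard-edge kernel the
  simple poles of \<open>\<Gamma>(- \<zeta>)\<close> at \<open>0, 1, 2, \<dots>\<close>. Both inner integrals are sums over residues
  (\<open>truncated_zeta_integral\<close>, \<open>hard_zeta_integral\<close>). The residue at \<open>k\<close> carries
  factors \<open>L (L + 1) \<cdots> (L + k - 1) / L\<^sup>k\<close>, and since \<open>k < n \<le> \<ell>\<^sub>j\<close> each of them is at most \<open>2\<^sup>k\<close>,
  which the factor \<open>1 / k!\<close> absorbs. This is where \<open>n \<lless> \<ell>\<^sub>j\<close> enters, and Tannery's theorem applies.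

  The integral over \<open>\<sigma>\<close> runs along a loop to \<open>-\<infinity>\<close>. Moving \<open>\<sigma>\<close> one unit to the left multiplies the
  two Euler products by at most \<open>1 / L + 1 / \<bar>\<sigma> + \<nu> - 1\<bar>\<close> and \<open>1 / n + 1 / \<bar>\<sigma>\<bar>\<close>. Far to the left and
  for large \<open>n\<close> and \<open>L\<close> these factors are as small as desired, so that, uniformly in all large \<open>\<alpha>\<close>, the
  products decay faster than any prescribed exponential, and in particular beat \<open>\<bar>y\<^sup>-\<^sup>\<sigma>\<bar>\<close>
  (\<open>trunc_Gamma_loop_bound\<close>, \<open>trunc_rGamma_loop_bound\<close>). Dominated convergence gives
  \<open>double_integral_tendsto\<close>.

  The Meijer function of the truncated kernel is treated in the same way along its own loop; the
  limit is the loop integral of \<open>\<Prod>\<^sub>j \<Gamma>(\<nu>\<^sub>j - 1 + \<eta>) z\<^sup>-\<^sup>\<eta>\<close>, which Cauchy's theorem moves to the vertical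
  line in the definition of the hard-edge kernel (\<open>Gamma_prod_left_loop_eq_vertical\<close>).

  Uniformity on \<open>A \<times> B\<close> is obtained by proving all limits along arbitrary sequences of points
  \<open>(x\<^sub>\<alpha>, y\<^sub>\<alpha>)\<close>; compactness enters only through a bound on \<open>\<bar>ln x\<^sub>\<alpha>\<bar>\<close> and \<open>\<bar>ln y\<^sub>\<alpha>\<bar>\<close>.
\<close>

section \<open>Integrals along straight contours\<close>

definition left_loop :: "real \<Rightarrow> real \<Rightarrow> complex set"
  where "left_loop a d = {z. Re z \<le> a \<and> \<bar>Im z\<bar> = d} \<union> {z. Re z = a \<and> \<bar>Im z\<bar> \<le> d}"

lemma continuous_on_Complex_line [continuous_intros]:
  "continuous_on S f \<Longrightarrow> continuous_on S g \<Longrightarrow> continuous_on S (\<lambda>t. Complex (f t) (g t))"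
  by (simp add: Complex_eq continuous_intros)

lemma contour_integral_horizontal:
  assumes "a \<le> b" and cont: "continuous_on {a..b} (\<lambda>t. f (Complex t d))"
  shows "contour_integral (linepath (Complex a d) (Complex b d)) f
    = (LINT t:{a..b}|lborel. f (Complex t d))"
proof (cases "a = b")
  case True
  have "negligible {b}" by simp
  with True show ?thesis
    using set_borel_integral_eq_integral(2)[OF borel_integrable_atLeastAtMost'[OF cont]] by simp
next
  case False
  with assms have ab: "a < b" by simp
  have "contour_integral (linepath (Complex a d) (Complex b d)) f
    = (Complex b d - Complex a d) * integral {0..1} (\<lambda>x. f (linepath (Complex a d) (Complex b d) x))"
    by (simp add: contour_integral_integral)
  also have "Complex b d - Complex a d = of_real (b - a)"
    by (simp add: complex_eq_iff)
  also have "integral {0..1} (\<lambda>x. f (linepath (Complex a d) (Complex b d) x)) =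
             integral {0..(b - a) / (b - a)} (\<lambda>x. f (Complex (a + (b - a) * x) d))"
    using ab by (intro arg_cong2[where f=integral] ext arg_cong[where f=f])
      (auto simp: linepath_def complex_eq_iff algebra_simps)
  also have "{0..(b - a) / (b - a)} = (\<lambda>x. x / (b - a)) ` {0..b - a}"
    using ab by simp
  also have "integral \<dots> (\<lambda>x. f (Complex (a + (b - a) * x) d)) =
             integral {a-a..b-a} (\<lambda>x. f (Complex (x + a) d)) / of_real (b - a)"
    using ab by (subst integral_stretch_real) (auto simp: scaleR_conv_of_real add_ac)
  also have "\<dots> = integral {a..b} (\<lambda>x. f (Complex x d)) / of_real (b - a)"
    by (subst integral_shift_real_ivl) (rule refl)
  finally show ?thesis
    using ab set_borel_integral_eq_integral(2)[OF borel_integrable_atLeastAtMost'[OF cont]] by simp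
qed

lemma contour_integral_vertical:
  assumes "a \<le> b" and cont: "continuous_on {a..b} (\<lambda>t. f (Complex c t))"
  shows "contour_integral (linepath (Complex c a) (Complex c b)) f
    = \<i> * (LINT t:{a..b}|lborel. f (Complex c t))"
proof (cases "a = b")
  case True
  with assms show ?thesis
    using set_borel_integral_eq_integral(2)[OF borel_integrable_atLeastAtMost'[OF cont]] by simp
next
  case False
  with assms show ?thesis
    by (subst contour_integral_linepath_same_Re[of _ c _ a b])
      (auto simp: set_borel_integral_eq_integral(2)[OF borel_integrable_atLeastAtMost'[OF cont]])
qed

text \<open>
  If the function is not integrable along the segment, both sides are zero by convention.
\<close>

lemma contour_integral_linepath_reverse:
  "contour_integral (linepath b a) f = - contour_integral (linepath a b) f"
proof (cases "f contour_integrable_on linepath a b")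
  case True
  then show ?thesis
    by (metis contour_integral_reversepath reversepath_linepath valid_path_linepath)
next
  case False
  then have "\<not> f contour_integrable_on linepath b a"
    by (metis contour_integrable_reversepath reversepath_linepath valid_path_linepath)
  with False show ?thesis by (simp add: not_integrable_contour_integral)
qed

lemma contour_integral_rectpath_edges:
  assumes ab: "a \<le> b" "c \<le> d"
    and cont: "continuous_on (path_image (rectpath (Complex a c) (Complex b d))) f"
  shows "contour_integral (rectpath (Complex a c) (Complex b d)) f
    = (LINT t:{a..b}|lborel. f (Complex t c)) + \<i> * (LINT t:{c..d}|lborel. f (Complex b t))
      - (LINT t:{a..b}|lborel. f (Complex t d)) - \<i> * (LINT t:{c..d}|lborel. f (Complex a t))"
proof -
  note im = path_image_rectpath[of "Complex a c" "Complex b d"]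
  have sub: "closed_segment (Complex a c) (Complex b c) \<subseteq> path_image (rectpath (Complex a c) (Complex b d))"
    "closed_segment (Complex b c) (Complex b d) \<subseteq> path_image (rectpath (Complex a c) (Complex b d))"
    "closed_segment (Complex b d) (Complex a d) \<subseteq> path_image (rectpath (Complex a c) (Complex b d))"
    "closed_segment (Complex a d) (Complex a c) \<subseteq> path_image (rectpath (Complex a c) (Complex b d))"
    by (auto simp: rectpath_def Let_def path_image_join)
  have int: "f contour_integrable_on linepath (Complex a c) (Complex b c)"
    "f contour_integrable_on linepath (Complex b c) (Complex b d)"
    "f contour_integrable_on linepath (Complex b d) (Complex a d)"
    "f contour_integrable_on linepath (Complex a d) (Complex a c)"
    by (intro contour_integrable_continuous_linepath continuous_on_subset[OF cont] sub)+
  have "contour_integral (rectpath (Complex a c) (Complex b d)) f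
    = contour_integral (linepath (Complex a c) (Complex b c)) f
      + contour_integral (linepath (Complex b c) (Complex b d)) f
      + contour_integral (linepath (Complex b d) (Complex a d)) f
      + contour_integral (linepath (Complex a d) (Complex a c)) f"
    unfolding rectpath_def Let_def using int by simp
  moreover have "continuous_on {a..b} (\<lambda>t. f (Complex t c))" "continuous_on {a..b} (\<lambda>t. f (Complex t d))"
    "continuous_on {c..d} (\<lambda>t. f (Complex a t))" "continuous_on {c..d} (\<lambda>t. f (Complex b t))"
    using ab by (auto intro!: continuous_on_compose2[OF cont] continuous_intros simp: im)
  ultimately show ?thesis
    using ab contour_integral_horizontal[of a b f c] contour_integral_horizontal[of a b f d]
      contour_integral_vertical[of c d f a] contour_integral_vertical[of c d f b]
      contour_integral_linepath_reverse[of "Complex b d" "Complex a d" f]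
      contour_integral_linepath_reverse[of "Complex a d" "Complex a c" f]
    by simp
qed

lemma set_integrable_exp_atMost: "set_integrable lborel {..a::real} (\<lambda>t. K * exp t)"
proof -
  have "(\<integral>\<^sup>+x. ennreal (exp (- x)) * indicator {-a ..} x \<partial>lborel) = ennreal (0 - (- exp (- (- a))))"
    by (rule nn_integral_FTC_atLeast)
      (auto intro!: derivative_eq_intros tendsto_minus[OF filterlim_compose[OF exp_at_bot filterlim_uminus_at_bot_at_top], simplified])
  then have "integrable lborel (\<lambda>x. indicator {-a..} x *\<^sub>R exp (- x))"
    by (intro integrableI_nonneg)
      (auto simp: ennreal_indicator ennreal_mult' mult.commute split: split_indicator)
  then have "integrable lborel (\<lambda>x. indicator {-a..} (0 + (-1) * x) *\<^sub>R exp (- (0 + (-1) * x)))"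
    by (rule lborel_integrable_real_affine) simp
  moreover have "(\<lambda>x::real. indicator {-a..} (0 + (-1) * x) *\<^sub>R exp (- (0 + (-1) * x)))
      = (\<lambda>x. indicator {..a} x *\<^sub>R exp x)"
    by (auto split: split_indicator)
  ultimately show ?thesis
    by (intro set_integrable_mult_right) (simp add: set_integrable_def)
qed

lemma set_integrable_exp_decay:
  fixes f :: "real \<Rightarrow> complex"
  assumes "continuous_on {..a} f" and "\<And>t. t \<le> a \<Longrightarrow> norm (f t) \<le> K * exp t"
  shows "set_integrable lborel {..a} f"
proof (rule set_integrable_bound[OF set_integrable_exp_atMost])
  show "set_borel_measurable lborel {..a} f"
    using assms(1) unfolding set_borel_measurable_def
    by (simp add: borel_measurable_continuous_on_indicator)
  show "AE x in lborel. x \<in> {..a} \<longrightarrow> norm (f x) \<le> norm (K * exp x)"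
    using assms(2) by (force intro!: AE_I2)
qed

lemma set_integrable_inverse_square:
  assumes "d > (0::real)"
  shows "set_integrable lborel {d..} (\<lambda>t. K / t\<^sup>2)"
proof -
  have "((\<lambda>t::real. - 1 / t) \<longlongrightarrow> 0) at_top"
    by (intro tendsto_divide_0[OF tendsto_const] filterlim_at_top_imp_at_infinity filterlim_ident)
  then have "(\<integral>\<^sup>+x. ennreal (1 / x\<^sup>2) * indicator {d..} x \<partial>lborel) = ennreal (0 - (- 1 / d))"
    using assms
    by (intro nn_integral_FTC_atLeast)
      (auto intro!: derivative_eq_intros simp: power2_eq_square)
  moreover have "ennreal (1 / x\<^sup>2) * indicator {d..} x = ennreal (indicator {d..} x *\<^sub>R (1 / x\<^sup>2))" for x :: real
    by (auto split: split_indicator)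
  ultimately have "integrable lborel (\<lambda>x. indicator {d..} x *\<^sub>R (1 / x\<^sup>2))"
    by (intro integrableI_nonneg) auto
  then have "set_integrable lborel {d..} (\<lambda>t. K * (1 / t\<^sup>2))"
    by (intro set_integrable_mult_right) (simp add: set_integrable_def)
  then show ?thesis by simp
qed

lemma set_integral_split_Icc:
  fixes f :: "real \<Rightarrow> complex"
  assumes "g \<le> g'" "set_integrable lborel {..g'} f"
  shows "(LINT t:{..g'}|lborel. f t) = (LINT t:{..g}|lborel. f t) + (LINT t:{g..g'}|lborel. f t)"
proof -
  have "{..g'} = {..g} \<union> {g..g'}" using assms by auto
  then show ?thesis
    using AE_lborel_singleton[of g]
    by (simp, intro set_integral_Un_AE) (auto elim!: eventually_mono intro: set_integrable_subset[OF assms(2)])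
qed

lemma norm_set_integral_Icc_le:
  fixes f :: "real \<Rightarrow> complex"
  assumes "a \<le> b" "continuous_on {a..b} f" "\<And>t. t \<in> {a..b} \<Longrightarrow> norm (f t) \<le> B"
  shows "norm (LINT t:{a..b}|lborel. f t) \<le> B * (b - a)"
proof -
  note int = borel_integrable_atLeastAtMost'[OF assms(2)]
  have "norm (LINT t:{a..b}|lborel. f t) = norm (integral {a..b} f)"
    using set_borel_integral_eq_integral(2)[OF int] by simp
  also have "\<dots> \<le> B * (b - a)"
    by (rule integral_bound) (use assms in auto)
  finally show ?thesis .
qed

lemma continuous_on_left_loop_pieces:
  assumes "continuous_on (left_loop a d) f" "d > 0"
  shows "continuous_on {..a} (\<lambda>t. f (Complex t d))" "continuous_on {..a} (\<lambda>t. f (Complex t (- d)))"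
    "continuous_on {-d..d} (\<lambda>t. f (Complex a t))"
  using assms(2) by (auto intro!: continuous_on_compose2[OF assms(1)] continuous_intros simp: left_loop_def)

lemma left_loop_integral_eq_set_integrals:
  assumes "continuous_on (left_loop a d) f" "d > 0"
  shows "left_loop_integral a d f = (LINT t:{..a}|lborel. f (Complex t (- d)))
    + \<i> * (LINT t:{-d..d}|lborel. f (Complex a t)) - (LINT t:{..a}|lborel. f (Complex t d))"
  using contour_integral_vertical[OF _ continuous_on_left_loop_pieces(3)[OF assms]] assms(2)
  by (simp add: left_loop_integral_def)

lemma left_loop_integral_cong:
  assumes "\<And>z. z \<in> left_loop a d \<Longrightarrow> f z = g z" "d > 0"
  shows "left_loop_integral a d f = left_loop_integral a d g"
proof -
  have "contour_integral (linepath (Complex a (- d)) (Complex a d)) f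
    = contour_integral (linepath (Complex a (- d)) (Complex a d)) g"
    using assms(2) by (intro contour_integral_eq assms)
      (auto simp: left_loop_def closed_segment_same_Re closed_segment_eq_real_ivl abs_le_iff)
  moreover have "(LINT t:{..a}|lborel. f (Complex t (- d))) = (LINT t:{..a}|lborel. g (Complex t (- d)))"
    "(LINT t:{..a}|lborel. f (Complex t d)) = (LINT t:{..a}|lborel. g (Complex t d))"
    using assms by (auto intro!: set_lebesgue_integral_cong simp: left_loop_def)
  ultimately show ?thesis
    by (simp add: left_loop_integral_def)
qed

text \<open>
  For a nonzero factor the integrals with and without it exist simultaneously, and integrals that do
  not exist are zero by convention.
\<close>

lemma left_loop_integral_scale:
  assumes k: "k \<noteq> 0"
  shows "left_loop_integral a d (\<lambda>z. k * f z) = k * left_loop_integral a d f"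
proof -
  have "contour_integral p (\<lambda>z. k * f z) = k * contour_integral p f" for p
  proof (cases "f contour_integrable_on p")
    case False
    have "\<not> (\<lambda>z. k * f z) contour_integrable_on p"
    proof
      assume "(\<lambda>z. k * f z) contour_integrable_on p"
      then have "(\<lambda>z. 1 / k * (k * f z)) contour_integrable_on p" by (rule contour_integrable_lmul)
      with k False show False by simp
    qed
    with False show ?thesis by (simp add: not_integrable_contour_integral)
  qed (rule contour_integral_lmul)
  then show ?thesis by (simp add: left_loop_integral_def algebra_simps)
qed

lemma left_loop_set_integrable:
  fixes f :: "complex \<Rightarrow> complex"
  assumes cont: "continuous_on (left_loop a d) f" and "d > 0"
    and bd: "\<And>z. z \<in> left_loop a d \<Longrightarrow> norm (f z) \<le> K * exp (Re z)"
  shows "set_integrable lborel {..a} (\<lambda>t. f (Complex t d))"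
    "set_integrable lborel {..a} (\<lambda>t. f (Complex t (- d)))"
    "set_integrable lborel {-d..d} (\<lambda>t. f (Complex a t))"
proof -
  note c = continuous_on_left_loop_pieces[OF cont \<open>d > 0\<close>]
  show "set_integrable lborel {..a} (\<lambda>t. f (Complex t d))"
    by (rule set_integrable_exp_decay[where K=K], rule c)
      (use \<open>d > 0\<close> bd[of "Complex _ d"] in \<open>auto simp: left_loop_def\<close>)
  show "set_integrable lborel {..a} (\<lambda>t. f (Complex t (- d)))"
    by (rule set_integrable_exp_decay[where K=K], rule c)
      (use \<open>d > 0\<close> bd[of "Complex _ (- d)"] in \<open>auto simp: left_loop_def\<close>)
  show "set_integrable lborel {-d..d} (\<lambda>t. f (Complex a t))"
    by (intro borel_integrable_atLeastAtMost' c)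
qed

lemma left_loop_integral_diff:
  assumes f: "continuous_on (left_loop a d) f" "\<And>z. z \<in> left_loop a d \<Longrightarrow> norm (f z) \<le> K * exp (Re z)"
    and g: "continuous_on (left_loop a d) g" "\<And>z. z \<in> left_loop a d \<Longrightarrow> norm (g z) \<le> K' * exp (Re z)"
    and d: "d > 0"
  shows "left_loop_integral a d (\<lambda>z. f z - g z) = left_loop_integral a d f - left_loop_integral a d g"
  using left_loop_set_integrable[OF f(1) d f(2)] left_loop_set_integrable[OF g(1) d g(2)] f(1) g(1) d
  by (simp add: left_loop_integral_eq_set_integrals continuous_on_diff set_integral_diff algebra_simps)

section \<open>Dominated convergence on the left loop\<close>

lemma set_integral_tendsto_0_dominated:
  fixes f :: "nat \<Rightarrow> real \<Rightarrow> complex"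
  assumes "eventually (\<lambda>n. set_integrable lborel S (f n)) sequentially"
    and "\<And>t. t \<in> S \<Longrightarrow> (\<lambda>n. f n t) \<longlonglongrightarrow> 0"
    and "eventually (\<lambda>n. \<forall>t\<in>S. norm (f n t) \<le> w t) sequentially"
    and w: "set_integrable lborel S w"
  shows "(\<lambda>n. LINT t:S|lborel. f n t) \<longlonglongrightarrow> 0"
proof -
  from assms(1,3) obtain N where N: "\<And>n. n \<ge> N \<Longrightarrow> set_integrable lborel S (f n)"
      "\<And>n t. n \<ge> N \<Longrightarrow> t \<in> S \<Longrightarrow> norm (f n t) \<le> w t"
    unfolding eventually_sequentially by (metis nle_le order_trans)
  have "(\<lambda>n. LINT t|lborel. indicator S t *\<^sub>R f (n + N) t) \<longlonglongrightarrow> (LINT (t::real)|lborel. (0::complex))"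
  proof (rule integral_dominated_convergence)
    show "integrable lborel (\<lambda>t. indicator S t *\<^sub>R w t)"
      using w by (simp add: set_integrable_def)
    show "(\<lambda>t. indicator S t *\<^sub>R f (n + N) t) \<in> borel_measurable lborel" for n
      using N(1)[of "n + N"] by (simp add: set_integrable_def borel_measurable_integrable)
    show "AE t in lborel. norm (indicator S t *\<^sub>R f (n + N) t) \<le> indicator S t *\<^sub>R w t" for n
      using N(2)[of "n + N"] by (auto split: split_indicator)
    show "AE t in lborel. (\<lambda>n. indicator S t *\<^sub>R f (n + N) t) \<longlonglongrightarrow> 0"
      using LIMSEQ_ignore_initial_segment[OF assms(2), of _ N]
      by (intro AE_I2) (auto split: split_indicator)
  qed simp
  then have "(\<lambda>n. LINT t:S|lborel. f (n + N) t) \<longlonglongrightarrow> 0"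
    by (simp add: set_lebesgue_integral_def)
  then show ?thesis by (rule LIMSEQ_offset)
qed

lemma left_loop_integral_tendsto_0:
  fixes E :: "nat \<Rightarrow> complex \<Rightarrow> complex"
  assumes d: "d > 0"
    and cont: "\<forall>\<^sub>F n in sequentially. continuous_on (left_loop a d) (E n)"
    and lim: "\<And>z. z \<in> left_loop a d \<Longrightarrow> (\<lambda>n. E n z) \<longlonglongrightarrow> 0"
    and bd: "\<forall>\<^sub>F n in sequentially. \<forall>z\<in>left_loop a d. norm (E n z) \<le> K * exp (Re z)"
  shows "(\<lambda>n. left_loop_integral a d (E n)) \<longlonglongrightarrow> 0"
proof -
  have in_loop: "t \<le> a \<Longrightarrow> Complex t d \<in> left_loop a d" "t \<le> a \<Longrightarrow> Complex t (- d) \<in> left_loop a d"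
    "t \<in> {-d..d} \<Longrightarrow> Complex a t \<in> left_loop a d" for t
    using d by (auto simp: left_loop_def)
  from cont bd have ev: "\<forall>\<^sub>F n in sequentially. continuous_on (left_loop a d) (E n)
      \<and> (\<forall>z\<in>left_loop a d. norm (E n z) \<le> K * exp (Re z))"
    by (rule eventually_conj)
  have int: "\<forall>\<^sub>F n in sequentially. set_integrable lborel {..a} (\<lambda>t. E n (Complex t d))"
    "\<forall>\<^sub>F n in sequentially. set_integrable lborel {..a} (\<lambda>t. E n (Complex t (- d)))"
    "\<forall>\<^sub>F n in sequentially. set_integrable lborel {-d..d} (\<lambda>t. E n (Complex a t))"
    using ev by (eventually_elim, use left_loop_set_integrable[OF _ d] in blast)+
  have dom: "\<forall>\<^sub>F n in sequentially. \<forall>t\<in>{..a}. norm (E n (Complex t d)) \<le> K * exp t"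
    "\<forall>\<^sub>F n in sequentially. \<forall>t\<in>{..a}. norm (E n (Complex t (- d))) \<le> K * exp t"
    "\<forall>\<^sub>F n in sequentially. \<forall>t\<in>{-d..d}. norm (E n (Complex a t)) \<le> K * exp a"
    using bd by (eventually_elim, use in_loop in force)+
  note DCT = set_integral_tendsto_0_dominated[OF int(1) lim dom(1) set_integrable_exp_atMost]
    set_integral_tendsto_0_dominated[OF int(2) lim dom(2) set_integrable_exp_atMost]
    set_integral_tendsto_0_dominated[OF int(3) lim dom(3) borel_integrable_atLeastAtMost'[OF continuous_on_const]]
  have 1: "(\<lambda>n. LINT t:{..a}|lborel. E n (Complex t d)) \<longlonglongrightarrow> 0"
    and 2: "(\<lambda>n. LINT t:{..a}|lborel. E n (Complex t (-d))) \<longlonglongrightarrow> 0"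
    and 3: "(\<lambda>n. LINT t:{-d..d}|lborel. E n (Complex a t)) \<longlonglongrightarrow> 0"
    using DCT in_loop by auto
  have "(\<lambda>n. (LINT t:{..a}|lborel. E n (Complex t (- d)))
    + \<i> * (LINT t:{-d..d}|lborel. E n (Complex a t)) - (LINT t:{..a}|lborel. E n (Complex t d))) \<longlonglongrightarrow> 0 + \<i> * 0 - 0"
    by (intro tendsto_intros 1 2 3)
  moreover have "\<forall>\<^sub>F n in sequentially. (LINT t:{..a}|lborel. E n (Complex t (- d)))
    + \<i> * (LINT t:{-d..d}|lborel. E n (Complex a t)) - (LINT t:{..a}|lborel. E n (Complex t d))
    = left_loop_integral a d (E n)"
    using cont by eventually_elim (simp add: left_loop_integral_eq_set_integrals d)
  ultimately show ?thesis
    by (auto elim: Lim_transform_eventually)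
qed

text \<open>
  Dominated convergence in a form in which the limit integrand may itself depend on the index:
  it does so here through the moving points \<open>(x\<^sub>\<alpha>, y\<^sub>\<alpha>)\<close>.
\<close>

lemma left_loop_integral_diff_tendsto_0:
  fixes F G :: "nat \<Rightarrow> complex \<Rightarrow> complex"
  assumes d: "d > 0"
    and F: "\<forall>\<^sub>F n in sequentially. continuous_on (left_loop a d) (F n)"
      "\<forall>\<^sub>F n in sequentially. \<forall>z\<in>left_loop a d. norm (F n z) \<le> K * exp (Re z)"
    and G: "\<forall>\<^sub>F n in sequentially. continuous_on (left_loop a d) (G n)"
      "\<forall>\<^sub>F n in sequentially. \<forall>z\<in>left_loop a d. norm (G n z) \<le> K' * exp (Re z)"
    and lim: "\<And>z. z \<in> left_loop a d \<Longrightarrow> (\<lambda>n. F n z - G n z) \<longlonglongrightarrow> 0"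
  shows "(\<lambda>n. left_loop_integral a d (F n) - left_loop_integral a d (G n)) \<longlonglongrightarrow> 0"
proof -
  have "(\<lambda>n. left_loop_integral a d (\<lambda>z. F n z - G n z)) \<longlonglongrightarrow> 0"
  proof (rule left_loop_integral_tendsto_0[OF d _ lim])
    show "\<forall>\<^sub>F n in sequentially. continuous_on (left_loop a d) (\<lambda>z. F n z - G n z)"
      using F(1) G(1) by eventually_elim (rule continuous_on_diff)
    show "\<forall>\<^sub>F n in sequentially. \<forall>z\<in>left_loop a d. norm (F n z - G n z) \<le> (K + K') * exp (Re z)"
      using F(2) G(2)
    proof eventually_elim
      case (elim n)
      then show ?case by (auto intro!: order_trans[OF norm_triangle_ineq4] simp: distrib_right add_mono)
    qed
  qed
  moreover have "\<forall>\<^sub>F n in sequentially. left_loop_integral a d (\<lambda>z. F n z - G n z)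
      = left_loop_integral a d (F n) - left_loop_integral a d (G n)"
    using F G by eventually_elim (rule left_loop_integral_diff[OF _ _ _ _ d], auto)
  ultimately show ?thesis by (rule Lim_transform_eventually)
qed

section \<open>Deforming unbounded contours\<close>

text \<open>
  The two loops differ by the boundary of a rectangle.
\<close>

lemma left_loop_integral_shift:
  assumes d: "d > 0" and gg: "g \<le> g'"
    and cont: "continuous_on (left_loop g d) f" "continuous_on (left_loop g' d) f"
    and bd: "\<And>z. z \<in> left_loop g' d \<Longrightarrow> norm (f z) \<le> K * exp (Re z)"
    and holo: "f holomorphic_on S" "convex S" "cbox (Complex g (- d)) (Complex g' d) \<subseteq> S"
  shows "left_loop_integral g' d f = left_loop_integral g d f"
proof -
  have sub: "path_image (rectpath (Complex g (- d)) (Complex g' d)) \<subseteq> S"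
    using path_image_rectpath_subset_cbox[of "Complex g (- d)" "Complex g' d"] holo(3) gg d by auto
  have "contour_integral (rectpath (Complex g (- d)) (Complex g' d)) f = 0"
    by (rule contour_integral_unique, rule Cauchy_theorem_convex_simple[OF holo(1,2)]) (use sub in auto)
  moreover have "continuous_on (path_image (rectpath (Complex g (- d)) (Complex g' d))) f"
    using holomorphic_on_imp_continuous_on[OF holo(1)] sub continuous_on_subset by blast
  ultimately have "(LINT t:{g..g'}|lborel. f (Complex t (- d))) + \<i> * (LINT t:{-d..d}|lborel. f (Complex g' t))
      - (LINT t:{g..g'}|lborel. f (Complex t d)) - \<i> * (LINT t:{-d..d}|lborel. f (Complex g t)) = 0"
    using contour_integral_rectpath_edges[of g g' "-d" d f] gg d by simp
  moreover note si = left_loop_set_integrable[OF cont(2) d bd]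
  note set_integral_split_Icc[OF gg si(1)] set_integral_split_Icc[OF gg si(2)]
  ultimately show ?thesis
    by (simp add: left_loop_integral_eq_set_integrals d cont algebra_simps)
qed

text \<open>
  Cauchy's theorem for the contour that comes from \<open>-\<infinity> + i d\<close>, turns at \<open>g + i d\<close> and leaves
  upwards. It is the limit of rectangles; the bound is integrable in both directions, so the far
  edges contribute nothing in the limit.
\<close>

lemma quadrant_integral_eq_0:
  assumes d: "d > 0" and holo: "f holomorphic_on {z. Im z > 0}"
    and bd: "\<And>z. Re z \<le> g \<Longrightarrow> Im z \<ge> d \<Longrightarrow> norm (f z) \<le> K * exp (Re z) / (Im z)\<^sup>2"
  shows "set_integrable lborel {d..} (\<lambda>t. f (Complex g t))"
    and "(LINT t:{..g}|lborel. f (Complex t d)) + \<i> * (LINT t:{d..}|lborel. f (Complex g t)) = 0"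
proof -
  note contf = holomorphic_on_imp_continuous_on[OF holo]
  have conth: "continuous_on T (\<lambda>t. f (Complex t s))" if "s > 0" for s T
    using that by (auto intro!: continuous_on_compose2[OF contf] continuous_intros)
  have contv: "continuous_on T (\<lambda>t. f (Complex s t))" if "T \<subseteq> {0<..}" for s T
    using that by (auto intro!: continuous_on_compose2[OF contf] continuous_intros)
  show iv: "set_integrable lborel {d..} (\<lambda>t. f (Complex g t))"
  proof (rule set_integrable_bound[OF set_integrable_inverse_square[OF d]])
    show "set_borel_measurable lborel {d..} (\<lambda>t. f (Complex g t))"
      using contv[of "{d..}"] d unfolding set_borel_measurable_def
      by (simp add: borel_measurable_continuous_on_indicator subset_eq)
    show "AE x in lborel. x \<in> {d..} \<longrightarrow> norm (f (Complex g x)) \<le> norm ((K * exp g) / x\<^sup>2)"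
    proof (intro AE_I2 impI)
      fix x assume "x \<in> {d..}"
      then show "norm (f (Complex g x)) \<le> norm ((K * exp g) / x\<^sup>2)"
        using bd[of "Complex g x"] order_trans[OF _ abs_ge_self, of _ "K * exp g / x\<^sup>2"] by simp
    qed
  qed
  have ih: "set_integrable lborel {..g} (\<lambda>t. f (Complex t d))"
    by (rule set_integrable_exp_decay[where K="K / d\<^sup>2"]) (use bd[of "Complex _ d"] in \<open>auto intro!: conth d\<close>)
  have K: "K \<ge> 0"
    using order_trans[OF norm_ge_zero bd[of "Complex g d"]] d by (simp add: zero_le_divide_iff zero_le_mult_iff)
  let ?I = "\<lambda>N. (LINT t:{-real N..g}|lborel. f (Complex t d)) + \<i> * (LINT t:{d..d + real N}|lborel. f (Complex g t))"
  \<comment> \<open>The far edges of the rectangle with corners \<open>- N + i d\<close> and \<open>g + i (d + N)\<close>.\<close>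
  define e1 where "e1 N = (LINT t:{-real N..g}|lborel. f (Complex t (d + real N)))" for N
  define e2 where "e2 N = (LINT t:{d..d + real N}|lborel. f (Complex (- real N) t))" for N
  have eq: "?I N
      = e1 N + \<i> * e2 N" if "real N \<ge> \<bar>g\<bar>" for N
  proof -
    let ?p = "rectpath (Complex (- real N) d) (Complex g (d + real N))"
    have sub: "path_image ?p \<subseteq> {z. Im z > 0}"
      using path_image_rectpath_subset_cbox[of "Complex (- real N) d" "Complex g (d + real N)"] that d
      by (fastforce simp: in_cbox_complex_iff)
    have "contour_integral ?p f = 0"
      by (rule contour_integral_unique, rule Cauchy_theorem_convex_simple[OF holo convex_halfspace_Im_gt])
        (use sub in auto)
    moreover have "continuous_on (path_image ?p) f"
      using contf sub continuous_on_subset by blast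
    ultimately show ?thesis
      using contour_integral_rectpath_edges[of "- real N" g d "d + real N" f] that
      by (simp add: e1_def e2_def algebra_simps)
  qed
  have "e1 \<longlonglongrightarrow> 0"
  proof (rule Lim_null_comparison)
    show "\<forall>\<^sub>F N in sequentially. norm (e1 N) \<le> K * exp g / (d + real N)\<^sup>2 * (g - (- real N))"
      using eventually_ge_at_top[of "nat \<lceil>\<bar>g\<bar>\<rceil>"]
    proof eventually_elim
      case (elim N)
      then have "\<bar>g\<bar> \<le> real N" by linarith
      then show ?case unfolding e1_def
      proof (intro norm_set_integral_Icc_le)
        fix t assume "t \<in> {- real N..g}"
        then have "norm (f (Complex t (d + real N))) \<le> K * exp t / (d + real N)\<^sup>2"
          using bd[of "Complex t (d + real N)"] by simp
        also have "\<dots> \<le> K * exp g / (d + real N)\<^sup>2"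
          using K \<open>t \<in> _\<close> by (intro divide_right_mono mult_left_mono) auto
        finally show "norm (f (Complex t (d + real N))) \<le> K * exp g / (d + real N)\<^sup>2" .
      qed (use d in \<open>auto intro!: conth\<close>)
    qed
    have "(\<lambda>N. K * exp g / (d + real N) * ((g + real N) / (d + real N))) \<longlonglongrightarrow> 0 * 1"
    proof (intro tendsto_mult)
      have inf: "filterlim (\<lambda>N. d + real N) at_top sequentially"
        by (intro filterlim_tendsto_add_at_top[OF tendsto_const] filterlim_real_sequentially)
      then show "(\<lambda>N. K * exp g / (d + real N)) \<longlonglongrightarrow> 0"
        by (intro tendsto_divide_0[OF tendsto_const]) (rule filterlim_at_top_imp_at_infinity)
      have "(\<lambda>N. 1 + (g - d) / (d + real N)) \<longlonglongrightarrow> 1 + 0"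
        by (intro tendsto_add tendsto_const tendsto_divide_0[OF tendsto_const]
              filterlim_at_top_imp_at_infinity inf)
      moreover have "1 + (g - d) / (d + real N) = (g + real N) / (d + real N)" for N
        using d by (simp add: field_simps)
      ultimately show "(\<lambda>N. (g + real N) / (d + real N)) \<longlonglongrightarrow> 1" by simp
    qed
    then show "(\<lambda>N. K * exp g / (d + real N)\<^sup>2 * (g - (- real N))) \<longlonglongrightarrow> 0"
      by (simp add: power2_eq_square field_simps)
  qed
  moreover have "e2 \<longlonglongrightarrow> 0"
  proof (rule Lim_null_comparison)
    show "\<forall>\<^sub>F N in sequentially. norm (e2 N) \<le> K * exp (- real N) / d\<^sup>2 * (d + real N - d)"
      using eventually_ge_at_top[of "nat \<lceil>\<bar>g\<bar>\<rceil>"]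
    proof eventually_elim
      case (elim N)
      then have N: "\<bar>g\<bar> \<le> real N" by linarith
      show ?case unfolding e2_def
      proof (intro norm_set_integral_Icc_le)
        fix t assume t: "t \<in> {d..d + real N}"
        then have "norm (f (Complex (- real N) t)) \<le> K * exp (- real N) / t\<^sup>2"
          using bd[of "Complex (- real N) t"] N by simp
        also have "\<dots> \<le> K * exp (- real N) / d\<^sup>2"
          using K t d by (intro divide_left_mono) auto
        finally show "norm (f (Complex (- real N) t)) \<le> K * exp (- real N) / d\<^sup>2" .
      qed (use d in \<open>auto intro!: contv\<close>)
    qed
    have "((\<lambda>x::real. x ^ 1 / exp x) \<longlongrightarrow> 0) at_top"
      by (rule tendsto_power_div_exp_0)
    from filterlim_compose[OF this filterlim_real_sequentially]
    have "(\<lambda>N. K / d\<^sup>2 * (real N ^ 1 / exp (real N))) \<longlonglongrightarrow> K / d\<^sup>2 * 0"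
      by (intro tendsto_mult tendsto_const)
    then show "(\<lambda>N. K * exp (- real N) / d\<^sup>2 * (d + real N - d)) \<longlonglongrightarrow> 0"
      by (simp add: exp_minus field_simps)
  qed
  ultimately have "(\<lambda>N. e1 N + \<i> * e2 N) \<longlonglongrightarrow> 0 + \<i> * 0"
    by (intro tendsto_intros)
  moreover have "\<forall>\<^sub>F N in sequentially. e1 N + \<i> * e2 N =
      ?I N"
    using eventually_ge_at_top[of "nat \<lceil>\<bar>g\<bar>\<rceil>"]
  proof eventually_elim
    case (elim N)
    then have "\<bar>g\<bar> \<le> real N" by linarith
    from eq[OF this] show ?case by simp
  qed
  ultimately have "(\<lambda>N. ?I N) \<longlonglongrightarrow> 0 + \<i> * 0"
    by (rule Lim_transform_eventually)
  moreover have "(\<lambda>N. ?I N)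
      \<longlonglongrightarrow> (LINT t:{..g}|lborel. f (Complex t d)) + \<i> * (LINT t:{d..}|lborel. f (Complex g t))"
  proof (intro tendsto_add tendsto_mult tendsto_const)
    have "filterlim (\<lambda>N. - real N) at_bot sequentially"
      by (rule filterlim_compose[OF filterlim_uminus_at_bot_at_top filterlim_real_sequentially])
    then show "(\<lambda>N. LINT t:{-real N..g}|lborel. f (Complex t d)) \<longlonglongrightarrow> (LINT t:{..g}|lborel. f (Complex t d))"
      by (rule filterlim_compose[OF tendsto_set_lebesgue_integral_at_bot[OF _ ih], rotated]) simp
    have "filterlim (\<lambda>N. d + real N) at_top sequentially"
      by (intro filterlim_tendsto_add_at_top[OF tendsto_const] filterlim_real_sequentially)
    then show "(\<lambda>N. LINT t:{d..d + real N}|lborel. f (Complex g t)) \<longlonglongrightarrow> (LINT t:{d..}|lborel. f (Complex g t))"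
      by (rule filterlim_compose[OF tendsto_set_lebesgue_integral_at_top[OF _ iv], rotated]) simp
  qed
  ultimately show "(LINT t:{..g}|lborel. f (Complex t d)) + \<i> * (LINT t:{d..}|lborel. f (Complex g t)) = 0"
    using LIMSEQ_unique by fastforce
qed

text \<open>
  The horizontal rays of the loop are bent into the two halves of the vertical line. The lower
  quadrant is the upper one for the function \<open>cnj \<circ> f \<circ> cnj\<close>.
\<close>

lemma left_loop_integral_eq_vertical_line_integral:
  assumes d: "d > 0" and holo: "f holomorphic_on {z. Im z > 0}" "f holomorphic_on {z. Im z < 0}"
    and cont: "continuous_on {z. Re z = g} f"
    and bd: "\<And>z. Re z \<le> g \<Longrightarrow> \<bar>Im z\<bar> \<ge> d \<Longrightarrow> norm (f z) \<le> K * exp (Re z) / (Im z)\<^sup>2"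
  shows "left_loop_integral g d f = vertical_line_integral g f"
proof -
  define f2 where "f2 = cnj \<circ> f \<circ> cnj"
  have "cnj ` {z. Im z > 0} = {z. Im z < 0}"
    by (auto simp: image_iff intro!: exI[of _ "cnj _"])
  then have "f2 holomorphic_on {z. Im z > 0}"
    unfolding f2_def by (intro holomorphic_on_compose_cnj_cnj) (simp_all add: holo open_halfspace_Im_gt)
  then have q2: "set_integrable lborel {d..} (\<lambda>t. f2 (Complex g t))"
    "(LINT t:{..g}|lborel. f2 (Complex t d)) + \<i> * (LINT t:{d..}|lborel. f2 (Complex g t)) = 0"
    using quadrant_integral_eq_0[OF d, of f2 g K] bd[of "cnj _"] by (simp_all add: f2_def)
  have bd': "norm (f z) \<le> K * exp (Re z) / (Im z)\<^sup>2" if "Re z \<le> g" "Im z \<ge> d" for z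
    using bd[of z] that by simp
  note q1 = quadrant_integral_eq_0[OF d holo(1) bd']
  have low: "(LINT t:{..g}|lborel. f (Complex t (- d))) = \<i> * (LINT t:{..-d}|lborel. f (Complex g t))"
    and lowi: "set_integrable lborel {..-d} (\<lambda>t. f (Complex g t))"
  proof -
    have eq: "f2 (Complex x y) = cnj (f (Complex x (- y)))" for x y
      by (simp add: f2_def complex_cnj)
    have ind: "indicator {d..} (- t) = (indicator {..-d} t :: real)" for t
      by (auto split: split_indicator)
    have "integrable lborel (\<lambda>t. cnj (indicator {d..} t *\<^sub>R f2 (Complex g t)))"
      using q2(1) by (intro integrable_cnj) (simp add: set_integrable_def)
    then have "integrable lborel (\<lambda>t. indicator {d..} t *\<^sub>R f (Complex g (- t)))"
      by (simp add: eq complex_cnj_scaleR)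
    from lborel_integrable_real_affine[OF this, of "-1" 0]
    show "set_integrable lborel {..-d} (\<lambda>t. f (Complex g t))"
      by (simp add: set_integrable_def ind)
    have "(LINT t|lborel. indicator {d..} t *\<^sub>R f (Complex g (- t)))
        = (LINT t|lborel. indicator {..-d} t *\<^sub>R f (Complex g t))"
      by (subst lborel_integral_real_affine[of "-1" _ 0]) (simp_all add: ind)
    moreover have "cnj ((LINT t:{..g}|lborel. f2 (Complex t d)) + \<i> * (LINT t:{d..}|lborel. f2 (Complex g t))) = 0"
      using q2(2) by simp
    ultimately show "(LINT t:{..g}|lborel. f (Complex t (- d))) = \<i> * (LINT t:{..-d}|lborel. f (Complex g t))"
      by (simp add: set_lebesgue_integral_def eq complex_cnj_scaleR del: Bochner_Integration.integral_cnj flip: Bochner_Integration.integral_cnj)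
  qed
  have mid: "continuous_on {-d..d} (\<lambda>t. f (Complex g t))"
    by (auto intro!: continuous_on_compose2[OF cont] continuous_intros)
  have cl: "continuous_on (left_loop g d) f"
  proof -
    have "continuous_on {z. \<bar>Im z\<bar> = d \<and> Re z \<le> g} f"
    proof -
      have "{z. \<bar>Im z\<bar> = d \<and> Re z \<le> g} = {z. Im z = d \<and> Re z \<le> g} \<union> {z. Im z = - d \<and> Re z \<le> g}"
        using d by auto
      moreover have "closed {z. Im z = d \<and> Re z \<le> g}" "closed {z. Im z = - d \<and> Re z \<le> g}"
        by (intro closed_Collect_conj closed_Collect_eq closed_Collect_le continuous_intros)+
      moreover have "continuous_on {z. Im z = d \<and> Re z \<le> g} f"
        by (rule continuous_on_subset[OF holomorphic_on_imp_continuous_on[OF holo(1)]]) (use d in auto)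
      moreover have "continuous_on {z. Im z = - d \<and> Re z \<le> g} f"
        by (rule continuous_on_subset[OF holomorphic_on_imp_continuous_on[OF holo(2)]]) (use d in auto)
      ultimately show ?thesis using continuous_on_closed_Un by simp
    qed
    moreover have "left_loop g d = {z. \<bar>Im z\<bar> = d \<and> Re z \<le> g} \<union> {z. Re z = g \<and> \<bar>Im z\<bar> \<le> d}"
      by (auto simp: left_loop_def)
    moreover have "closed {z. \<bar>Im z\<bar> = d \<and> Re z \<le> g}" "closed {z. Re z = g \<and> \<bar>Im z\<bar> \<le> d}"
      by (intro closed_Collect_conj closed_Collect_eq closed_Collect_le continuous_intros)+
    moreover have "continuous_on {z. Re z = g \<and> \<bar>Im z\<bar> \<le> d} f"
      by (rule continuous_on_subset[OF cont]) auto
    ultimately show ?thesis using continuous_on_closed_Un by simp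
  qed
  note midi = borel_integrable_atLeastAtMost'[OF mid]
  have ne: "AE t in lborel. t \<noteq> - d" "AE t in lborel. t \<noteq> d"
    by (rule AE_lborel_singleton)+
  have i1: "set_integrable lborel ({-d..d} \<union> {d..}) (\<lambda>t. f (Complex g t))"
    using midi q1(1) by (intro set_integrable_Un) auto
  have "(LINT t|lborel. f (Complex g t)) = (LINT t:{..-d} \<union> ({-d..d} \<union> {d..})|lborel. f (Complex g t))"
  proof -
    have "{..-d} \<union> ({-d..d} \<union> {d..}) = UNIV" using d by auto
    then show ?thesis by (simp add: set_lebesgue_integral_def)
  qed
  also have "\<dots> = (LINT t:{..-d}|lborel. f (Complex g t)) + (LINT t:{-d..d} \<union> {d..}|lborel. f (Complex g t))"
    using d by (intro set_integral_Un_AE lowi i1) (auto intro: eventually_mono[OF ne(1)])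
  also have "(LINT t:{-d..d} \<union> {d..}|lborel. f (Complex g t))
      = (LINT t:{-d..d}|lborel. f (Complex g t)) + (LINT t:{d..}|lborel. f (Complex g t))"
    by (intro set_integral_Un_AE midi q1(1)) (auto intro: eventually_mono[OF ne(2)])
  finally have split: "(LINT t|lborel. f (Complex g t)) = (LINT t:{..-d}|lborel. f (Complex g t))
      + ((LINT t:{-d..d}|lborel. f (Complex g t)) + (LINT t:{d..}|lborel. f (Complex g t)))" .
  have "(LINT t:{..g}|lborel. f (Complex t d)) = - (\<i> * (LINT t:{d..}|lborel. f (Complex g t)))"
    using q1(2) by (rule add_eq_0_iff2[THEN iffD1])
  then show ?thesis
    unfolding left_loop_integral_eq_set_integrals[OF cl d] vertical_line_integral_def split low
    by (simp add: algebra_simps)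
qed

text \<open>
  The vertical edges sit at half-integers because the integrands of interest have their poles at the
  nonnegative integers.
\<close>

lemma right_loop_integral_LIMSEQ:
  assumes d: "d > 0"
    and contr: "continuous_on {z. Re z \<ge> a \<and> \<bar>Im z\<bar> = d} f"
    and contv: "continuous_on {z. Re z = a \<and> \<bar>Im z\<bar> \<le> d} f"
    and conte: "\<And>N. continuous_on {z. Re z = 1/2 + real N \<and> \<bar>Im z\<bar> \<le> d} f"
    and bdr: "\<And>z. Re z \<ge> a \<Longrightarrow> \<bar>Im z\<bar> = d \<Longrightarrow> norm (f z) \<le> K * exp (- Re z)"
    and bde: "\<And>N z. Re z = 1/2 + real N \<Longrightarrow> \<bar>Im z\<bar> \<le> d \<Longrightarrow> norm (f z) \<le> K * exp (- Re z)"
  shows "(\<lambda>N. contour_integral (rectpath (Complex a (- d)) (Complex (1/2 + real N) d)) f)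
    \<longlonglongrightarrow> right_loop_integral a d f"
proof -
  have c: "continuous_on {a..} (\<lambda>t. f (Complex t s))" if "\<bar>s\<bar> = d" for s
    using that by (auto intro!: continuous_on_compose2[OF contr] continuous_intros)
  have i: "set_integrable lborel {a..} (\<lambda>t. f (Complex t s))" if s: "\<bar>s\<bar> = d" for s
  proof -
    have "set_integrable lborel {..-a} (\<lambda>t. f (Complex (- t) s))"
      by (rule set_integrable_exp_decay[where K=K])
        (use s bdr[of "Complex (- _) s"] in \<open>auto intro!: continuous_on_compose2[OF c] continuous_intros\<close>)
    then have "integrable lborel (\<lambda>t. indicator {..-a} t *\<^sub>R f (Complex (- t) s))"
      by (simp add: set_integrable_def)
    from lborel_integrable_real_affine[OF this, of "-1" 0]
    have "integrable lborel (\<lambda>t. indicator {..-a} (- t) *\<^sub>R f (Complex t s))" by simp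
    moreover have "indicator {..-a} (- t) = (indicator {a..} t :: real)" for t
      by (auto split: split_indicator)
    ultimately show ?thesis by (simp add: set_integrable_def)
  qed
  define e where "e N = (LINT t:{-d..d}|lborel. f (Complex (1/2 + real N) t))" for N
  have e0: "e \<longlonglongrightarrow> 0"
  proof (rule Lim_null_comparison)
    show "\<forall>\<^sub>F N in sequentially. norm (e N) \<le> K * exp (- (1/2 + real N)) * (d - (- d))"
      unfolding e_def using d
      by (intro always_eventually allI norm_set_integral_Icc_le)
        (auto intro!: order_trans[OF bde] continuous_on_compose2[OF conte] continuous_intros)
    have "(\<lambda>N. K * exp (- (1/2 + real N)) * (d - (- d))) \<longlonglongrightarrow> K * 0 * (d - (- d))"
      by (intro tendsto_intros filterlim_compose[OF exp_at_bot]
        filterlim_compose[OF filterlim_uminus_at_bot_at_top]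
        filterlim_tendsto_add_at_top[OF tendsto_const] filterlim_real_sequentially)
    then show "(\<lambda>N. K * exp (- (1/2 + real N)) * (d - (- d))) \<longlonglongrightarrow> 0" by simp
  qed
  have "(\<lambda>N. (LINT t:{a..1/2 + real N}|lborel. f (Complex t (- d))) + \<i> * e N
      - (LINT t:{a..1/2 + real N}|lborel. f (Complex t d)) - \<i> * (LINT t:{-d..d}|lborel. f (Complex a t)))
    \<longlonglongrightarrow> (LINT t:{a..}|lborel. f (Complex t (- d))) + \<i> * 0
      - (LINT t:{a..}|lborel. f (Complex t d)) - \<i> * (LINT t:{-d..d}|lborel. f (Complex a t))"
    by (intro tendsto_intros e0 filterlim_compose[OF tendsto_set_lebesgue_integral_at_top[OF _ i]]
        filterlim_tendsto_add_at_top[OF tendsto_const] filterlim_real_sequentially)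
      (use d in auto)
  also have "(LINT t:{a..}|lborel. f (Complex t (- d))) + \<i> * 0
      - (LINT t:{a..}|lborel. f (Complex t d)) - \<i> * (LINT t:{-d..d}|lborel. f (Complex a t))
    = right_loop_integral a d f"
  proof -
    have "continuous_on {-d..d} (\<lambda>t. f (Complex a t))"
      by (rule continuous_on_compose2[OF contv]) (auto intro!: continuous_intros)
    then show ?thesis
      using contour_integral_vertical[of "-d" d f a] contour_integral_linepath_reverse[of "Complex a d" "Complex a (- d)" f] d
      by (simp add: right_loop_integral_def)
  qed
  finally show ?thesis
  proof (rule Lim_transform_eventually)
    show "\<forall>\<^sub>F N in sequentially. (LINT t:{a..1/2 + real N}|lborel. f (Complex t (- d))) + \<i> * e N
      - (LINT t:{a..1/2 + real N}|lborel. f (Complex t d)) - \<i> * (LINT t:{-d..d}|lborel. f (Complex a t))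
      = contour_integral (rectpath (Complex a (- d)) (Complex (1/2 + real N) d)) f"
      using eventually_ge_at_top[of "nat \<lceil>a + 1\<rceil>"]
    proof eventually_elim
      case (elim N)
      then have N: "a \<le> 1/2 + real N" by linarith
      let ?B = "{z. Re z \<ge> a \<and> \<bar>Im z\<bar> = d} \<union> {z. Re z = a \<and> \<bar>Im z\<bar> \<le> d} \<union> {z. Re z = 1/2 + real N \<and> \<bar>Im z\<bar> \<le> d}"
      have cl: "closed {z. Re z \<ge> a \<and> \<bar>Im z\<bar> = d}" "closed {z. Re z = b \<and> \<bar>Im z\<bar> \<le> d}" for b
        by (intro closed_Collect_conj closed_Collect_eq closed_Collect_le continuous_intros)+
      have "continuous_on ?B f"
        by (intro continuous_on_closed_Un closed_Un cl contr contv conte)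
      moreover have "path_image (rectpath (Complex a (- d)) (Complex (1/2 + real N) d)) \<subseteq> ?B"
        using path_image_rectpath[of "Complex a (- d)" "Complex (1/2 + real N) d"] N d by auto
      ultimately have "continuous_on (path_image (rectpath (Complex a (- d)) (Complex (1/2 + real N) d))) f"
        using continuous_on_subset by blast
      from contour_integral_rectpath_edges[OF _ _ this] N d show ?case
        by (simp add: e_def)
    qed
  qed
qed

section \<open>Euler's products for the Gamma function\<close>

lemma pochhammer_Weierstrass:
  fixes z :: "'a :: field_char_0"
  assumes "n \<ge> 1"
  shows "pochhammer z n = z * fact (n - 1) * (\<Prod>k=1..<n. 1 + z / of_nat k)"
proof -
  have "pochhammer z n = (\<Prod>k=0..<n. z + of_nat k)"
    by (simp add: pochhammer_prod)
  also have "\<dots> = z * (\<Prod>k=1..<n. z + of_nat k)"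
    using assms by (subst prod.atLeast_Suc_lessThan) auto
  also have "(\<Prod>k=1..<n. z + of_nat k) = (\<Prod>k=1..<n. of_nat k * (1 + z / of_nat k))"
    by (intro prod.cong) (auto simp: field_simps)
  also have "\<dots> = (\<Prod>k=1..<n. of_nat k) * (\<Prod>k=1..<n. 1 + z / of_nat k)"
    by (rule prod.distrib)
  also have "(\<Prod>k=1..<n. of_nat k) = (fact (n - 1) :: 'a)"
    using assms by (cases n) (simp_all add: fact_prod atLeastLessThanSuc_atLeastAtMost)
  finally show ?thesis by (simp add: mult_ac)
qed

lemma sum_inverse_squares_le: "(\<Sum>k=1..<n. 1 / (real k)\<^sup>2) \<le> 2"
proof -
  have *: "(\<Sum>k=1..<Suc m. 1 / (real k)\<^sup>2) \<le> 2 - 1 / real m" if "m \<ge> 1" for m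
    using that
  proof (induction m rule: dec_induct)
    case (step m)
    have "1 / (real (Suc m))\<^sup>2 \<le> 1 / (real m * real (Suc m))"
      using step by (intro divide_left_mono) (auto simp: power2_eq_square)
    also have "\<dots> = 1 / real m - 1 / real (Suc m)"
      using step by (simp add: field_simps)
    finally show ?case using step.IH by simp
  qed auto
  have "(\<Sum>k=1..<n. 1 / (real k)\<^sup>2) \<le> 2 - 1 / real (n - 1)" if "n \<ge> 2" for n
    using *[of "n - 1"] that by simp
  then have "n \<ge> 2 \<Longrightarrow> ?thesis" by (rule order_trans) auto
  moreover have "n < 2 \<Longrightarrow> ?thesis" by (cases n) auto
  ultimately show ?thesis by linarith
qed

lemma sum_inverse_bounds:
  assumes "n \<ge> 1"
  shows "ln (real n) \<le> (\<Sum>k=1..<n. 1 / real k)" "(\<Sum>k=1..<n. 1 / real k) \<le> ln (real n) + 1"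
proof -
  have eq: "(\<Sum>k=1..<n. 1 / real k) = harm (n - 1)"
    using assms unfolding harm_def by (intro sum.cong) (auto simp: field_simps)
  show "ln (real n) \<le> (\<Sum>k=1..<n. 1 / real k)"
    unfolding eq using ln_le_harm[of "n - 1"] assms by (simp add: of_nat_diff)
  have "harm (n - 1) \<le> (harm n :: real)"
    by (intro harm_mono) auto
  also have "\<dots> \<le> ln (real n) + 1"
    using euler_mascheroni_sequence_decreasing[of 1 n] assms by (simp add: harm_def)
  finally show "(\<Sum>k=1..<n. 1 / real k) \<le> ln (real n) + 1"
    unfolding eq .
qed

text \<open>
  From \<open>\<bar>1 + w\<bar>\<^sup>2 = 1 + 2 Re w + \<bar>w\<bar>\<^sup>2\<close> and \<open>1 + t \<le> exp t\<close>.
\<close>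

lemma norm_1_plus_le: "norm (1 + w :: complex) \<le> exp (Re w + (norm w)\<^sup>2 / 2)"
proof -
  have "(norm (1 + w))\<^sup>2 = 1 + (2 * Re w + (norm w)\<^sup>2)"
    unfolding cmod_power2 by (simp add: power2_eq_square algebra_simps)
  also have "\<dots> \<le> exp (2 * Re w + (norm w)\<^sup>2)"
    by (rule exp_ge_add_one_self)
  also have "\<dots> = (exp (Re w + (norm w)\<^sup>2 / 2))\<^sup>2"
    by (simp add: power2_eq_square flip: exp_add)
  finally show ?thesis
    by (rule power2_le_imp_le) simp
qed

text \<open>
  In the Weierstrass form of the product, the linear terms in the exponents add up to
  \<open>Re z (ln n + O(1))\<close> and the quadratic ones to a bounded multiple of \<open>\<bar>z\<bar>\<^sup>2\<close>. The point is that
  the bound is uniform in \<open>n\<close>.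
\<close>

lemma norm_pochhammer_le:
  fixes z :: complex
  assumes n: "n \<ge> 1"
  shows "norm (pochhammer z n) \<le> norm z * exp (norm z + (norm z)\<^sup>2) * (fact (n - 1) * exp (Re z * ln n))"
proof -
  have "norm (\<Prod>k=1..<n. 1 + z / of_nat k) \<le> (\<Prod>k=1..<n. exp (Re z * (1 / real k) + (norm z)\<^sup>2 / 2 * (1 / (real k)\<^sup>2)))"
    unfolding prod_norm[symmetric]
    by (intro prod_mono conjI norm_ge_zero order_trans[OF norm_1_plus_le])
      (auto simp: norm_divide power_divide)
  also have "\<dots> = exp (\<Sum>k=1..<n. Re z * (1 / real k) + (norm z)\<^sup>2 / 2 * (1 / (real k)\<^sup>2))"
    by (simp add: exp_sum)
  also have "(\<Sum>k=1..<n. Re z * (1 / real k) + (norm z)\<^sup>2 / 2 * (1 / (real k)\<^sup>2))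
      = Re z * (\<Sum>k=1..<n. 1 / real k) + (norm z)\<^sup>2 / 2 * (\<Sum>k=1..<n. 1 / (real k)\<^sup>2)"
    by (simp add: sum.distrib sum_distrib_left)
  also have "Re z * (\<Sum>k=1..<n. 1 / real k) \<le> Re z * ln n + norm z"
  proof -
    have "Re z * ((\<Sum>k=1..<n. 1 / real k) - ln n) \<le> \<bar>Re z\<bar> * \<bar>(\<Sum>k=1..<n. 1 / real k) - ln n\<bar>"
      by (metis abs_ge_self abs_mult)
    also have "\<dots> \<le> norm z * 1"
      using sum_inverse_bounds[OF n] by (intro mult_mono abs_Re_le_cmod) auto
    finally show ?thesis by (simp add: algebra_simps)
  qed
  also have "(norm z)\<^sup>2 / 2 * (\<Sum>k=1..<n. 1 / (real k)\<^sup>2) \<le> (norm z)\<^sup>2 / 2 * 2"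
    by (intro mult_left_mono sum_inverse_squares_le) auto
  finally have "norm (\<Prod>k=1..<n. 1 + z / of_nat k) \<le> exp (Re z * ln n + norm z + (norm z)\<^sup>2 / 2 * 2)"
    by simp
  then have "norm (pochhammer z n) \<le> norm z * fact (n - 1) * exp (Re z * ln n + norm z + (norm z)\<^sup>2 / 2 * 2)"
    unfolding pochhammer_Weierstrass[OF n] norm_mult
    by (intro mult_mono) auto
  then show ?thesis by (simp add: exp_add mult_ac)
qed

text \<open>
  The lower bound that matches the preceding upper bound, from \<open>w - w\<^sup>2 \<le> ln (1 + w)\<close> for \<open>w > 0\<close>.
\<close>

lemma pochhammer_real_ge:
  fixes x :: real
  assumes n: "n \<ge> 1" and x: "x > 0"
  shows "fact (n - 1) * exp (x * ln n) \<le> exp (2 * x\<^sup>2) / x * pochhammer x n"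
proof -
  have "exp (x * (1 / real k) - x\<^sup>2 * (1 / (real k)\<^sup>2)) \<le> 1 + x / real k" if "k \<in> {1..<n}" for k
  proof -
    define w where "w = x / real k"
    have w: "w > 0" using that x by (simp add: w_def)
    have "x * (1 / real k) - x\<^sup>2 * (1 / (real k)\<^sup>2) = w - w\<^sup>2"
      by (simp add: w_def power_divide)
    also have "w - w\<^sup>2 \<le> ln (1 + w)"
    proof (cases "w \<le> 1")
      case True
      with ln_one_plus_pos_lower_bound[of w] w show ?thesis by simp
    next
      case False
      then have "w - w\<^sup>2 \<le> 0" by (simp add: power2_eq_square)
      also have "0 \<le> ln (1 + w)" using w by simp
      finally show ?thesis .
    qed
    finally show ?thesis
      using w by (simp add: w_def[symmetric] ln_ge_iff)
  qed
  then have "(\<Prod>k=1..<n. exp (x * (1 / real k) - x\<^sup>2 * (1 / (real k)\<^sup>2))) \<le> (\<Prod>k=1..<n. 1 + x / real k)"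
    by (intro prod_mono) auto
  also have "(\<Prod>k=1..<n. exp (x * (1 / real k) - x\<^sup>2 * (1 / (real k)\<^sup>2)))
      = exp (x * (\<Sum>k=1..<n. 1 / real k) - x\<^sup>2 * (\<Sum>k=1..<n. 1 / (real k)\<^sup>2))"
    by (simp add: exp_sum[symmetric] sum_subtractf sum_distrib_left)
  finally have "exp (x * ln n - x\<^sup>2 * 2) \<le> (\<Prod>k=1..<n. 1 + x / real k)"
    using x sum_inverse_squares_le[of n] sum_inverse_bounds(1)[OF n]
    by (elim order_trans[rotated]) (simp add: mult_mono diff_mono)
  then have "x * fact (n - 1) * exp (x * ln n - x\<^sup>2 * 2) \<le> pochhammer x n"
    unfolding pochhammer_Weierstrass[OF n] using x by (intro mult_left_mono) auto
  then have "exp (2 * x\<^sup>2) / x * (x * fact (n - 1) * exp (x * ln n - x\<^sup>2 * 2)) \<le> exp (2 * x\<^sup>2) / x * pochhammer x n"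
    using x by (intro mult_left_mono) auto
  also have "exp (2 * x\<^sup>2) / x * (x * fact (n - 1) * exp (x * ln n - x\<^sup>2 * 2)) = fact (n - 1) * exp (x * ln n)"
    using x by (simp add: exp_diff mult_ac)
  finally show ?thesis .
qed

lemma norm_pochhammer_ge:
  fixes z :: complex
  assumes "Re z > 0"
  shows "pochhammer (Re z) n \<le> norm (pochhammer z n)"
  unfolding pochhammer_prod prod_norm[symmetric]
proof (intro prod_mono conjI)
  fix i
  show "Re z + real i \<le> norm (z + of_nat i)"
    using complex_Re_le_cmod[of "z + of_nat i"] by simp
qed (use assms in auto)

lemma norm_Gamma_series'_le:
  fixes z :: complex
  assumes n: "n \<ge> 1" and z: "Re z > 0"
  shows "norm (Gamma_series' z n) \<le> exp (2 * (Re z)\<^sup>2) / Re z"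
proof -
  have "pochhammer (Re z) n > 0" using z by (intro pochhammer_pos)
  then have "norm (Gamma_series' z n) \<le> fact (n - 1) * exp (Re z * ln n) / pochhammer (Re z) n"
    unfolding Gamma_series'_def norm_divide norm_mult using norm_pochhammer_ge[OF z, of n]
    by (intro frac_le mult_mono) (auto simp: norm_exp)
  also have "\<dots> \<le> exp (2 * (Re z)\<^sup>2) / Re z"
    using pochhammer_real_ge[OF n z] \<open>pochhammer (Re z) n > 0\<close> by (simp add: pos_divide_le_eq)
  finally show ?thesis .
qed

lemma norm_Gamma_le:
  fixes z :: complex
  assumes "Re z > 0"
  shows "norm (Gamma z) \<le> exp (2 * (Re z)\<^sup>2) / Re z"
  by (rule tendsto_upperbound[OF tendsto_norm[OF Gamma_series'_LIMSEQ]])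
    (auto intro!: eventually_mono[OF eventually_ge_at_top[of 1]] norm_Gamma_series'_le assms)

text \<open>
  Euler's product for \<open>\<Gamma>(\<sigma> + \<nu>)\<close>, normalised at \<open>\<nu> + l\<close> instead of \<open>l\<close>: away from the poles it equals
  \<open>\<Gamma>(L) L\<^sup>\<sigma> \<Gamma>(\<nu> + \<sigma>) / \<Gamma>(L + \<sigma>)\<close> with \<open>L = \<nu> + l\<close>, which is the form in which it occurs in the
  truncated kernel.
\<close>

definition trunc_Gamma :: "nat \<Rightarrow> nat \<Rightarrow> complex \<Rightarrow> complex"
  where "trunc_Gamma \<nu> l \<sigma> = fact (\<nu> + l - 1) * exp (\<sigma> * of_real (ln (real (\<nu> + l)))) / pochhammer (\<sigma> + of_nat \<nu>) l"

text \<open>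
  The reciprocal of Euler's product for \<open>\<Gamma>(- \<sigma>)\<close>.
\<close>

definition trunc_rGamma :: "nat \<Rightarrow> complex \<Rightarrow> complex"
  where "trunc_rGamma n \<sigma> = pochhammer (- \<sigma>) n * exp (\<sigma> * of_real (ln (real n))) / fact (n - 1)"

text \<open>
  Reduces the normalisation at \<open>\<nu> + l\<close> to the library's product, up to two factors that tend to 1
  as \<open>l \<rightarrow> \<infinity>\<close>.
\<close>

lemma trunc_Gamma_eq:
  assumes "l \<ge> 1" "\<nu> \<ge> 1"
  shows "trunc_Gamma \<nu> l \<sigma> = Gamma_series' (\<sigma> + of_nat \<nu>) l * of_real (\<Prod>i<\<nu>. 1 + real i / real l)
    * exp (\<sigma> * of_real (ln (1 + real \<nu> / real l)))"
proof -
  have f: "fact (\<nu> + l - 1) = fact (l - 1) * (of_real (\<Prod>i<\<nu>. 1 + real i / real l) * of_nat l ^ \<nu> :: complex)"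
  proof -
    have "(fact (\<nu> + l - 1) :: complex) = pochhammer 1 (l - 1) * pochhammer (1 + of_nat (l - 1)) \<nu>"
      using assms pochhammer_product'[of "1 :: complex" "l - 1" \<nu>]
      by (simp add: pochhammer_fact[symmetric] add.commute)
    also have "1 + of_nat (l - 1) = (of_nat l :: complex)"
      using assms by (simp add: of_nat_diff)
    also have "pochhammer (of_nat l :: complex) \<nu> = (\<Prod>i<\<nu>. of_nat l * (1 + of_nat i / of_nat l))"
      unfolding pochhammer_prod lessThan_atLeast0 using assms by (intro prod.cong) (auto simp: field_simps)
    finally show ?thesis
      by (simp add: prod.distrib pochhammer_fact[symmetric] mult_ac)
  qed
  have e: "exp (\<sigma> * of_real (ln (real (\<nu> + l)))) * of_nat l ^ \<nu>
      = exp ((\<sigma> + of_nat \<nu>) * of_real (ln (real l))) * exp (\<sigma> * of_real (ln (1 + real \<nu> / real l)))"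
  proof -
    have "1 + real \<nu> / real l = real (\<nu> + l) / real l" using assms by (simp add: field_simps)
    then have "ln (1 + real \<nu> / real l) = ln (real (\<nu> + l)) - ln (real l)"
      using assms by (simp add: ln_div)
    moreover have "exp (of_nat \<nu> * of_real (ln (real l))) = (of_nat l :: complex) ^ \<nu>"
      using assms by (simp add: exp_of_nat_mult exp_of_real)
    ultimately show ?thesis
      by (simp add: ring_distribs exp_add exp_diff)
  qed
  show ?thesis
    unfolding trunc_Gamma_def Gamma_series'_def f using e by (simp add: mult_ac)
qed

lemma trunc_Gamma_LIMSEQ:
  assumes "\<nu> \<ge> 1"
  shows "(\<lambda>l. trunc_Gamma \<nu> l \<sigma>) \<longlonglongrightarrow> Gamma (\<sigma> + of_nat \<nu>)"
proof -
  have lim: "(\<lambda>l. real k / real l) \<longlonglongrightarrow> 0" for k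
    by (rule lim_const_over_n)
  have "(\<lambda>l. Gamma_series' (\<sigma> + of_nat \<nu>) l * of_real (\<Prod>i<\<nu>. 1 + real i / real l)
    * exp (\<sigma> * of_real (ln (1 + real \<nu> / real l))))
    \<longlonglongrightarrow> Gamma (\<sigma> + of_nat \<nu>) * of_real (\<Prod>i<\<nu>. 1 + 0) * exp (\<sigma> * of_real (ln (1 + 0)))"
    by (intro tendsto_intros Gamma_series'_LIMSEQ lim) auto
  then have "(\<lambda>l. Gamma_series' (\<sigma> + of_nat \<nu>) l * of_real (\<Prod>i<\<nu>. 1 + real i / real l)
    * exp (\<sigma> * of_real (ln (1 + real \<nu> / real l)))) \<longlonglongrightarrow> Gamma (\<sigma> + of_nat \<nu>)" by simp
  then show ?thesis
  proof (rule Lim_transform_eventually)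
    show "\<forall>\<^sub>F l in sequentially. Gamma_series' (\<sigma> + of_nat \<nu>) l * of_real (\<Prod>i<\<nu>. 1 + real i / real l)
      * exp (\<sigma> * of_real (ln (1 + real \<nu> / real l))) = trunc_Gamma \<nu> l \<sigma>"
      using eventually_ge_at_top[of 1] by eventually_elim (rule trunc_Gamma_eq[symmetric, OF _ assms])
  qed
qed

lemma norm_trunc_Gamma_le:
  assumes "l \<ge> 1" "\<nu> \<ge> 1" "Re \<sigma> + real \<nu> > 0"
  shows "norm (trunc_Gamma \<nu> l \<sigma>) \<le> exp (2 * (Re \<sigma> + real \<nu>)\<^sup>2) / (Re \<sigma> + real \<nu>) * (1 + real \<nu>) ^ \<nu> * exp (\<bar>Re \<sigma>\<bar> * ln (1 + real \<nu>))"
proof -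
  have "real i / real l \<le> real \<nu>" if "i \<le> \<nu>" for i
  proof -
    have "real i / real l \<le> real i / 1" using assms(1) by (intro divide_left_mono) auto
    with that show ?thesis by simp
  qed
  then have "(\<Prod>i<\<nu>. 1 + real i / real l) \<le> (\<Prod>i<\<nu>. 1 + real \<nu>)"
    by (intro prod_mono) auto
  moreover have "(\<Prod>i<\<nu>. 1 + real i / real l) \<ge> 0"
    by (intro prod_nonneg) auto
  ultimately have "norm (of_real (\<Prod>i<\<nu>. 1 + real i / real l) :: complex) \<le> (1 + real \<nu>) ^ \<nu>"
    unfolding norm_of_real by simp
  moreover have "norm (exp (\<sigma> * of_real (ln (1 + real \<nu> / real l)))) \<le> exp (\<bar>Re \<sigma>\<bar> * ln (1 + real \<nu>))"
  proof -
    have "Re \<sigma> * ln (1 + real \<nu> / real l) \<le> \<bar>Re \<sigma>\<bar> * ln (1 + real \<nu> / real l)"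
      by (intro mult_right_mono) auto
    also have "\<dots> \<le> \<bar>Re \<sigma>\<bar> * ln (1 + real \<nu>)"
      using \<open>\<And>i. i \<le> \<nu> \<Longrightarrow> _\<close>[of \<nu>] by (intro mult_left_mono) (auto simp: add_pos_nonneg)
    finally show ?thesis by (simp add: norm_exp)
  qed
  moreover have "norm (Gamma_series' (\<sigma> + of_nat \<nu>) l) \<le> exp (2 * (Re \<sigma> + real \<nu>)\<^sup>2) / (Re \<sigma> + real \<nu>)"
    using norm_Gamma_series'_le[of l "\<sigma> + of_nat \<nu>"] assms by simp
  ultimately show ?thesis
    unfolding trunc_Gamma_eq[OF assms(1,2)] norm_mult
    using assms by (intro mult_mono) (auto simp del: of_real_prod)
qed

text \<open>
  The recursion of the Gamma function survives truncation up to the correction \<open>1 / L\<close>. Since the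
  factor is small for large \<open>L\<close> and \<open>Re \<sigma> \<rightarrow> -\<infinity>\<close>, it is the source of all decay to the left.
\<close>

lemma trunc_Gamma_step:
  assumes "Im \<sigma> \<noteq> 0" "l \<ge> 1"
  shows "norm (trunc_Gamma \<nu> l \<sigma>) \<le> (1 / real (\<nu> + l) + 1 / norm (\<sigma> + of_nat \<nu>)) * norm (trunc_Gamma \<nu> l (\<sigma> + 1))"
proof -
  let ?w = "\<sigma> + of_nat \<nu>"
  have nz: "?w + of_nat k \<noteq> 0" for k
    using assms(1) by (auto simp: complex_eq_iff)
  from nz[of 0] have nz0: "?w \<noteq> 0" by simp
  have pz: "pochhammer ?w k \<noteq> 0" "pochhammer (?w + 1) k \<noteq> 0" for k
  proof -
    have "pochhammer v k \<noteq> 0" if "Im v \<noteq> 0" for v :: complex and k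
      unfolding pochhammer_eq_0_iff using that by auto
    then show "pochhammer ?w k \<noteq> 0" "pochhammer (?w + 1) k \<noteq> 0" using assms(1) by simp_all
  qed
  have "pochhammer ?w l * (?w + of_nat l) = ?w * pochhammer (?w + 1) l"
    using pochhammer_rec[of ?w l] pochhammer_rec'[of ?w l] by (simp add: mult.commute)
  then have eq: "1 / pochhammer ?w l = (?w + of_nat l) / (?w * pochhammer (?w + 1) l)"
    using nz0 pz(1)[of l] pz(2)[of l] by (subst frac_eq_eq) (auto simp: mult_ac)
  have "trunc_Gamma \<nu> l \<sigma> = fact (\<nu> + l - 1) * exp (\<sigma> * of_real (ln (real (\<nu> + l)))) * (1 / pochhammer ?w l)"
    by (simp add: trunc_Gamma_def)
  also have "\<dots> = (?w + of_nat l) / (of_nat (\<nu> + l) * ?w) * trunc_Gamma \<nu> l (\<sigma> + 1)"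
  proof -
    have e: "exp ((\<sigma> + 1) * of_real (ln (real (\<nu> + l)))) = exp (\<sigma> * of_real (ln (real (\<nu> + l)))) * of_nat (\<nu> + l)"
      using assms(2) by (simp add: distrib_right exp_add exp_of_real del: of_nat_add)
    have arg: "\<sigma> + 1 + of_nat \<nu> = ?w + 1" by simp
    have "F * E * (u / (v * P)) = u / (L * v) * (F * (E * L) / P)" if "L \<noteq> 0" for F E u v P L :: complex
      using that by simp
    moreover have "of_nat (\<nu> + l) \<noteq> (0 :: complex)" using assms(2) by (simp del: of_nat_add)
    ultimately show ?thesis
      unfolding eq trunc_Gamma_def arg e by blast
  qed
  finally have 1: "norm (trunc_Gamma \<nu> l \<sigma>) = norm (?w + of_nat l) / (real (\<nu> + l) * norm ?w) * norm (trunc_Gamma \<nu> l (\<sigma> + 1))"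
    by (simp add: norm_mult norm_divide del: of_nat_add)
  have 2: "norm (?w + of_nat l) / (real (\<nu> + l) * norm ?w) \<le> (norm ?w + real (\<nu> + l)) / (real (\<nu> + l) * norm ?w)"
    using norm_triangle_ineq[of ?w "of_nat l"] by (intro divide_right_mono) auto
  have 3: "(norm ?w + real (\<nu> + l)) / (real (\<nu> + l) * norm ?w) = 1 / real (\<nu> + l) + 1 / norm ?w"
    using nz0 assms(2) by (simp add: field_simps)
  show ?thesis
    unfolding 1 by (rule mult_right_mono[OF order_trans[OF 2 eq_refl[OF 3]] norm_ge_zero])
qed

lemma trunc_rGamma_LIMSEQ:
  assumes "- \<sigma> \<notin> \<int>\<^sub>\<le>\<^sub>0"
  shows "(\<lambda>n. trunc_rGamma n \<sigma>) \<longlonglongrightarrow> rGamma (- \<sigma>)"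
proof -
  have "trunc_rGamma n \<sigma> = inverse (Gamma_series' (- \<sigma>) n)" for n
    by (simp add: trunc_rGamma_def Gamma_series'_def exp_minus field_simps)
  with tendsto_inverse[OF Gamma_series'_LIMSEQ[of "- \<sigma>"]] assms show ?thesis
    by (simp add: Gamma_eq_zero_iff rGamma_inverse_Gamma)
qed

lemma norm_trunc_rGamma_le:
  assumes "n \<ge> 1"
  shows "norm (trunc_rGamma n \<sigma>) \<le> norm \<sigma> * exp (norm \<sigma> + (norm \<sigma>)\<^sup>2)"
proof -
  have "norm (trunc_rGamma n \<sigma>) = norm (pochhammer (- \<sigma>) n) / (fact (n - 1) * exp (Re (- \<sigma>) * ln n))"
    by (simp add: trunc_rGamma_def norm_mult norm_divide norm_exp exp_minus field_simps)
  also have "\<dots> \<le> norm \<sigma> * exp (norm \<sigma> + (norm \<sigma>)\<^sup>2)"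
    using norm_pochhammer_le[OF assms, of "- \<sigma>"] by (subst pos_divide_le_eq) auto
  finally show ?thesis .
qed

lemma trunc_rGamma_step:
  assumes "\<sigma> \<noteq> -1" "n \<ge> 1"
  shows "norm (trunc_rGamma n \<sigma>) \<le> (1 / real n + 1 / norm (\<sigma> + 1)) * norm (trunc_rGamma n (\<sigma> + 1))"
proof -
  define w where "w = - (\<sigma> + 1)"
  have w: "w \<noteq> 0" using assms(1) unfolding w_def by (metis add_eq_0_iff2 neg_equal_0_iff_equal)
  have \<sigma>: "- \<sigma> = w + 1" "\<sigma> = - (w + 1)" "\<sigma> + 1 = - w" by (simp_all add: w_def)
  have "w * pochhammer (w + 1) n = (w + of_nat n) * pochhammer w n"
    using pochhammer_rec[of w n] pochhammer_rec'[of w n] by simp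
  then have p: "pochhammer (w + 1) n = (w + of_nat n) / w * pochhammer w n"
    using w by (simp add: field_simps)
  have e: "exp (- (w + 1) * of_real (ln (real n))) = exp (- w * of_real (ln (real n))) / of_nat n"
    using assms(2) by (simp add: ring_distribs exp_diff exp_of_real)
  have "trunc_rGamma n \<sigma> = (w + of_nat n) / (of_nat n * w) * trunc_rGamma n (\<sigma> + 1)"
    unfolding trunc_rGamma_def \<sigma>(1) \<sigma>(3) minus_minus p unfolding \<sigma>(2) e by (simp add: mult_ac)
  then have 1: "norm (trunc_rGamma n \<sigma>) = norm (w + of_nat n) / (real n * norm w) * norm (trunc_rGamma n (\<sigma> + 1))"
    by (simp add: norm_mult norm_divide )
  have 2: "norm (w + of_nat n) / (real n * norm w) \<le> (norm w + real n) / (real n * norm w)"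
    using norm_triangle_ineq[of w "of_nat n"] by (intro divide_right_mono) auto
  have 3: "(norm w + real n) / (real n * norm w) = 1 / real n + 1 / norm (\<sigma> + 1)"
    unfolding \<sigma>(3) using w assms(2) by (simp add: field_simps )
  show ?thesis
    unfolding 1 by (rule mult_right_mono[OF order_trans[OF 2 eq_refl[OF 3]] norm_ge_zero])
qed

section \<open>Uniform decay of the products on the left loop\<close>

text \<open>
  Passes from a one-step estimate to exponential decay. Typical sets \<open>U\<close> are horizontal lines,
  strips, and strips from which discs around the integers have been removed.
\<close>

lemma geometric_decay:
  fixes F :: "complex \<Rightarrow> complex"
  assumes U: "\<And>z. z \<in> U \<Longrightarrow> Re z < \<rho> \<Longrightarrow> z + 1 \<in> U"
    and step: "\<And>z. z \<in> U \<Longrightarrow> Re z < \<rho> \<Longrightarrow> norm (F z) \<le> exp (- \<kappa>) * norm (F (z + 1))"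
    and base: "\<And>z. z \<in> U \<Longrightarrow> \<rho> \<le> Re z \<Longrightarrow> norm (F z) \<le> K * exp (\<kappa> * (Re z - \<rho>))"
    and z: "z \<in> U"
  shows "norm (F z) \<le> K * exp (\<kappa> * (Re z - \<rho>))"
  using z
proof (induction "nat \<lceil>\<rho> - Re z\<rceil>" arbitrary: z rule: less_induct)
  case less
  show ?case
  proof (cases "Re z < \<rho>")
    case True
    then have "nat \<lceil>\<rho> - Re (z + 1)\<rceil> < nat \<lceil>\<rho> - Re z\<rceil>" by simp linarith
    from less.hyps[OF this U[OF less.prems True]]
    have "exp (- \<kappa>) * norm (F (z + 1)) \<le> exp (- \<kappa>) * (K * exp (\<kappa> * (Re (z + 1) - \<rho>)))"
      by (intro mult_left_mono) auto
    also have "\<dots> = K * exp (\<kappa> * (Re z - \<rho>))"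
      by (simp add: exp_add exp_diff exp_minus algebra_simps)
    finally show ?thesis using step[OF less.prems True] by linarith
  qed (use base less in auto)
qed

lemma trunc_Gamma_bounded_right:
  assumes "\<nu> \<ge> 1"
  obtains C where "C \<ge> 0" "\<And>l \<sigma>. l \<ge> 1 \<Longrightarrow> x \<le> Re \<sigma> + real \<nu> \<Longrightarrow> Re \<sigma> \<le> a \<Longrightarrow> x > 0 \<Longrightarrow> norm (trunc_Gamma \<nu> l \<sigma>) \<le> C"
proof
  define M where "M = \<bar>a\<bar> + real \<nu>"
  define C where "C = exp (2 * M\<^sup>2) / \<bar>x\<bar> * (1 + real \<nu>) ^ \<nu> * exp (M * ln (1 + real \<nu>))"
  show "C \<ge> 0" by (simp add: C_def)
  show "norm (trunc_Gamma \<nu> l \<sigma>) \<le> C"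
    if "l \<ge> 1" "x \<le> Re \<sigma> + real \<nu>" "Re \<sigma> \<le> a" "x > 0" for l \<sigma>
  proof -
    have le: "Re \<sigma> + real \<nu> \<le> M" "\<bar>Re \<sigma>\<bar> \<le> M" using that by (auto simp: M_def)
    have "exp (2 * (Re \<sigma> + real \<nu>)\<^sup>2) / (Re \<sigma> + real \<nu>) * (1 + real \<nu>) ^ \<nu> * exp (\<bar>Re \<sigma>\<bar> * ln (1 + real \<nu>)) \<le> C"
      unfolding C_def using that le
      by (intro mult_mono frac_le exp_mono order.refl mult_left_mono power_mono mult_right_mono) auto
    with norm_trunc_Gamma_le[of l \<nu> \<sigma>] that assms show ?thesis by simp
  qed
qed

text \<open>
  To the left of \<open>Re \<sigma> = - \<nu>\<close> the bound is transported along the lines \<open>\<bar>Im \<sigma>\<bar> = d\<close>, one unit at a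
  time; there the step costs at most a factor \<open>1 + 1 / d\<close>.
\<close>

lemma trunc_Gamma_bounded:
  assumes "\<nu> \<ge> 1" "d > 0"
  shows "\<exists>C\<ge>0. \<forall>l\<ge>1. \<forall>\<sigma>. \<bar>Im \<sigma>\<bar> = d \<longrightarrow> 1/2 - real \<nu> - real m \<le> Re \<sigma> \<longrightarrow> Re \<sigma> \<le> a
    \<longrightarrow> norm (trunc_Gamma \<nu> l \<sigma>) \<le> C"
proof (induction m arbitrary: a)
  case 0
  from trunc_Gamma_bounded_right[OF assms(1), of "1/2" a]
  obtain C where "C \<ge> 0" "\<And>l \<sigma>. l \<ge> 1 \<Longrightarrow> 1/2 \<le> Re \<sigma> + real \<nu> \<Longrightarrow> Re \<sigma> \<le> a \<Longrightarrow> 1/2 > (0::real) \<Longrightarrow> norm (trunc_Gamma \<nu> l \<sigma>) \<le> C"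
    by metis
  then show ?case by (intro exI[of _ C]) (auto simp: algebra_simps)
next
  case (Suc m)
  from Suc[of "max a (3/2 - real \<nu> - real m)"]
  obtain C where C: "C \<ge> 0" "\<And>l \<sigma>. l \<ge> 1 \<Longrightarrow> \<bar>Im \<sigma>\<bar> = d \<Longrightarrow> 1/2 - real \<nu> - real m \<le> Re \<sigma> \<Longrightarrow> Re \<sigma> \<le> max a (3/2 - real \<nu> - real m)
    \<Longrightarrow> norm (trunc_Gamma \<nu> l \<sigma>) \<le> C" by blast
  have "norm (trunc_Gamma \<nu> l \<sigma>) \<le> (1 + 1 / d) * C"
    if "l \<ge> 1" "\<bar>Im \<sigma>\<bar> = d" "1/2 - real \<nu> - real (Suc m) \<le> Re \<sigma>" "Re \<sigma> \<le> a" for l \<sigma>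
  proof (cases "1/2 - real \<nu> - real m \<le> Re \<sigma>")
    case True
    with that C have "norm (trunc_Gamma \<nu> l \<sigma>) \<le> C" by simp
    also have "\<dots> \<le> (1 + 1 / d) * C" using C(1) assms(2) by (simp add: field_simps)
    finally show ?thesis .
  next
    case False
    have "norm (trunc_Gamma \<nu> l \<sigma>) \<le> (1 / real (\<nu> + l) + 1 / norm (\<sigma> + of_nat \<nu>)) * norm (trunc_Gamma \<nu> l (\<sigma> + 1))"
      using that assms by (intro trunc_Gamma_step) auto
    also have "\<dots> \<le> (1 + 1 / d) * C"
    proof (intro mult_mono add_mono)
      show "1 / real (\<nu> + l) \<le> 1" using that by simp
      show "1 / norm (\<sigma> + of_nat \<nu>) \<le> 1 / d"
        using abs_Im_le_cmod[of "\<sigma> + of_nat \<nu>"] that assms by (intro divide_left_mono mult_pos_pos) auto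
      show "norm (trunc_Gamma \<nu> l (\<sigma> + 1)) \<le> C"
        using that False by (intro C(2)) auto
    qed (use assms in auto)
    finally show ?thesis .
  qed
  then show ?case using C(1) assms(2) by (intro exI[of _ "(1 + 1 / d) * C"]) auto
qed

text \<open>
  The rate \<open>\<kappa>\<close> is arbitrary: it only determines how far to the left and for how large \<open>l\<close> the step
  factor becomes at most \<open>exp (- \<kappa>)\<close>.
\<close>

lemma trunc_Gamma_loop_bound:
  assumes \<nu>: "\<nu> \<ge> 1" and a: "- real \<nu> < a" and d: "d > 0" and \<kappa>: "\<kappa> \<ge> 0"
  obtains K where "K \<ge> 0"
    "\<forall>\<^sub>F l in sequentially. \<forall>\<sigma>\<in>left_loop a d. norm (trunc_Gamma \<nu> l \<sigma>) \<le> K * exp (\<kappa> * Re \<sigma>)"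
proof -
  \<comment> \<open>Beyond distance \<open>\<Lambda>\<close> from the pole and for \<open>l \<ge> \<Lambda>\<close>, both terms of the step factor are at most \<open>exp (- \<kappa>) / 2\<close>.\<close>
  define \<Lambda> where "\<Lambda> = 2 * exp \<kappa>"
  have \<Lambda>: "\<Lambda> \<ge> 2" "1 / \<Lambda> + 1 / \<Lambda> = exp (- \<kappa>)" using \<kappa> by (auto simp: \<Lambda>_def exp_minus field_simps)
  define \<rho> where "\<rho> = - real \<nu> - \<Lambda>"
  obtain m where m: "1/2 - real \<nu> - real m \<le> \<rho>"
    using real_arch_simple[of "1/2 - real \<nu> - \<rho>"] by (auto simp: algebra_simps)
  obtain C where C: "C \<ge> 0" "\<And>l \<sigma>. l \<ge> 1 \<Longrightarrow> \<bar>Im \<sigma>\<bar> = d \<Longrightarrow> 1/2 - real \<nu> - real m \<le> Re \<sigma> \<Longrightarrow> Re \<sigma> \<le> a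
    \<Longrightarrow> norm (trunc_Gamma \<nu> l \<sigma>) \<le> C" using trunc_Gamma_bounded[OF \<nu> d] by meson
  obtain C' where C': "C' \<ge> 0" "\<And>l \<sigma>. l \<ge> 1 \<Longrightarrow> a + real \<nu> \<le> Re \<sigma> + real \<nu> \<Longrightarrow> Re \<sigma> \<le> a \<Longrightarrow> norm (trunc_Gamma \<nu> l \<sigma>) \<le> C'"
    using trunc_Gamma_bounded_right[OF \<nu>, of "a + real \<nu>" a] a by (auto simp: algebra_simps)
  define K where "K = C * exp (- \<kappa> * \<rho>) + C' * exp (- \<kappa> * a)"
  have "norm (trunc_Gamma \<nu> l \<sigma>) \<le> K * exp (\<kappa> * Re \<sigma>)"
    if l: "real l \<ge> \<Lambda>" and \<sigma>: "\<sigma> \<in> left_loop a d" for l \<sigma>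
  proof (cases "\<bar>Im \<sigma>\<bar> = d")
    case True
    have l1: "l \<ge> 1" using l \<Lambda>(1) by linarith
    have "norm (trunc_Gamma \<nu> l \<sigma>) \<le> C * exp (\<kappa> * (Re \<sigma> - \<rho>))"
    proof (rule geometric_decay[where U="{z. \<bar>Im z\<bar> = d \<and> Re z \<le> a}"])
      fix z assume z: "z \<in> {z. \<bar>Im z\<bar> = d \<and> Re z \<le> a}"
      show "z + 1 \<in> {z. \<bar>Im z\<bar> = d \<and> Re z \<le> a}" if "Re z < \<rho>"
        using z that \<Lambda>(1) a by (auto simp: \<rho>_def)
      show "norm (trunc_Gamma \<nu> l z) \<le> C * exp (\<kappa> * (Re z - \<rho>))" if "\<rho> \<le> Re z"
      proof -
        have "norm (trunc_Gamma \<nu> l z) \<le> C" using z that m by (intro C l1) auto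
        also have "\<dots> \<le> C * exp (\<kappa> * (Re z - \<rho>))"
          using C(1) \<kappa> that by (simp add: mult_le_cancel_left1)
        finally show ?thesis .
      qed
      show "norm (trunc_Gamma \<nu> l z) \<le> exp (- \<kappa>) * norm (trunc_Gamma \<nu> l (z + 1))" if "Re z < \<rho>"
      proof -
        have "norm (trunc_Gamma \<nu> l z) \<le> (1 / real (\<nu> + l) + 1 / norm (z + of_nat \<nu>)) * norm (trunc_Gamma \<nu> l (z + 1))"
          using z d l1 by (intro trunc_Gamma_step) auto
        also have "\<dots> \<le> (1 / \<Lambda> + 1 / \<Lambda>) * norm (trunc_Gamma \<nu> l (z + 1))"
        proof (intro mult_right_mono add_mono divide_left_mono)
          show "\<Lambda> \<le> norm (z + of_nat \<nu>)"
            using abs_Re_le_cmod[of "z + of_nat \<nu>"] that \<Lambda>(1) by (simp add: \<rho>_def)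
          then show "0 < norm (z + of_nat \<nu>) * \<Lambda>" using \<Lambda>(1) by (intro mult_pos_pos) auto
        qed (use l \<Lambda>(1) in \<open>auto intro!: mult_pos_pos\<close>)
        finally show ?thesis unfolding \<Lambda>(2) .
      qed
    qed (use True \<sigma> in \<open>auto simp: left_loop_def\<close>)
    also have "\<dots> = C * exp (- \<kappa> * \<rho>) * exp (\<kappa> * Re \<sigma>)"
      by (simp add: exp_diff exp_minus field_simps)
    also have "\<dots> \<le> K * exp (\<kappa> * Re \<sigma>)"
      using C'(1) by (intro mult_right_mono) (auto simp: K_def)
    finally show ?thesis .
  next
    case False
    then have "Re \<sigma> = a" using \<sigma> by (auto simp: left_loop_def)
    then have "norm (trunc_Gamma \<nu> l \<sigma>) \<le> C' * exp (- \<kappa> * a) * exp (\<kappa> * Re \<sigma>)"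
      using C'(2)[of l \<sigma>] l \<Lambda>(1) by (simp add: exp_minus field_simps)
    also have "\<dots> \<le> K * exp (\<kappa> * Re \<sigma>)"
      using C(1) by (intro mult_right_mono) (auto simp: K_def)
    finally show ?thesis .
  qed
  moreover have "K \<ge> 0" using C(1) C'(1) by (simp add: K_def)
  moreover have "\<forall>\<^sub>F l in sequentially. real l \<ge> \<Lambda>"
    by (rule filterlim_at_top[THEN iffD1, rule_format, OF filterlim_real_sequentially])
  ultimately show ?thesis by (intro that[of K]) (auto elim: eventually_mono)
qed

lemma trunc_rGamma_loop_bound:
  assumes a: "a < 0" and d: "d > 0" and \<kappa>: "\<kappa> \<ge> 0"
  obtains K where "K \<ge> 0"
    "\<forall>\<^sub>F n in sequentially. \<forall>\<sigma>\<in>left_loop a d. norm (trunc_rGamma n \<sigma>) \<le> K * exp (\<kappa> * Re \<sigma>)"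
proof -
  define \<Lambda> where "\<Lambda> = 2 * exp \<kappa>"
  have \<Lambda>: "\<Lambda> \<ge> 2" "1 / \<Lambda> + 1 / \<Lambda> = exp (- \<kappa>)" using \<kappa> by (auto simp: \<Lambda>_def exp_minus field_simps)
  define \<rho> where "\<rho> = a - 1 - \<Lambda>"
  define M where "M = \<bar>\<rho>\<bar> + d"
  define C where "C = M * exp (M + M\<^sup>2)"
  have C0: "C \<ge> 0" using d by (simp add: C_def M_def)
  have "norm (trunc_rGamma n \<sigma>) \<le> C * exp (- \<kappa> * \<rho>) * exp (\<kappa> * Re \<sigma>)"
    if n: "real n \<ge> \<Lambda>" and \<sigma>: "\<sigma> \<in> left_loop a d" for n \<sigma>
  proof -
    have n1: "n \<ge> 1" using n \<Lambda>(1) by linarith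
    have "norm (trunc_rGamma n \<sigma>) \<le> C * exp (\<kappa> * (Re \<sigma> - \<rho>))"
    proof (rule geometric_decay[where U="{z. \<bar>Im z\<bar> \<le> d \<and> Re z \<le> a}"])
      fix z assume z: "z \<in> {z. \<bar>Im z\<bar> \<le> d \<and> Re z \<le> a}"
      show "z + 1 \<in> {z. \<bar>Im z\<bar> \<le> d \<and> Re z \<le> a}" if "Re z < \<rho>"
        using z that \<Lambda>(1) a by (auto simp: \<rho>_def)
      show "norm (trunc_rGamma n z) \<le> C * exp (\<kappa> * (Re z - \<rho>))" if "\<rho> \<le> Re z"
      proof -
        have "norm z \<le> M"
          using cmod_le[of z] z that a by (simp add: M_def)
        then have "norm z * exp (norm z + (norm z)\<^sup>2) \<le> C"
          unfolding C_def using norm_ge_zero[of z] by (intro mult_mono exp_mono add_mono power_mono exp_ge_zero) linarith+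
        then have "norm (trunc_rGamma n z) \<le> C" using norm_trunc_rGamma_le[OF n1, of z] by simp
        also have "\<dots> \<le> C * exp (\<kappa> * (Re z - \<rho>))"
          using C0 \<kappa> that by (simp add: mult_le_cancel_left1)
        finally show ?thesis .
      qed
      show "norm (trunc_rGamma n z) \<le> exp (- \<kappa>) * norm (trunc_rGamma n (z + 1))" if "Re z < \<rho>"
      proof -
        have "z \<noteq> - 1" using that a \<Lambda>(1) by (auto simp: \<rho>_def)
        then have "norm (trunc_rGamma n z) \<le> (1 / real n + 1 / norm (z + 1)) * norm (trunc_rGamma n (z + 1))"
          using n1 by (intro trunc_rGamma_step) auto
        also have "\<dots> \<le> (1 / \<Lambda> + 1 / \<Lambda>) * norm (trunc_rGamma n (z + 1))"
        proof (intro mult_right_mono add_mono divide_left_mono)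
          show "\<Lambda> \<le> norm (z + 1)"
            using abs_Re_le_cmod[of "z + 1"] that \<Lambda>(1) a by (simp add: \<rho>_def)
          then show "0 < norm (z + 1) * \<Lambda>" using \<Lambda>(1) by (intro mult_pos_pos) auto
        qed (use n \<Lambda>(1) in \<open>auto intro!: mult_pos_pos\<close>)
        finally show ?thesis unfolding \<Lambda>(2) .
      qed
    qed (use \<sigma> in \<open>auto simp: left_loop_def\<close>)
    also have "\<dots> = C * exp (- \<kappa> * \<rho>) * exp (\<kappa> * Re \<sigma>)"
      by (simp add: exp_diff exp_minus field_simps)
    finally show ?thesis .
  qed
  moreover have "\<forall>\<^sub>F n in sequentially. real n \<ge> \<Lambda>"
    by (rule filterlim_at_top[THEN iffD1, rule_format, OF filterlim_real_sequentially])
  ultimately show ?thesis using C0 by (intro that[of "C * exp (- \<kappa> * \<rho>)"]) (auto elim: eventually_mono)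
qed

lemma left_loop_uminus_notin_nonpos_Ints: "a < 0 \<Longrightarrow> d > 0 \<Longrightarrow> \<sigma> \<in> left_loop a d \<Longrightarrow> - \<sigma> \<notin> \<int>\<^sub>\<le>\<^sub>0"
  by (auto simp: left_loop_def elim!: nonpos_Ints_cases')

text \<open>
  The bound for the finite products is uniform, so it passes to their limit \<open>1 / \<Gamma>(- \<sigma>)\<close>.
\<close>

lemma rGamma_loop_bound:
  assumes a: "a < 0" and d: "d > 0" and \<kappa>: "\<kappa> \<ge> 0"
  obtains K where "K \<ge> 0" "\<forall>\<sigma>\<in>left_loop a d. norm (rGamma (- \<sigma>)) \<le> K * exp (\<kappa> * Re \<sigma>)"
proof -
  from trunc_rGamma_loop_bound[OF assms] obtain K where K: "K \<ge> 0"
    "\<forall>\<^sub>F l in sequentially. \<forall>\<sigma>\<in>left_loop a d. norm (trunc_rGamma l \<sigma>) \<le> K * exp (\<kappa> * Re \<sigma>)" .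
  show ?thesis
    by (rule that[OF K(1)], rule ballI, rule tendsto_upperbound[OF tendsto_norm[OF trunc_rGamma_LIMSEQ]])
      (use K(2) left_loop_uminus_notin_nonpos_Ints[OF a d] in \<open>auto elim: eventually_mono\<close>)
qed

lemma prod_trunc_Gamma_loop_bound:
  fixes l :: "'i \<Rightarrow> nat \<Rightarrow> nat" and \<nu> :: "'i \<Rightarrow> nat"
  assumes J: "finite J" "J \<noteq> {}" and \<nu>: "\<And>j. j \<in> J \<Longrightarrow> \<nu> j \<ge> 1" "\<And>j. j \<in> J \<Longrightarrow> - real (\<nu> j) < a"
    and l: "\<And>j. j \<in> J \<Longrightarrow> filterlim (l j) at_top sequentially" and d: "d > 0" and \<kappa>: "\<kappa> \<ge> 0"
  obtains K where "K \<ge> 0" "\<forall>\<^sub>F \<alpha> in sequentially. \<forall>\<sigma>\<in>left_loop a d.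
    norm (\<Prod>j\<in>J. trunc_Gamma (\<nu> j) (l j \<alpha>) \<sigma>) \<le> K * exp (\<kappa> * Re \<sigma>)"
proof -
  define p where "p = card J"
  have p: "p > 0" using J by (auto simp: p_def card_gt_0_iff)
  have "\<forall>j\<in>J. \<exists>K\<ge>0. \<forall>\<^sub>F l in sequentially. \<forall>\<sigma>\<in>left_loop a d. norm (trunc_Gamma (\<nu> j) l \<sigma>) \<le> K * exp (\<kappa> / real p * Re \<sigma>)"
  proof
    fix j assume "j \<in> J"
    have "\<kappa> / real p \<ge> 0" using \<kappa> by simp
    from trunc_Gamma_loop_bound[OF \<nu>(1)[OF \<open>j \<in> J\<close>] \<nu>(2)[OF \<open>j \<in> J\<close>] d this]
    obtain K where "K \<ge> 0" "\<forall>\<^sub>F l in sequentially. \<forall>\<sigma>\<in>left_loop a d. norm (trunc_Gamma (\<nu> j) l \<sigma>) \<le> K * exp (\<kappa> / real p * Re \<sigma>)" .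
    then show "\<exists>K\<ge>0. \<forall>\<^sub>F l in sequentially. \<forall>\<sigma>\<in>left_loop a d. norm (trunc_Gamma (\<nu> j) l \<sigma>) \<le> K * exp (\<kappa> / real p * Re \<sigma>)"
      by blast
  qed
  from bchoice[OF this] obtain K where K': "\<forall>j\<in>J. K j \<ge> 0 \<and> (\<forall>\<^sub>F l in sequentially.
      \<forall>\<sigma>\<in>left_loop a d. norm (trunc_Gamma (\<nu> j) l \<sigma>) \<le> K j * exp (\<kappa> / real p * Re \<sigma>))" ..
  have K: "K j \<ge> 0"
    "\<forall>\<^sub>F l in sequentially. \<forall>\<sigma>\<in>left_loop a d. norm (trunc_Gamma (\<nu> j) l \<sigma>) \<le> K j * exp (\<kappa> / real p * Re \<sigma>)"
    if "j \<in> J" for j using bspec[OF K' that] by simp_all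
  have "\<forall>\<^sub>F \<alpha> in sequentially. \<forall>j\<in>J. \<forall>\<sigma>\<in>left_loop a d. norm (trunc_Gamma (\<nu> j) (l j \<alpha>) \<sigma>) \<le> K j * exp (\<kappa> / real p * Re \<sigma>)"
    using J(1) by (intro eventually_ball_finite ballI eventually_compose_filterlim[OF K(2) l])
  then have "\<forall>\<^sub>F \<alpha> in sequentially. \<forall>\<sigma>\<in>left_loop a d. norm (\<Prod>j\<in>J. trunc_Gamma (\<nu> j) (l j \<alpha>) \<sigma>) \<le> prod K J * exp (\<kappa> * Re \<sigma>)"
  proof eventually_elim
    case (elim \<alpha>)
    show ?case
    proof
      fix \<sigma> assume "\<sigma> \<in> left_loop a d"
      then have "norm (\<Prod>j\<in>J. trunc_Gamma (\<nu> j) (l j \<alpha>) \<sigma>) \<le> (\<Prod>j\<in>J. K j * exp (\<kappa> / real p * Re \<sigma>))"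
        unfolding prod_norm[symmetric] using elim by (intro prod_mono) auto
      also have "\<dots> = prod K J * exp (\<kappa> * Re \<sigma>)"
        using p by (simp add: prod.distrib p_def[symmetric] flip: exp_of_nat_mult)
      finally show "norm (\<Prod>j\<in>J. trunc_Gamma (\<nu> j) (l j \<alpha>) \<sigma>) \<le> prod K J * exp (\<kappa> * Re \<sigma>)" .
    qed
  qed
  moreover have "prod K J \<ge> 0" using K(1) by (intro prod_nonneg) auto
  ultimately show ?thesis by (rule that[rotated])
qed

lemma prod_Gamma_loop_bound:
  fixes \<nu> :: "'i \<Rightarrow> nat"
  assumes J: "finite J" "J \<noteq> {}" and \<nu>: "\<And>j. j \<in> J \<Longrightarrow> \<nu> j \<ge> 1" "\<And>j. j \<in> J \<Longrightarrow> - real (\<nu> j) < a"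
    and d: "d > 0" and \<kappa>: "\<kappa> \<ge> 0"
  obtains K where "K \<ge> 0"
    "\<forall>\<sigma>\<in>left_loop a d. norm (\<Prod>j\<in>J. Gamma (\<sigma> + of_nat (\<nu> j))) \<le> K * exp (\<kappa> * Re \<sigma>)"
proof -
  from prod_trunc_Gamma_loop_bound[OF J \<nu> filterlim_ident d \<kappa>] obtain K where K: "K \<ge> 0"
    "\<forall>\<^sub>F \<alpha> in sequentially. \<forall>\<sigma>\<in>left_loop a d. norm (\<Prod>j\<in>J. trunc_Gamma (\<nu> j) \<alpha> \<sigma>) \<le> K * exp (\<kappa> * Re \<sigma>)" .
  show ?thesis
  proof (rule that[OF K(1)], rule ballI)
    fix \<sigma> assume \<sigma>: "\<sigma> \<in> left_loop a d"
    have "(\<lambda>\<alpha>. norm (\<Prod>j\<in>J. trunc_Gamma (\<nu> j) \<alpha> \<sigma>)) \<longlonglongrightarrow> norm (\<Prod>j\<in>J. Gamma (\<sigma> + of_nat (\<nu> j)))"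
      using \<nu> by (intro tendsto_norm tendsto_prod trunc_Gamma_LIMSEQ)
    then show "norm (\<Prod>j\<in>J. Gamma (\<sigma> + of_nat (\<nu> j))) \<le> K * exp (\<kappa> * Re \<sigma>)"
      by (rule tendsto_upperbound) (use K(2) \<sigma> in \<open>auto elim: eventually_mono\<close>)
  qed
qed

lemma left_loop_no_pole:
  assumes "\<sigma> \<in> left_loop a d" "d > 0" "- real \<nu> < a"
  shows "\<sigma> + of_nat \<nu> + of_nat k \<noteq> 0" "\<sigma> + of_nat \<nu> \<notin> \<int>\<^sub>\<le>\<^sub>0"
proof -
  show *: "\<sigma> + of_nat \<nu> + of_nat k \<noteq> 0" for k
  proof
    assume "\<sigma> + of_nat \<nu> + of_nat k = 0"
    then have "Re (\<sigma> + of_nat \<nu> + of_nat k) = 0" "Im (\<sigma> + of_nat \<nu> + of_nat k) = 0" by (simp_all only: zero_complex.sel)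
    then show False using assms by (auto simp: left_loop_def)
  qed
  show "\<sigma> + of_nat \<nu> \<notin> \<int>\<^sub>\<le>\<^sub>0"
    using * by (auto elim!: nonpos_Ints_cases' simp: add_eq_0_iff2)
qed

lemma left_loop_notin_Ints:
  assumes c: "0 < c" "c < 1" and d: "d > 0" and \<sigma>: "\<sigma> \<in> left_loop (- c) d"
  shows "\<sigma> \<notin> \<int>"
proof
  assume "\<sigma> \<in> \<int>"
  then obtain k where k: "\<sigma> = of_int k" by (auto elim: Ints_cases)
  with \<sigma> c d have "real_of_int (- 1) < real_of_int k" "real_of_int k < real_of_int 0" by (auto simp: left_loop_def)
  then show False unfolding of_int_less_iff by linarith
qed

lemma continuous_on_trunc_Gamma:
  assumes "d > 0" "- real \<nu> < a"
  shows "continuous_on (left_loop a d) (trunc_Gamma \<nu> l)"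
  unfolding trunc_Gamma_def pochhammer_prod
  by (intro continuous_intros) (use left_loop_no_pole[OF _ assms] in \<open>auto simp: prod_zero_iff\<close>)

lemma continuous_on_Gamma_loop:
  assumes "d > 0" "- real \<nu> < a"
  shows "continuous_on (left_loop a d) (\<lambda>\<sigma>. Gamma (\<sigma> + of_nat \<nu>))"
  by (rule continuous_on_compose2[OF continuous_on_Gamma[of "(\<lambda>\<sigma>. \<sigma> + of_nat \<nu>) ` left_loop a d"]])
    (use left_loop_no_pole[OF _ assms] in \<open>auto intro!: continuous_intros\<close>)

lemma continuous_on_trunc_rGamma: "continuous_on S (trunc_rGamma n)"
  unfolding trunc_rGamma_def pochhammer_prod by (intro continuous_intros) auto

section \<open>Decay of the Gamma function away from its poles\<close>

text \<open>
  Both the decay to the left and the factor \<open>(Im z)\<^sup>-\<^sup>2\<close> come from the functional equation: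
  \<open>\<Gamma>(z) = \<Gamma>(z + k) / (z (z + 1) \<cdots> (z + k - 1))\<close>, where \<open>\<Gamma>(z + k)\<close> is bounded on vertical strips to
  the right of the imaginary axis and each factor in the denominator has modulus at least
  \<open>\<bar>Im z\<bar>\<close>.
\<close>

lemma Gamma_vertical_decay:
  assumes d: "d > 0" and \<kappa>: "\<kappa> \<ge> 0"
  obtains K where "K \<ge> 0"
    "\<And>z. Re z \<le> g \<Longrightarrow> \<bar>Im z\<bar> \<ge> d \<Longrightarrow> norm (Gamma z) \<le> K * exp (\<kappa> * Re z) / (Im z)\<^sup>2"
proof -
  define \<rho> where "\<rho> = min (g - 1) (- exp \<kappa>)"
  \<comment> \<open>\<open>k\<close> unit steps lead from \<open>Re z \<ge> \<rho>\<close> to the right of 1, and two of them are kept for \<open>(Im z)\<^sup>-\<^sup>2\<close>.\<close>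
  obtain k :: nat where k: "1 - \<rho> \<le> real k" "k \<ge> 2"
  proof -
    obtain k :: nat where "1 - \<rho> \<le> real k" using real_arch_simple by blast
    then show ?thesis by (intro that[of "k + 2"]) auto
  qed
  define X where "X = \<bar>g\<bar> + real k"
  define C where "C = exp (2 * X\<^sup>2) / d ^ (k - 2)"
  have C0: "C \<ge> 0" using d by (simp add: C_def)
  have base: "norm (Gamma z) * (Im z)\<^sup>2 \<le> C" if z: "Re z \<le> g" "\<bar>Im z\<bar> \<ge> d" "\<rho> \<le> Re z" for z
  proof -
    have ni: "z \<notin> \<int>\<^sub>\<le>\<^sub>0" using z d by (auto elim!: nonpos_Ints_cases')
    have eq: "Gamma (z + of_nat k) = pochhammer z k * Gamma z"
      using pochhammer_Gamma[OF ni, of k] ni by (simp add: Gamma_eq_zero_iff)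
    have x: "1 \<le> Re (z + of_nat k)" "Re (z + of_nat k) \<le> X" using z k by (auto simp: X_def)
    have "norm (Gamma (z + of_nat k)) \<le> exp (2 * (Re (z + of_nat k))\<^sup>2) / Re (z + of_nat k)"
      using x by (intro norm_Gamma_le) linarith
    also have "\<dots> \<le> exp (2 * X\<^sup>2) / 1"
      using x by (intro frac_le exp_mono mult_left_mono power_mono) auto
    finally have up: "norm (Gamma (z + of_nat k)) \<le> exp (2 * X\<^sup>2)" by simp
    have "\<bar>Im z\<bar> ^ k \<le> norm (pochhammer z k)"
    proof -
      have "(\<Prod>i=0..<k. \<bar>Im z\<bar>) \<le> (\<Prod>i=0..<k. norm (z + of_nat i))"
        using abs_Im_le_cmod[of "z + of_nat _"] by (intro prod_mono) auto
      then show ?thesis by (simp add: pochhammer_prod prod_norm)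
    qed
    moreover have "d ^ (k - 2) * (Im z)\<^sup>2 \<le> \<bar>Im z\<bar> ^ k"
    proof -
      have "d ^ (k - 2) * \<bar>Im z\<bar>\<^sup>2 \<le> \<bar>Im z\<bar> ^ (k - 2) * \<bar>Im z\<bar>\<^sup>2"
        using z d by (intro mult_right_mono power_mono) auto
      also have "\<dots> = \<bar>Im z\<bar> ^ k" using k(2) by (metis le_add_diff_inverse2 power_add)
      finally show ?thesis by simp
    qed
    ultimately have "d ^ (k - 2) * (Im z)\<^sup>2 * norm (Gamma z) \<le> norm (pochhammer z k) * norm (Gamma z)"
      by (intro mult_right_mono) auto
    also have "\<dots> \<le> exp (2 * X\<^sup>2)" using up unfolding eq norm_mult .
    finally show ?thesis using d by (simp add: C_def field_simps)
  qed
  \<comment> \<open>Unit steps do not change \<open>Im z\<close>, so the factor \<open>(Im z)\<^sup>2\<close> can be carried along.\<close>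
  have "norm (Gamma z * of_real ((Im z)\<^sup>2)) \<le> C * exp (\<kappa> * (Re z - \<rho>))" if z: "Re z \<le> g" "\<bar>Im z\<bar> \<ge> d" for z
  proof (rule geometric_decay[where U="{z. Re z \<le> g \<and> \<bar>Im z\<bar> \<ge> d}"])
    fix z assume z: "z \<in> {z. Re z \<le> g \<and> \<bar>Im z\<bar> \<ge> d}"
    show "z + 1 \<in> {z. Re z \<le> g \<and> \<bar>Im z\<bar> \<ge> d}" if "Re z < \<rho>"
      using z that by (auto simp: \<rho>_def)
    show "norm (Gamma z * of_real ((Im z)\<^sup>2)) \<le> C * exp (\<kappa> * (Re z - \<rho>))" if "\<rho> \<le> Re z"
    proof -
      have "norm (Gamma z * of_real ((Im z)\<^sup>2)) \<le> C"
        using base[of z] z that by (simp add: norm_mult norm_power)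
      also have "\<dots> \<le> C * exp (\<kappa> * (Re z - \<rho>))"
        using C0 \<kappa> that by (simp add: mult_le_cancel_left1)
      finally show ?thesis .
    qed
    show "norm (Gamma z * of_real ((Im z)\<^sup>2)) \<le> exp (- \<kappa>) * norm (Gamma (z + 1) * of_real ((Im (z + 1))\<^sup>2))"
      if "Re z < \<rho>"
    proof -
      have "z \<notin> \<int>\<^sub>\<le>\<^sub>0" using z d by (auto elim!: nonpos_Ints_cases')
      then have "Gamma (z + 1) = z * Gamma z" by (rule Gamma_plus1)
      moreover have "exp \<kappa> \<le> norm z"
        using abs_Re_le_cmod[of z] that by (auto simp: \<rho>_def)
      then have "exp \<kappa> * norm (Gamma z) \<le> norm z * norm (Gamma z)" by (intro mult_right_mono) auto
      then have "norm (Gamma z) \<le> exp (- \<kappa>) * (norm z * norm (Gamma z))"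
        by (simp add: exp_minus field_simps)
      then have "norm (Gamma z) * (Im z)\<^sup>2 \<le> exp (- \<kappa>) * (norm z * norm (Gamma z)) * (Im z)\<^sup>2"
        by (intro mult_right_mono) auto
      ultimately show ?thesis by (simp add: norm_mult norm_power mult_ac)
    qed
  qed (use z in auto)
  then have "norm (Gamma z) \<le> C * exp (- \<kappa> * \<rho>) * exp (\<kappa> * Re z) / (Im z)\<^sup>2" if "Re z \<le> g" "\<bar>Im z\<bar> \<ge> d" for z
    using that d by (subst pos_le_divide_eq) (auto simp: norm_mult norm_power exp_diff exp_minus field_simps)
  then show ?thesis using C0 by (intro that[of "C * exp (- \<kappa> * \<rho>)"]) auto
qed

text \<open>
  One factor provides \<open>(Im z)\<^sup>-\<^sup>2\<close>; in the others this quantity is bounded by \<open>d\<^sup>-\<^sup>2\<close>.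
\<close>

lemma prod_Gamma_vertical_decay:
  fixes \<nu> :: "'i \<Rightarrow> nat"
  assumes J: "finite J" "J \<noteq> {}" and d: "d > 0" and \<kappa>: "\<kappa> \<ge> 0"
  obtains K where "K \<ge> 0" "\<And>z. Re z \<le> g \<Longrightarrow> \<bar>Im z\<bar> \<ge> d \<Longrightarrow>
    norm (\<Prod>j\<in>J. Gamma (z - 1 + of_nat (\<nu> j))) \<le> K * exp (\<kappa> * Re z) / (Im z)\<^sup>2"
proof -
  define p where "p = card J"
  have p: "p > 0" using J by (auto simp: p_def card_gt_0_iff)
  have kp: "\<kappa> / real p \<ge> 0" using \<kappa> by simp
  have "\<forall>j\<in>J. \<exists>K\<ge>0. \<forall>z. Re z \<le> g \<longrightarrow> \<bar>Im z\<bar> \<ge> d \<longrightarrow>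
      norm (Gamma (z - 1 + of_nat (\<nu> j))) \<le> K * exp (\<kappa> / real p * Re z) / (Im z)\<^sup>2"
  proof
    fix j assume "j \<in> J"
    obtain K where K: "K \<ge> 0" "\<And>z. Re z \<le> g - 1 + real (\<nu> j) \<Longrightarrow> \<bar>Im z\<bar> \<ge> d \<Longrightarrow> norm (Gamma z) \<le> K * exp (\<kappa> / real p * Re z) / (Im z)\<^sup>2"
      by (rule Gamma_vertical_decay[OF d kp, of "g - 1 + real (\<nu> j)"]) blast
    have "norm (Gamma (z - 1 + of_nat (\<nu> j))) \<le> K * exp (\<kappa> / real p * (real (\<nu> j) - 1)) * exp (\<kappa> / real p * Re z) / (Im z)\<^sup>2"
      if "Re z \<le> g" "\<bar>Im z\<bar> \<ge> d" for z
    proof -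
      have "norm (Gamma (z - 1 + of_nat (\<nu> j))) \<le> K * exp (\<kappa> / real p * Re (z - 1 + of_nat (\<nu> j))) / (Im (z - 1 + of_nat (\<nu> j)))\<^sup>2"
        using that by (intro K(2)) auto
      also have "\<kappa> / real p * Re (z - 1 + of_nat (\<nu> j)) = \<kappa> / real p * (real (\<nu> j) - 1) + \<kappa> / real p * Re z"
        by (simp add: algebra_simps)
      finally show ?thesis by (simp add: exp_add mult_ac)
    qed
    then show "\<exists>K\<ge>0. \<forall>z. Re z \<le> g \<longrightarrow> \<bar>Im z\<bar> \<ge> d \<longrightarrow>
      norm (Gamma (z - 1 + of_nat (\<nu> j))) \<le> K * exp (\<kappa> / real p * Re z) / (Im z)\<^sup>2"
      using K(1) by (intro exI[of _ "K * exp (\<kappa> / real p * (real (\<nu> j) - 1))"]) auto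
  qed
  from bchoice[OF this] obtain K where K: "\<forall>j\<in>J. K j \<ge> 0 \<and> (\<forall>z. Re z \<le> g \<longrightarrow> \<bar>Im z\<bar> \<ge> d \<longrightarrow>
      norm (Gamma (z - 1 + of_nat (\<nu> j))) \<le> K j * exp (\<kappa> / real p * Re z) / (Im z)\<^sup>2)" ..
  have K0: "prod K J \<ge> 0" using K by (intro prod_nonneg) auto
  have "norm (\<Prod>j\<in>J. Gamma (z - 1 + of_nat (\<nu> j))) \<le> prod K J / (d\<^sup>2) ^ (p - 1) * exp (\<kappa> * Re z) / (Im z)\<^sup>2"
    if z: "Re z \<le> g" "\<bar>Im z\<bar> \<ge> d" for z
  proof -
    have "norm (\<Prod>j\<in>J. Gamma (z - 1 + of_nat (\<nu> j))) \<le> (\<Prod>j\<in>J. K j * exp (\<kappa> / real p * Re z) / (Im z)\<^sup>2)"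
      unfolding prod_norm[symmetric] using K z by (intro prod_mono) auto
    also have "\<dots> = prod K J * exp (\<kappa> * Re z) / ((Im z)\<^sup>2) ^ p"
      using p by (simp add: prod_dividef prod.distrib p_def[symmetric] flip: exp_of_nat_mult)
    also have "\<dots> \<le> prod K J * exp (\<kappa> * Re z) / ((d\<^sup>2) ^ (p - 1) * (Im z)\<^sup>2)"
    proof (intro divide_left_mono mult_nonneg_nonneg K0)
      have "d\<^sup>2 \<le> (Im z)\<^sup>2" using z(2) d by (simp add: abs_le_square_iff[symmetric])
      then have "(d\<^sup>2) ^ (p - 1) * (Im z)\<^sup>2 \<le> ((Im z)\<^sup>2) ^ (p - 1) * (Im z)\<^sup>2"
        by (intro mult_right_mono power_mono[of "d\<^sup>2" "(Im z)\<^sup>2" "p - 1"]) auto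
      also have "\<dots> = ((Im z)\<^sup>2) ^ p" using p by (metis Suc_diff_1 power_Suc2)
      finally show "(d\<^sup>2) ^ (p - 1) * (Im z)\<^sup>2 \<le> ((Im z)\<^sup>2) ^ p" .
      show "0 < ((Im z)\<^sup>2) ^ p * ((d\<^sup>2) ^ (p - 1) * (Im z)\<^sup>2)"
      proof -
        have I: "(Im z)\<^sup>2 > 0" and D: "d\<^sup>2 > 0" using z d by auto
        show ?thesis by (intro mult_pos_pos zero_less_power[OF I] zero_less_power[OF D] I)
      qed
    qed auto
    finally show ?thesis by (simp add: mult_ac)
  qed
  moreover have "prod K J / (d\<^sup>2) ^ (p - 1) \<ge> 0" using K0 by simp
  ultimately show ?thesis using that by blast
qed

text \<open>
  The set of points at distance at least \<open>\<eta>\<close> from the integers is invariant under unit translations,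
  so \<open>geometric_decay\<close> applies once \<open>\<Gamma>\<close> is bounded on a compact piece.
\<close>

lemma Gamma_decay_off_Ints:
  assumes \<eta>: "\<eta> > 0" and \<kappa>: "\<kappa> \<ge> 0"
  obtains K where "K \<ge> 0"
    "\<And>z. Re z \<le> g \<Longrightarrow> \<bar>Im z\<bar> \<le> d \<Longrightarrow> (\<And>k. dist z (of_int k) \<ge> \<eta>) \<Longrightarrow> norm (Gamma z) \<le> K * exp (\<kappa> * Re z)"
proof -
  define \<rho> where "\<rho> = min (g - 1) (- exp \<kappa>)"
  define U where "U = {z. Re z \<le> g \<and> \<bar>Im z\<bar> \<le> d \<and> (\<forall>k. dist z (of_int k) \<ge> \<eta>)}"
  have ni: "z \<notin> \<int>\<^sub>\<le>\<^sub>0" if "z \<in> U" for z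
  proof
    assume "z \<in> \<int>\<^sub>\<le>\<^sub>0"
    then obtain k where "z = of_int k" by (auto elim: nonpos_Ints_cases)
    with that \<eta> show False by (auto simp: U_def dest!: spec[of _ k])
  qed
  define B where "B = U \<inter> {z. \<rho> \<le> Re z}"
  have "closed B"
    unfolding B_def U_def by (intro closed_Int closed_Collect_conj closed_Collect_all closed_Collect_le continuous_intros)
  moreover have "bounded B"
  proof (rule boundedI)
    fix z assume "z \<in> B"
    then show "norm z \<le> \<bar>g\<bar> + \<bar>\<rho>\<bar> + d" using cmod_le[of z] by (auto simp: B_def U_def)
  qed
  ultimately have "compact (Gamma ` B)"
    using ni by (intro compact_continuous_image continuous_intros) (auto simp: compact_eq_bounded_closed B_def)
  then obtain C where C: "\<And>z. z \<in> B \<Longrightarrow> norm (Gamma z) \<le> C"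
    using compact_imp_bounded bounded_iff by (metis imageI)
  define C' where "C' = max C 0"
  have "norm (Gamma z) \<le> C' * exp (\<kappa> * (Re z - \<rho>))" if "z \<in> U" for z
  proof (rule geometric_decay[where U=U])
    fix z assume z: "z \<in> U"
    show "z + 1 \<in> U" if "Re z < \<rho>"
    proof -
      have "dist (z + 1) (of_int k) \<ge> \<eta>" for k
      proof -
        have "dist (z + 1) (of_int k) = dist z (of_int (k - 1))"
          by (simp add: dist_norm algebra_simps)
        then show ?thesis using z by (simp only: U_def mem_Collect_eq)
      qed
      then show ?thesis using z that by (auto simp: U_def \<rho>_def)
    qed
    show "norm (Gamma z) \<le> C' * exp (\<kappa> * (Re z - \<rho>))" if "\<rho> \<le> Re z"
    proof -
      have "norm (Gamma z) \<le> C'" using C[of z] z that by (simp add: B_def C'_def)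
      also have "\<dots> \<le> C' * exp (\<kappa> * (Re z - \<rho>))"
        using \<kappa> that by (simp add: mult_le_cancel_left1 C'_def)
      finally show ?thesis .
    qed
    show "norm (Gamma z) \<le> exp (- \<kappa>) * norm (Gamma (z + 1))" if "Re z < \<rho>"
    proof -
      have "Gamma (z + 1) = z * Gamma z" using ni[OF z] by (rule Gamma_plus1)
      moreover have "exp \<kappa> \<le> norm z"
        using abs_Re_le_cmod[of z] that by (auto simp: \<rho>_def)
      then have "exp \<kappa> * norm (Gamma z) \<le> norm z * norm (Gamma z)" by (intro mult_right_mono) auto
      ultimately show ?thesis by (simp add: exp_minus field_simps norm_mult)
    qed
  qed (use that in auto)
  then show ?thesis
    by (intro that[of "C' * exp (- \<kappa> * \<rho>)"]) (auto simp: C'_def U_def exp_diff exp_minus field_simps)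
qed

lemma rGamma_bounded_strip:
  obtains K where "K \<ge> 0" "\<And>z. Re z \<ge> x \<Longrightarrow> \<bar>Im z\<bar> \<le> d \<Longrightarrow> norm (rGamma z) \<le> K"
proof -
  define m where "m = max 2 (x + 1)"
  have "compact (rGamma ` cbox (Complex x (- d)) (Complex m d))"
    by (intro compact_continuous_image continuous_intros) auto
  then obtain C where C: "\<And>z. z \<in> cbox (Complex x (- d)) (Complex m d) \<Longrightarrow> norm (rGamma z) \<le> C"
    using compact_imp_bounded bounded_iff by (metis imageI)
  define C' where "C' = max C 0"
  have "norm (rGamma (- w)) \<le> C' * exp (0 * (Re w - (- m)))" if "Re w \<le> - x" "\<bar>Im w\<bar> \<le> d" for w
  proof (rule geometric_decay[where U="{w. Re w \<le> - x \<and> \<bar>Im w\<bar> \<le> d}" and F="\<lambda>w. rGamma (- w)"])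
    fix w assume w: "w \<in> {w. Re w \<le> - x \<and> \<bar>Im w\<bar> \<le> d}"
    show "w + 1 \<in> {w. Re w \<le> - x \<and> \<bar>Im w\<bar> \<le> d}" if "Re w < - m"
      using w that by (auto simp: m_def)
    show "norm (rGamma (- w)) \<le> C' * exp (0 * (Re w - (- m)))" if "- m \<le> Re w"
      using C[of "- w"] w that by (simp add: C'_def in_cbox_complex_iff abs_le_iff le_max_iff_disj)
    show "norm (rGamma (- w)) \<le> exp (- 0) * norm (rGamma (- (w + 1)))" if "Re w < - m"
    proof -
      have "- (w + 1) * rGamma (- w) = rGamma (- (w + 1))"
        using rGamma_plus1[of "- (w + 1)"] by simp
      moreover have "1 \<le> norm (- (w + 1))"
        using abs_Re_le_cmod[of "- (w + 1)"] that by (simp add: m_def)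
      then have "1 * norm (rGamma (- w)) \<le> norm (- (w + 1)) * norm (rGamma (- w))" by (intro mult_right_mono) auto
      ultimately show ?thesis by (metis exp_zero minus_zero mult_1 norm_mult)
    qed
  qed (use that in auto)
  from this[of "- _"] show ?thesis
    by (intro that[of C']) (auto simp: C'_def)
qed

section \<open>Contour integrals as residue sums\<close>

lemma contour_integral_rectpath_simple_poles:
  fixes f :: "complex \<Rightarrow> complex"
  assumes holo: "f holomorphic_on {z. - c < Re z \<and> Re z < real N} - of_nat ` {..<N}"
    and lim: "\<And>k. k < N \<Longrightarrow> ((\<lambda>z. f z * (z - of_nat k)) \<longlongrightarrow> r k) (at (of_nat k))"
    and c: "c > 0"
    and st: "- c < Re s" "Re s < 0" "real N - 1 < Re t" "Re t < real N" "Im s < 0" "0 < Im t" "N \<ge> 1"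
  shows "contour_integral (rectpath s t) f = 2 * of_real pi * \<i> * (\<Sum>k<N. r k)"
proof -
  define S where "S = {z. - c < Re z \<and> Re z < real N}"
  define pts where "pts = (of_nat ` {..<N} :: complex set)"
  have conv: "convex S"
    unfolding S_def using convex_Int[OF convex_halfspace_Re_gt[of "-c"] convex_halfspace_Re_lt[of "real N"]]
    by (simp add: Collect_conj_eq)
  have op: "open S"
    unfolding S_def by (intro open_Collect_conj open_Collect_less continuous_intros)
  have le: "Re s \<le> Re t" "Im s \<le> Im t" using st by linarith+
  have box: "of_nat k \<in> box s t" if "k < N" for k :: nat
    using st that by (auto simp: in_box_complex_iff)
  have cb: "cbox s t \<subseteq> S"
    using st by (auto simp: in_cbox_complex_iff S_def)
  have res: "residue f (of_nat k) = r k" if k: "k < N" for k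
  proof (rule residue_simple'[OF _ _ _ lim[OF k]])
    show "open (S - (pts - {of_nat k}))"
      by (intro open_Diff op finite_imp_closed) (auto simp: pts_def)
    show "of_nat k \<in> S - (pts - {of_nat k})" using k c by (auto simp: S_def)
    show "f holomorphic_on S - (pts - {of_nat k}) - {of_nat k}"
      by (rule holomorphic_on_subset[OF holo]) (auto simp: S_def pts_def)
  qed
  have "contour_integral (rectpath s t) f = 2 * of_real pi * \<i> * (\<Sum>p\<in>pts. winding_number (rectpath s t) p * residue f p)"
  proof -
    have "path_image (rectpath s t) \<subseteq> S - pts"
    proof -
      have "path_image (rectpath s t) \<inter> pts = {}"
        using path_image_rectpath_inter_box[OF le] box by (auto simp: pts_def)
      then show ?thesis using path_image_rectpath_subset_cbox[OF le] cb by blast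
    qed
    moreover have "\<forall>z. z \<notin> S \<longrightarrow> winding_number (rectpath s t) z = 0"
      using winding_number_rectpath_outside[OF le] cb by blast
    ultimately show ?thesis
      using Residue_theorem[OF op convex_connected[OF conv], of pts f "rectpath s t"] holo
      by (simp add: pts_def S_def)
  qed
  also have "(\<Sum>p\<in>pts. winding_number (rectpath s t) p * residue f p) = (\<Sum>p\<in>pts. residue f p)"
    using box by (intro sum.cong) (auto simp: pts_def winding_number_rectpath)
  also have "\<dots> = (\<Sum>k<N. r k)"
    unfolding pts_def by (subst sum.reindex) (auto simp: inj_on_def res)
  finally show ?thesis .
qed

lemma Gamma_uminus_residue: "((\<lambda>z. Gamma (- z) * (z - of_nat k)) \<longlongrightarrow> - ((-1) ^ k / fact k)) (at (of_nat k :: complex))"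
proof -
  have "filterlim uminus (at (- of_nat k)) (at (of_nat k :: complex))"
    by (auto simp: filterlim_at eventually_at intro!: tendsto_eq_intros exI[of _ 1])
  from tendsto_minus[OF filterlim_compose[OF Gamma_residues this]]
  show ?thesis by (simp add: algebra_simps)
qed

text \<open>
  A Mellin--Barnes integral: closing the loop at \<open>Re z = N + 1/2\<close> collects the residues
  \<open>- (- 1)\<^sup>k / k! \<cdot> h(k)\<close> of \<open>\<Gamma>(- z) h(z)\<close> for \<open>k \<le> N\<close>, and the closing edge vanishes in the limit
  because \<open>\<Gamma>\<close> decays faster than any exponential.
\<close>

lemma right_loop_Gamma_sums:
  fixes h :: "complex \<Rightarrow> complex"
  assumes c: "0 < c'" "c' < c" "c < 1" and d: "d > 0"
    and holo: "h holomorphic_on {z. Re z > - c}"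
    and bd: "\<And>z. Re z \<ge> - c' \<Longrightarrow> \<bar>Im z\<bar> \<le> d \<Longrightarrow> norm (h z) \<le> C * exp (\<kappa> * Re z)"
    and \<kappa>: "\<kappa> \<ge> 0"
  shows "(\<lambda>k. (-1) ^ k / fact k * h (of_nat k)) sums
    (- (1 / (2 * of_real pi * \<i>) * right_loop_integral (- c') d (\<lambda>z. Gamma (- z) * h z)))"
proof -
  define f where "f = (\<lambda>z. Gamma (- z) * h z)"
  have holf: "f holomorphic_on T" if "\<And>z. z \<in> T \<Longrightarrow> Re z > - c \<and> (\<forall>k. z \<noteq> of_nat k)" for T
    unfolding f_def
  proof (intro holomorphic_on_mult holomorphic_on_subset[OF holo] holomorphic_Gamma')
    fix z assume "z \<in> T"
    then show "- z \<notin> \<int>\<^sub>\<le>\<^sub>0" using that[of z] by (auto elim!: nonpos_Ints_cases')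
  qed (use that in \<open>auto intro!: holomorphic_intros\<close>)
  have contf: "continuous_on T f" if "\<And>z. z \<in> T \<Longrightarrow> Re z > - c \<and> (\<forall>k. z \<noteq> of_nat k)" for T
    by (intro holomorphic_on_imp_continuous_on holf that)
  define \<eta> where "\<eta> = min d (1 / 2)"
  have \<eta>: "\<eta> > 0" using d by (simp add: \<eta>_def)
  obtain K where K: "K \<ge> 0" "\<And>z. Re z \<le> c' \<Longrightarrow> \<bar>Im z\<bar> \<le> d \<Longrightarrow> (\<And>k. dist z (of_int k) \<ge> \<eta>)
      \<Longrightarrow> norm (Gamma z) \<le> K * exp ((\<kappa> + 1) * Re z)"
    using Gamma_decay_off_Ints[OF \<eta>, of "\<kappa> + 1" c' d] \<kappa> by auto
  have bdf: "norm (f z) \<le> K * C * exp (- Re z)"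
    if z: "Re z \<ge> - c'" "\<bar>Im z\<bar> \<le> d" "\<And>k. dist (- z) (of_int k) \<ge> \<eta>" for z
  proof -
    have "norm (f z) \<le> (K * exp ((\<kappa> + 1) * Re (- z))) * (C * exp (\<kappa> * Re z))"
      unfolding f_def norm_mult using z K(1) by (intro mult_mono K(2) bd) auto
    also have "\<dots> = K * C * exp ((\<kappa> + 1) * Re (- z) + \<kappa> * Re z)"
      by (simp only: exp_add mult_ac)
    also have "(\<kappa> + 1) * Re (- z) + \<kappa> * Re z = - Re z"
      by (simp add: algebra_simps)
    finally show ?thesis .
  qed
  have d1: "dist (- z) (of_int k) \<ge> \<eta>" if "\<bar>Im z\<bar> = d" for z k
    using abs_Im_le_cmod[of "- z - of_int k"] that by (simp add: \<eta>_def dist_norm)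
  have d2: "dist (- z) (of_int k) \<ge> \<eta>" if "Re z = 1 / 2 + real N" for z k N
  proof -
    have "0 \<le> int N + k \<or> int N + k \<le> -1" by linarith
    then have "0 \<le> real_of_int (int N + k) \<or> real_of_int (int N + k) \<le> -1"
      by (metis of_int_0_le_iff of_int_le_iff of_int_minus of_int_1)
    then have "0 \<le> real N + of_int k \<or> real N + of_int k \<le> -1" by simp
    then have "1 / 2 \<le> \<bar>Re (- z - of_int k)\<bar>"
      using that by (auto simp: abs_if)
    then show ?thesis
      using abs_Re_le_cmod[of "- z - of_int k"] by (simp add: \<eta>_def dist_norm min.coboundedI2)
  qed
  have L: "(\<lambda>N. contour_integral (rectpath (Complex (- c') (- d)) (Complex (1/2 + real N) d)) f)
      \<longlonglongrightarrow> right_loop_integral (- c') d f"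
  proof (rule right_loop_integral_LIMSEQ[OF d, where K="K * C"])
    show "continuous_on {z. Re z \<ge> - c' \<and> \<bar>Im z\<bar> = d} f"
      using c d by (intro contf) auto
    show "continuous_on {z. Re z = - c' \<and> \<bar>Im z\<bar> \<le> d} f"
      using c d by (intro contf) auto
    show "continuous_on {z. Re z = 1 / 2 + real N \<and> \<bar>Im z\<bar> \<le> d} f" for N
    proof (rule contf)
      fix z assume z: "z \<in> {z. Re z = 1 / 2 + real N \<and> \<bar>Im z\<bar> \<le> d}"
      have "z \<noteq> of_nat k" for k
        using d2[of z N "- int k"] z \<eta> by auto
      then show "Re z > - c \<and> (\<forall>k. z \<noteq> of_nat k)" using z c by auto
    qed
    show "norm (f z) \<le> K * C * exp (- Re z)" if "Re z \<ge> - c'" "\<bar>Im z\<bar> = d" for z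
      using that by (intro bdf d1) auto
    show "norm (f z) \<le> K * C * exp (- Re z)" if "Re z = 1 / 2 + real N" "\<bar>Im z\<bar> \<le> d" for z N
      using that c by (intro bdf d2) auto
  qed
  have R: "contour_integral (rectpath (Complex (- c') (- d)) (Complex (1/2 + real N) d)) f
      = 2 * of_real pi * \<i> * (\<Sum>k<Suc N. - ((-1) ^ k / fact k) * h (of_nat k))" for N
  proof (rule contour_integral_rectpath_simple_poles[where c=c])
    show "f holomorphic_on {z. - c < Re z \<and> Re z < real (Suc N)} - of_nat ` {..<Suc N}"
    proof (rule holf)
      fix z :: complex assume z: "z \<in> {z. - c < Re z \<and> Re z < real (Suc N)} - of_nat ` {..<Suc N}"
      have "z \<noteq> of_nat k" for k using z by (cases "k < Suc N") auto
      with z show "Re z > - c \<and> (\<forall>k. z \<noteq> of_nat k)" by auto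
    qed
    fix k
    have "isCont h (of_nat k)"
      using c holomorphic_on_imp_continuous_on[OF holo]
      by (subst (asm) continuous_on_eq_continuous_at) (auto simp: open_halfspace_Re_gt)
    then have "((\<lambda>z. Gamma (- z) * (z - of_nat k) * h z) \<longlongrightarrow> - ((-1) ^ k / fact k) * h (of_nat k)) (at (of_nat k))"
      by (intro tendsto_mult Gamma_uminus_residue) (simp add: isCont_def)
    then show "((\<lambda>z. f z * (z - of_nat k)) \<longlongrightarrow> - ((-1) ^ k / fact k) * h (of_nat k)) (at (of_nat k))"
      by (simp add: f_def mult_ac)
  qed (use c d in auto)
  have L': "(\<lambda>N. - (1 / (2 * of_real pi * \<i>) * contour_integral (rectpath (Complex (- c') (- d)) (Complex (1/2 + real N) d)) f))
      \<longlonglongrightarrow> - (1 / (2 * of_real pi * \<i>) * right_loop_integral (- c') d f)"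
    by (intro tendsto_intros L)
  have E: "- (1 / (2 * of_real pi * \<i>) * (2 * of_real pi * \<i> * (\<Sum>k<Suc N. - ((-1) ^ k / fact k) * h (of_nat k))))
      = (\<Sum>k<Suc N. (-1) ^ k / fact k * h (of_nat k))" for N
    by (simp add: sum_negf del: sum.lessThan_Suc)
  have "(\<lambda>N. \<Sum>k<Suc N. (-1) ^ k / fact k * h (of_nat k))
      \<longlonglongrightarrow> - (1 / (2 * of_real pi * \<i>) * right_loop_integral (- c') d f)"
    using L' unfolding R E .
  then show ?thesis
    unfolding sums_def f_def by (rule LIMSEQ_imp_Suc)
qed

lemma prod_nat_diff_other:
  assumes "k < n"
  shows "(\<Prod>i\<in>{..<n} - {k}. of_nat k - of_nat i :: complex) = fact k * ((-1) ^ (n - 1 - k) * fact (n - 1 - k))"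
proof -
  have eq: "{..<n} - {k} = {..<k} \<union> {k<..<n}" using assms by auto
  have "(\<Prod>i\<in>{..<n} - {k}. of_nat k - of_nat i :: complex)
    = (\<Prod>i<k. of_nat k - of_nat i) * (\<Prod>i\<in>{k<..<n}. of_nat k - of_nat i)"
    unfolding eq by (rule prod.union_disjoint) auto
  also have "(\<Prod>i<k. of_nat k - of_nat i :: complex) = (\<Prod>i=1..k. of_nat i)"
    by (intro prod.reindex_bij_witness[of _ "\<lambda>i. k - i" "\<lambda>i. k - i"]) (simp_all add: of_nat_diff)
  also have "\<dots> = fact k" by (simp add: fact_prod)
  also have "(\<Prod>i\<in>{k<..<n}. of_nat k - of_nat i :: complex) = (\<Prod>i=1..n - 1 - k. (-1) * of_nat i)"
    by (rule prod.reindex_bij_witness[of _ "\<lambda>i. k + i" "\<lambda>i. i - k"]) (auto simp: of_nat_diff)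
  also have "\<dots> = (-1) ^ (n - 1 - k) * fact (n - 1 - k)"
    by (simp only: prod.distrib fact_prod prod_constant card_atLeastAtMost) simp
  finally show ?thesis .
qed

lemma contour_integral_rectpath_over_factors:
  fixes h :: "complex \<Rightarrow> complex"
  assumes holo: "h holomorphic_on {z. - c < Re z}" and c: "c > 0" and n: "n \<ge> 1"
    and st: "zeta_rectangle c n s t"
  shows "contour_integral (rectpath s t) (\<lambda>z. h z / (\<Prod>i<n. z - of_nat i))
    = 2 * of_real pi * \<i> * (\<Sum>k<n. h (of_nat k) * (-1) ^ (n - 1 - k) / (fact k * fact (n - 1 - k)))"
proof (rule contour_integral_rectpath_simple_poles[OF _ _ c])
  show "(\<lambda>z. h z / (\<Prod>i<n. z - of_nat i)) holomorphic_on {z. - c < Re z \<and> Re z < real n} - of_nat ` {..<n}"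
    by (intro holomorphic_intros holomorphic_on_subset[OF holo]) auto
  fix k assume k: "k < n"
  have cont: "isCont h (of_nat k)"
    using c holomorphic_on_imp_continuous_on[OF holo]
    by (subst (asm) continuous_on_eq_continuous_at) (auto simp: open_halfspace_Re_gt)
  have "((\<lambda>z. h z / (\<Prod>i\<in>{..<n} - {k}. z - of_nat i)) \<longlongrightarrow> h (of_nat k) / (\<Prod>i\<in>{..<n} - {k}. of_nat k - of_nat i)) (at (of_nat k))"
    using cont by (intro tendsto_intros) (auto simp: isCont_def)
  also have "h (of_nat k) / (\<Prod>i\<in>{..<n} - {k}. of_nat k - of_nat i) = h (of_nat k) * (-1) ^ (n - 1 - k) / (fact k * fact (n - 1 - k))"
    unfolding prod_nat_diff_other[OF k] by (simp add: field_simps flip: power_mult_distrib)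
  finally show "((\<lambda>z. h z / (\<Prod>i<n. z - of_nat i) * (z - of_nat k)) \<longlongrightarrow> h (of_nat k) * (-1) ^ (n - 1 - k) / (fact k * fact (n - 1 - k))) (at (of_nat k))"
  proof (rule Lim_transform_eventually)
    show "\<forall>\<^sub>F z in at (of_nat k). h z / (\<Prod>i\<in>{..<n} - {k}. z - of_nat i) = h z / (\<Prod>i<n. z - of_nat i) * (z - of_nat k)"
      using eventually_neq_at_within[of "of_nat k :: complex"]
    proof eventually_elim
      case (elim z)
      then show ?case using k by (subst (2) prod.remove[of _ k]) auto
    qed
  qed
qed (use st n in \<open>auto simp: zeta_rectangle_def\<close>)

section \<open>The residue coefficients and their limits\<close>

text \<open>
  After rescaling, the residues at \<open>\<zeta> = k\<close> of the two integrands are these coefficients times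
  \<open>- x\<^sup>k / (\<sigma> - k)\<close> and times a function of \<open>\<sigma>\<close> that does not depend on \<open>k\<close>. The truncated
  integrand has no pole at \<open>k \<ge> n\<close>.
\<close>

definition trunc_coeff :: "nat \<Rightarrow> (nat \<Rightarrow> nat) \<Rightarrow> (nat \<Rightarrow> nat) \<Rightarrow> nat \<Rightarrow> nat \<Rightarrow> complex"
  where "trunc_coeff n \<nu> l q k = (if k < n then (-1) ^ k / fact k * (fact (n - 1) / (fact (n - 1 - k) * of_nat n ^ k))
    * (\<Prod>j=1..q. pochhammer (of_nat (\<nu> j + l j)) k / of_nat (\<nu> j + l j) ^ k / Gamma (of_nat (\<nu> j + k))) else 0)"

definition hard_coeff :: "(nat \<Rightarrow> nat) \<Rightarrow> nat \<Rightarrow> nat \<Rightarrow> complex"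
  where "hard_coeff \<nu> q k = (-1) ^ k / fact k * (\<Prod>j=1..q. 1 / Gamma (of_nat (\<nu> j + k)))"

lemma falling_factorial_ratio:
  assumes "k < n"
  shows "fact (n - 1) / (fact (n - 1 - k) * of_nat n ^ k) = (\<Prod>i<k. 1 - of_nat (Suc i) / of_nat n :: complex)"
  using assms
proof (induction k)
  case (Suc k)
  have "n - 1 - k = Suc (n - 1 - Suc k)" using Suc.prems by simp
  then have f: "(fact (n - 1 - k) :: complex) = of_nat (n - 1 - k) * fact (n - 1 - Suc k)"
    by (metis fact_Suc)
  have "1 - of_nat (Suc k) / of_nat n = (of_nat (n - 1 - k) / of_nat n :: complex)"
    using Suc.prems by (simp add: of_nat_diff field_simps)
  moreover have "of_nat (n - 1 - k) \<noteq> (0 :: complex)" "of_nat n \<noteq> (0 :: complex)"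
    using Suc.prems unfolding of_nat_eq_0_iff by auto
  moreover have "x / (y * (N * p)) = x / (m * y * p) * (m / N)" if "m \<noteq> 0" for x y p m N :: complex
    using that by simp
  ultimately show ?case
    unfolding prod.lessThan_Suc power_Suc Suc.IH[OF Suc_lessD[OF Suc.prems], symmetric] f by metis
qed simp

lemma pochhammer_ratio:
  assumes "L \<ge> 1"
  shows "pochhammer (of_nat L) k / of_nat L ^ k = (\<Prod>i<k. 1 + of_nat i / of_nat L :: complex)"
proof -
  have "(\<Prod>i<k. 1 + of_nat i / of_nat L :: complex) = (\<Prod>i<k. (of_nat L + of_nat i) / of_nat L)"
    using assms by (intro prod.cong) (auto simp: field_simps)
  then show ?thesis
    by (simp add: pochhammer_prod prod_dividef lessThan_atLeast0)
qed

text \<open>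
  Written like this, each factor visibly tends to the corresponding factor of the limit.
\<close>

lemma trunc_coeff_altdef:
  assumes "k < n" "\<And>j. j \<in> {1..q} \<Longrightarrow> l j \<ge> 1"
  shows "trunc_coeff n \<nu> l q k = (-1) ^ k / fact k * (\<Prod>i<k. 1 - of_nat (Suc i) / of_nat n)
    * (\<Prod>j=1..q. (\<Prod>i<k. 1 + of_nat i / of_nat (\<nu> j + l j)) / Gamma (of_nat (\<nu> j + k)))"
proof -
  have "(\<Prod>j=1..q. pochhammer (of_nat (\<nu> j + l j)) k / of_nat (\<nu> j + l j) ^ k / Gamma (of_nat (\<nu> j + k)))
      = (\<Prod>j=1..q. (\<Prod>i<k. 1 + of_nat i / of_nat (\<nu> j + l j)) / Gamma (of_nat (\<nu> j + k) :: complex))"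
    using assms(2) by (intro prod.cong refl) (subst pochhammer_ratio, fastforce, rule refl)
  then show ?thesis
    using assms(1) falling_factorial_ratio[OF assms(1)] by (simp add: trunc_coeff_def)
qed

lemma norm_inverse_Gamma_nat_le:
  assumes "m \<ge> 1"
  shows "norm (1 / Gamma (of_nat m) :: complex) \<le> 1"
proof -
  have "Gamma (of_nat m) = (fact (m - 1) :: complex)"
    using assms Gamma_fact[of "m - 1", where 'a=complex] by (simp add: of_nat_diff)
  then show ?thesis by (simp add: norm_divide fact_ge_1)
qed

text \<open>
  A nonzero coefficient has \<open>k < n \<le> l j\<close>, so each factor \<open>1 + i / (\<nu> j + l j)\<close> with \<open>i < k\<close> is at
  most 2. The bound does not depend on \<open>n\<close> or \<open>l\<close>.
\<close>

lemma norm_trunc_coeff_le: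
  assumes \<nu>: "\<And>j. j \<ge> 1 \<Longrightarrow> \<nu> j \<ge> 1" and l: "\<And>j. j \<in> {1..q} \<Longrightarrow> n \<le> l j" and n: "n \<ge> 1"
  shows "norm (trunc_coeff n \<nu> l q k) \<le> (2 ^ q) ^ k / fact k"
proof (cases "k < n")
  case True
  have a: "norm (\<Prod>i<k. 1 - of_nat (Suc i) / of_nat n :: complex) \<le> 1"
  proof -
    have "norm (1 - of_nat (Suc i) / of_nat n :: complex) \<le> 1" if "i < k" for i
    proof -
      have "(1 - of_nat (Suc i) / of_nat n :: complex) = of_real (1 - real (Suc i) / real n)" by simp
      moreover have "\<bar>1 - real (Suc i) / real n\<bar> \<le> 1" using that True by (auto simp: field_simps abs_le_iff)
      ultimately show ?thesis by (metis norm_of_real)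
    qed
    then have "(\<Prod>i<k. norm (1 - of_nat (Suc i) / of_nat n :: complex)) \<le> (\<Prod>i<k. 1)"
      by (intro prod_mono) auto
    then show ?thesis by (simp add: prod_norm)
  qed
  have b: "norm ((\<Prod>i<k. 1 + of_nat i / of_nat (\<nu> j + l j)) / Gamma (of_nat (\<nu> j + k)) :: complex) \<le> 2 ^ k"
    if j: "j \<in> {1..q}" for j
  proof -
    have "norm (1 + of_nat i / of_nat (\<nu> j + l j) :: complex) \<le> 2" if "i < k" for i
    proof -
      have "real i \<le> real (\<nu> j + l j)" using l[OF j] True that by simp
      then have "real i / real (\<nu> j + l j) \<le> 1" by (intro divide_le_eq_1[THEN iffD2]) auto
      then show ?thesis
        by (intro order_trans[OF norm_triangle_ineq]) (simp add: norm_divide del: of_nat_add)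
    qed
    then have "(\<Prod>i<k. norm (1 + of_nat i / of_nat (\<nu> j + l j) :: complex)) \<le> (\<Prod>i<k. 2)"
      by (intro prod_mono) auto
    then have "norm (\<Prod>i<k. 1 + of_nat i / of_nat (\<nu> j + l j) :: complex) * norm (1 / Gamma (of_nat (\<nu> j + k)) :: complex) \<le> 2 ^ k * 1"
      using \<nu>[of j] j by (intro mult_mono norm_inverse_Gamma_nat_le) (auto simp: prod_norm)
    then show ?thesis by (simp add: norm_divide)
  qed
  have "norm (\<Prod>j=1..q. (\<Prod>i<k. 1 + of_nat i / of_nat (\<nu> j + l j)) / Gamma (of_nat (\<nu> j + k)) :: complex)
      \<le> (\<Prod>j=1..q. 2 ^ k)"
    unfolding prod_norm[symmetric] using b by (intro prod_mono) auto
  then have B: "norm (\<Prod>j=1..q. (\<Prod>i<k. 1 + of_nat i / of_nat (\<nu> j + l j)) / Gamma (of_nat (\<nu> j + k)) :: complex) \<le> (2 ^ q) ^ k"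
    by (simp add: power_mult[symmetric] mult.commute)
  have l1: "l j \<ge> 1" if "j \<in> {1..q}" for j using l[OF that] n by simp
  have "norm (trunc_coeff n \<nu> l q k) = 1 / fact k * norm (\<Prod>i<k. 1 - of_nat (Suc i) / of_nat n :: complex)
      * norm (\<Prod>j=1..q. (\<Prod>i<k. 1 + of_nat i / of_nat (\<nu> j + l j)) / Gamma (of_nat (\<nu> j + k)) :: complex)"
    by (subst trunc_coeff_altdef[OF True l1]) (simp_all only: norm_mult norm_divide norm_power norm_minus_cancel norm_one power_one norm_fact)
  also have "\<dots> \<le> 1 / fact k * 1 * (2 ^ q) ^ k"
    by (intro mult_mono a B mult_nonneg_nonneg norm_ge_zero) auto
  finally have "norm (trunc_coeff n \<nu> l q k) \<le> 1 / fact k * 1 * (2 ^ q) ^ k" .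
  then show ?thesis by simp
qed (simp add: trunc_coeff_def)

lemma norm_hard_coeff_le:
  assumes \<nu>: "\<And>j. j \<ge> 1 \<Longrightarrow> \<nu> j \<ge> 1"
  shows "norm (hard_coeff \<nu> q k) \<le> 1 / fact k"
proof -
  have "1 \<le> \<nu> j + k" if "j \<in> {1..q}" for j using \<nu>[of j] that by simp
  then have "norm (\<Prod>j=1..q. 1 / Gamma (of_nat (\<nu> j + k)) :: complex) \<le> (\<Prod>j=1..q. 1)"
    unfolding prod_norm[symmetric]
    by (intro prod_mono conjI norm_ge_zero norm_inverse_Gamma_nat_le)
  then have "norm (hard_coeff \<nu> q k) \<le> 1 / fact k * 1"
    unfolding hard_coeff_def norm_mult by (intro mult_mono) (auto simp: norm_divide norm_power)
  then show ?thesis by simp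
qed

lemma trunc_coeff_tendsto:
  fixes n :: "nat \<Rightarrow> nat" and l :: "nat \<Rightarrow> nat \<Rightarrow> nat"
  assumes n: "filterlim n at_top sequentially"
    and l: "\<And>j. j \<ge> 1 \<Longrightarrow> filterlim (l j) at_top sequentially" "\<And>j \<alpha>. j \<ge> 1 \<Longrightarrow> l j \<alpha> \<ge> 1"
  shows "(\<lambda>\<alpha>. trunc_coeff (n \<alpha>) \<nu> (\<lambda>j. l j \<alpha>) q k) \<longlonglongrightarrow> hard_coeff \<nu> q k"
proof -
  have n': "(\<lambda>\<alpha>. of_nat i / of_nat (n \<alpha>) :: complex) \<longlonglongrightarrow> 0" for i
    using filterlim_compose[OF lim_const_over_n[where 'a=complex] n] .
  have l': "(\<lambda>\<alpha>. of_nat i / of_nat (\<nu> j + l j \<alpha>) :: complex) \<longlonglongrightarrow> 0" if "j \<ge> 1" for i j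
  proof (rule filterlim_compose[OF lim_const_over_n[where 'a=complex]])
    show "filterlim (\<lambda>\<alpha>. \<nu> j + l j \<alpha>) at_top sequentially"
      by (rule filterlim_at_top_mono[OF l(1)[OF that]]) auto
  qed
  have "(\<lambda>\<alpha>. (-1) ^ k / fact k * (\<Prod>i<k. 1 - of_nat (Suc i) / of_nat (n \<alpha>))
      * (\<Prod>j=1..q. (\<Prod>i<k. 1 + of_nat i / of_nat (\<nu> j + l j \<alpha>)) / Gamma (of_nat (\<nu> j + k) :: complex)))
    \<longlonglongrightarrow> (-1) ^ k / fact k * (\<Prod>i<k. 1 - 0) * (\<Prod>j=1..q. (\<Prod>i<k. 1 + 0) * (1 / Gamma (of_nat (\<nu> j + k))))"
    unfolding divide_inverse[of "prod _ _"] divide_inverse[of 1 "Gamma _"] mult_1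
    by (intro tendsto_mult tendsto_prod tendsto_diff tendsto_add tendsto_const n' l') auto
  then have "(\<lambda>\<alpha>. (-1) ^ k / fact k * (\<Prod>i<k. 1 - of_nat (Suc i) / of_nat (n \<alpha>))
      * (\<Prod>j=1..q. (\<Prod>i<k. 1 + of_nat i / of_nat (\<nu> j + l j \<alpha>)) / Gamma (of_nat (\<nu> j + k) :: complex)))
    \<longlonglongrightarrow> hard_coeff \<nu> q k"
    by (simp add: hard_coeff_def)
  then show ?thesis
  proof (rule Lim_transform_eventually)
    have "\<forall>\<^sub>F \<alpha> in sequentially. k < n \<alpha>"
      by (rule eventually_compose_filterlim[OF eventually_gt_at_top n])
    then show "\<forall>\<^sub>F \<alpha> in sequentially. (-1) ^ k / fact k * (\<Prod>i<k. 1 - of_nat (Suc i) / of_nat (n \<alpha>))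
      * (\<Prod>j=1..q. (\<Prod>i<k. 1 + of_nat i / of_nat (\<nu> j + l j \<alpha>)) / Gamma (of_nat (\<nu> j + k) :: complex))
      = trunc_coeff (n \<alpha>) \<nu> (\<lambda>j. l j \<alpha>) q k"
      by eventually_elim (rule trunc_coeff_altdef[symmetric], use l(2) in auto)
  qed
qed

lemma power_fact_sums_exp: "(\<lambda>k. C ^ k / fact k) sums exp (C :: real)"
  using exp_converges[of C] by (simp add: field_simps)

text \<open>
  The residue sums as functions of \<open>\<sigma>\<close>. The exponential series dominates them uniformly on any set that
  keeps a positive distance from the poles \<open>0, 1, 2, \<dots>\<close>.
\<close>

lemma pole_series:
  fixes a :: "nat \<Rightarrow> complex" and x :: real
  assumes a: "\<And>k. norm (a k) \<le> B ^ k / fact k" and B: "B \<ge> 0" and x: "0 \<le> x" "x \<le> M" and c: "c > 0"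
    and S: "\<And>\<sigma> k. \<sigma> \<in> S \<Longrightarrow> c \<le> norm (\<sigma> - of_nat k)"
  shows "\<And>\<sigma> k. \<sigma> \<in> S \<Longrightarrow> norm (a k * of_real x ^ k / (\<sigma> - of_nat k)) \<le> (B * M) ^ k / fact k / c"
    and "\<And>\<sigma>. \<sigma> \<in> S \<Longrightarrow> summable (\<lambda>k. a k * of_real x ^ k / (\<sigma> - of_nat k))"
    and "\<And>\<sigma>. \<sigma> \<in> S \<Longrightarrow> norm (\<Sum>k. a k * of_real x ^ k / (\<sigma> - of_nat k)) \<le> exp (B * M) / c"
    and "continuous_on S (\<lambda>\<sigma>. \<Sum>k. a k * of_real x ^ k / (\<sigma> - of_nat k))"
proof -
  show bd: "norm (a k * of_real x ^ k / (\<sigma> - of_nat k)) \<le> (B * M) ^ k / fact k / c" if "\<sigma> \<in> S" for \<sigma> k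
  proof -
    have "norm (a k * of_real x ^ k / (\<sigma> - of_nat k)) \<le> B ^ k / fact k * M ^ k / c"
      unfolding norm_divide norm_mult norm_power norm_of_real
      using a[of k] S[OF that, of k] x c B by (intro frac_le mult_mono power_mono mult_nonneg_nonneg) auto
    then show ?thesis by (simp add: power_mult_distrib)
  qed
  have sm: "(\<lambda>k. (B * M) ^ k / fact k / c) sums (exp (B * M) / c)"
    by (intro sums_divide power_fact_sums_exp)
  show sum: "summable (\<lambda>k. a k * of_real x ^ k / (\<sigma> - of_nat k))" if "\<sigma> \<in> S" for \<sigma>
    by (rule summable_comparison_test'[OF sums_summable[OF sm]]) (rule bd[OF that])
  show "norm (\<Sum>k. a k * of_real x ^ k / (\<sigma> - of_nat k)) \<le> exp (B * M) / c" if "\<sigma> \<in> S" for \<sigma>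
    using norm_suminf_le[OF bd[OF that] sums_summable[OF sm]] sums_unique[OF sm] by simp
  have "\<forall>\<^sub>F n in sequentially. continuous_on S (\<lambda>\<sigma>. \<Sum>k<n. a k * of_real x ^ k / (\<sigma> - of_nat k))"
  proof (intro always_eventually allI continuous_intros ballI)
    fix \<sigma> k assume "\<sigma> \<in> S"
    with S[of \<sigma> k] c show "\<sigma> - of_nat k \<noteq> 0" by auto
  qed
  then show "continuous_on S (\<lambda>\<sigma>. \<Sum>k. a k * of_real x ^ k / (\<sigma> - of_nat k))"
    by (rule uniform_limit_theorem[OF _ Weierstrass_m_test[OF bd sums_summable[OF sm]]]) simp_all
qed

section \<open>The inner integrals of the two kernels\<close>

lemma powr_mult_pos: "a > 0 \<Longrightarrow> b > 0 \<Longrightarrow> of_real (a * b) powr (z :: complex) = of_real a powr z * of_real b powr z"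
  by (simp add: powr_times_real)

lemma powr_prod_pos:
  assumes "finite J" "\<And>j. j \<in> J \<Longrightarrow> L j > (0::real)"
  shows "of_real (\<Prod>j\<in>J. L j) powr (z :: complex) = (\<Prod>j\<in>J. of_real (L j) powr z)"
  using assms
proof (induction J rule: finite_induct)
  case (insert j J)
  then show ?case using powr_mult_pos[of "L j" "prod L J" z] by (simp add: prod_pos)
qed auto

lemma powr_divide_pos: "a > 0 \<Longrightarrow> b > 0 \<Longrightarrow> of_real (a / b) powr (z :: complex) = of_real a powr z * of_real b powr (- z)"
  by (simp add: powr_def Ln_of_real Ln_divide_of_real exp_diff exp_minus field_simps ln_div)

lemma norm_powr_real_le:
  assumes "y > 0" "\<bar>ln y\<bar> \<le> m"
  shows "norm (of_real y powr z) \<le> exp (m * \<bar>Re z\<bar>)"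
proof -
  have "norm (of_real y powr z) = exp (Re z * ln y)"
    using assms by (simp add: powr_def Ln_of_real norm_exp)
  also have "Re z * ln y \<le> \<bar>Re z\<bar> * \<bar>ln y\<bar>" by (metis abs_ge_self abs_mult)
  also have "\<dots> \<le> m * \<bar>Re z\<bar>" using assms by (metis abs_ge_zero mult.commute mult_left_mono)
  finally show ?thesis by simp
qed

text \<open>
  The ratio of the \<open>j = 0\<close> factors of the truncated kernel is a polynomial because \<open>\<ell>\<^sub>0 = - n\<close>.
\<close>

lemma Gamma_ratio_descending:
  assumes "z \<notin> \<int>"
  shows "Gamma (1 + z) / Gamma (1 - of_nat n + z) = (\<Prod>i<n. z - of_nat i :: complex)"
proof -
  have ni: "1 - of_nat n + z \<notin> \<int>\<^sub>\<le>\<^sub>0"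
  proof
    assume "1 - of_nat n + z \<in> \<int>\<^sub>\<le>\<^sub>0"
    then have "1 - of_nat n + z - (1 - of_nat n) \<in> \<int>"
      by (intro Ints_diff nonpos_Ints_Int Ints_1 Ints_of_nat)
    with assms show False by simp
  qed
  have "Gamma (1 + z) / Gamma (1 - of_nat n + z) = pochhammer (1 - of_nat n + z) n"
    using pochhammer_Gamma[OF ni, of n] by (simp add: algebra_simps)
  also have "\<dots> = (\<Prod>i<n. z - of_nat i)"
    unfolding pochhammer_prod
    by (rule prod.reindex_bij_witness[of _ "\<lambda>i. n - 1 - i" "\<lambda>i. n - 1 - i"]) (auto simp: of_nat_diff)
  finally show ?thesis .
qed

lemma prod_minus_pochhammer: "(\<Prod>i<n. z - of_nat i :: complex) = (-1) ^ n * pochhammer (- z) n"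
proof -
  have "(\<Prod>i<n. z - of_nat i :: complex) = (\<Prod>i=0..<n. (-1) * (- z + of_nat i))"
    by (simp add: lessThan_atLeast0)
  also have "\<dots> = (-1) ^ n * pochhammer (- z) n"
    by (simp only: prod.distrib pochhammer_prod prod_constant) simp
  finally show ?thesis .
qed

lemma Gamma_ratio_trunc:
  assumes ni: "\<sigma> + of_nat \<nu> \<notin> \<int>\<^sub>\<le>\<^sub>0" and l: "l \<ge> 1"
  shows "Gamma (of_nat \<nu> + \<sigma>) / Gamma (of_nat (\<nu> + l) + \<sigma>)
    = trunc_Gamma \<nu> l \<sigma> * of_nat (\<nu> + l) powr (- \<sigma>) / Gamma (of_nat (\<nu> + l))"
proof -
  have "Gamma (of_nat \<nu> + \<sigma>) / Gamma (of_nat (\<nu> + l) + \<sigma>) = 1 / pochhammer (\<sigma> + of_nat \<nu>) l"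
    using pochhammer_Gamma[OF ni, of l] by (simp add: algebra_simps)
  moreover have "Gamma (of_nat (\<nu> + l)) = (fact (\<nu> + l - 1) :: complex)"
    using l Gamma_fact[of "\<nu> + l - 1", where 'a=complex] by (simp add: of_nat_diff)
  moreover have "of_nat (\<nu> + l) powr (- \<sigma>) = exp (- (\<sigma> * of_real (ln (real (\<nu> + l)))))"
    using l by (simp add: powr_def Ln_of_nat del: of_nat_add)
  ultimately show ?thesis
    by (simp add: trunc_Gamma_def exp_minus)
qed

definition truncated_integrand ::
  "nat \<Rightarrow> (nat \<Rightarrow> nat) \<Rightarrow> (nat \<Rightarrow> nat) \<Rightarrow> nat \<Rightarrow> nat \<Rightarrow> real \<Rightarrow> real \<Rightarrow> complex \<Rightarrow> complex \<Rightarrow> complex"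
  where "truncated_integrand n \<nu> l q r x y \<sigma> \<zeta> =
    (\<Prod>j=0..r. Gamma (of_nat (\<nu> j) + \<sigma>)) / (\<Prod>j=0..q. Gamma (of_nat (\<nu> j) + \<zeta>))
    * ((\<Prod>j=0..q. Gamma (of_nat (\<nu> j) + of_int (with_ell0 n l j) + \<zeta>))
       / (\<Prod>j=0..r. Gamma (of_nat (\<nu> j) + of_int (with_ell0 n l j) + \<sigma>)))
    * (of_real x powr \<zeta> * of_real y powr (- \<sigma> - 1) / (\<sigma> - \<zeta>))"

definition hard_integrand :: "(nat \<Rightarrow> nat) \<Rightarrow> nat \<Rightarrow> nat \<Rightarrow> real \<Rightarrow> real \<Rightarrow> complex \<Rightarrow> complex \<Rightarrow> complex"
  where "hard_integrand \<nu> q r x y \<sigma> \<zeta> =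
    (\<Prod>j=1..r. Gamma (\<sigma> + of_nat (\<nu> j))) / (\<Prod>j=1..q. Gamma (\<zeta> + of_nat (\<nu> j)))
    * (Gamma (- \<zeta>) / Gamma (- \<sigma>))
    * (of_real x powr \<zeta> * of_real y powr (- \<sigma> - 1) / (\<sigma> - \<zeta>))"

text \<open>
  Off the poles, the integrand is \<open>A h(\<zeta>) / (\<zeta> (\<zeta> - 1) \<cdots> (\<zeta> - n + 1))\<close> with \<open>h\<close> holomorphic on
  \<open>Re \<zeta> > - c\<close> and \<open>A\<close> independent of \<open>\<zeta>\<close>. All powers of \<open>n\<close> and of the \<open>L\<^sub>j\<close> introduced by the scaling
  combine with \<open>A\<close>, the residues of \<open>h\<close> and the prefactor into the Euler products and \<open>trunc_coeff\<close>.
\<close>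

lemma truncated_zeta_integral:
  fixes n q r :: nat and \<nu> l :: "nat \<Rightarrow> nat"
  assumes \<nu>: "\<nu> 0 = 1" "\<And>j. j \<ge> 1 \<Longrightarrow> \<nu> j \<ge> 1" and l: "\<And>j. j \<ge> 1 \<Longrightarrow> l j \<ge> 1" and n: "n \<ge> 1"
    and c: "0 < c" "c < 1" and st: "zeta_rectangle c n s t"
    and \<sigma>: "Re \<sigma> \<le> - c" "\<sigma> \<notin> \<int>" and xy: "x > 0" "y > 0"
  defines "X \<equiv> real n * (\<Prod>j=1..q. real (l j) + real (\<nu> j))"
    and "Y \<equiv> real n * (\<Prod>j=1..r. real (l j) + real (\<nu> j))"
  shows "of_real (hard_edge_prefactor n \<nu> l q r) * (1 / (2 * of_real pi * \<i>) * contour_integral (rectpath s t) (truncated_integrand n \<nu> l q r (x / X) (y / Y) \<sigma>))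
    = trunc_rGamma n \<sigma> * (\<Prod>j=1..r. trunc_Gamma (\<nu> j) (l j) \<sigma>) * of_real y powr (- \<sigma> - 1)
      * (- (\<Sum>k<n. trunc_coeff n \<nu> l q k * of_real x ^ k / (\<sigma> - of_nat k)))"
proof -
  define L where "L j = real (\<nu> j + l j)" for j
  have L: "L j > 0" "L j \<noteq> 0" if "j \<ge> 1" for j using l[OF that] by (auto simp: L_def)
  have X: "X > 0" and Y: "Y > 0"
    unfolding X_def Y_def using n L(1) by (auto intro!: mult_pos_pos prod_pos simp: L_def add.commute)
  define h where "h = (\<lambda>\<zeta>. (\<Prod>j=1..q. Gamma (of_nat (\<nu> j + l j) + \<zeta>) * rGamma (of_nat (\<nu> j) + \<zeta>))
      * of_real (x / X) powr \<zeta> / (\<sigma> - \<zeta>))"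
  define A where "A = (\<Prod>i<n. \<sigma> - of_nat i) * (\<Prod>j=1..r. Gamma (of_nat (\<nu> j) + \<sigma>) / Gamma (of_nat (\<nu> j + l j) + \<sigma>))
      * of_real (y / Y) powr (- \<sigma> - 1)"
  have holo: "h holomorphic_on {z. - c < Re z}"
    unfolding h_def
  proof (intro holomorphic_intros)
    fix j z assume "j \<in> {1..q}" "z \<in> {z. - c < Re z}"
    then have "Re (of_nat (\<nu> j + l j) + z) > 0" using \<nu>(2)[of j] l[of j] c by (simp add: algebra_simps)
    moreover have "w \<notin> \<int>\<^sub>\<le>\<^sub>0" if "Re w > 0" for w :: complex
      using that by (auto elim!: nonpos_Ints_cases')
    ultimately show "of_nat (\<nu> j + l j) + z \<notin> \<int>\<^sub>\<le>\<^sub>0" by blast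
  qed (use \<sigma> X xy in auto)
  have split0: "(\<Prod>j=0..m. g j) = g 0 * (\<Prod>j=1..m. g j)" for g :: "nat \<Rightarrow> complex" and m
    by (simp add: prod.atLeast_Suc_atMost)
  have nonint: "\<zeta> \<notin> \<int>" if "\<zeta> \<in> path_image (rectpath s t)" for \<zeta>
  proof
    assume "\<zeta> \<in> \<int>"
    then obtain k where k: "\<zeta> = of_int k" by (auto elim: Ints_cases)
    have "Re s < Re t" "Im s < Im t" using st n c by (auto simp: zeta_rectangle_def)
    with that st k have "real_of_int k = Re s \<or> real_of_int k = Re t"
      by (subst (asm) path_image_rectpath) (auto simp: zeta_rectangle_def)
    then show False
    proof
      assume "real_of_int k = Re s"
      then have "real_of_int (-1) < real_of_int k" "real_of_int k < real_of_int 0" using st c by (auto simp: zeta_rectangle_def)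
      then show False unfolding of_int_less_iff by linarith
    next
      assume "real_of_int k = Re t"
      then have "real_of_int (int n - 1) < real_of_int k" "real_of_int k < real_of_int (int n)"
        using st by (auto simp: zeta_rectangle_def)
      then show False unfolding of_int_less_iff by linarith
    qed
  qed
  have "contour_integral (rectpath s t) (truncated_integrand n \<nu> l q r (x / X) (y / Y) \<sigma>)
     = contour_integral (rectpath s t) (\<lambda>\<zeta>. (A * h \<zeta>) / (\<Prod>i<n. \<zeta> - of_nat i))"
  proof (rule contour_integral_eq)
    fix \<zeta> assume "\<zeta> \<in> path_image (rectpath s t)"
    from nonint[OF this] have \<zeta>: "\<zeta> \<notin> \<int>" .
    have e1: "(\<Prod>j=1..m. Gamma (of_nat (\<nu> j) + of_int (with_ell0 n l j) + z)) = (\<Prod>j=1..m. Gamma (of_nat (\<nu> j + l j) + z))"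
      for z :: complex and m
      by (intro prod.cong) (auto simp: with_ell0_def)
    have e2: "(\<Prod>j=1..q. Gamma (of_nat (\<nu> j + l j) + \<zeta>) * rGamma (of_nat (\<nu> j) + \<zeta>))
        = (\<Prod>j=1..q. Gamma (of_nat (\<nu> j + l j) + \<zeta>)) / (\<Prod>j=1..q. Gamma (of_nat (\<nu> j) + \<zeta>))"
      by (simp add: rGamma_inverse_Gamma flip: prod_dividef divide_inverse)
    show "truncated_integrand n \<nu> l q r (x / X) (y / Y) \<sigma> \<zeta> = A * h \<zeta> / (\<Prod>i<n. \<zeta> - of_nat i)"
      unfolding truncated_integrand_def split0 e1 A_def h_def e2 prod_dividef \<nu>(1)
        Gamma_ratio_descending[OF \<zeta>, of n, symmetric] Gamma_ratio_descending[OF \<sigma>(2), of n, symmetric]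
      by (simp add: with_ell0_def mult_ac)
  qed
  also have "\<dots> = 2 * of_real pi * \<i> * (\<Sum>k<n. A * h (of_nat k) * (-1) ^ (n - 1 - k) / (fact k * fact (n - 1 - k)))"
    by (rule contour_integral_rectpath_over_factors[OF _ c(1) n st]) (intro holomorphic_intros holo)
  finally have int: "1 / (2 * of_real pi * \<i>) * contour_integral (rectpath s t) (truncated_integrand n \<nu> l q r (x / X) (y / Y) \<sigma>)
     = (\<Sum>k<n. A * h (of_nat k) * (-1) ^ (n - 1 - k) / (fact k * fact (n - 1 - k)))"
    by simp
  define Gq where "Gq = (\<Prod>j=1..q. Gamma (of_nat (\<nu> j + l j)) :: complex)"
  define Gr where "Gr = (\<Prod>j=1..r. Gamma (of_nat (\<nu> j + l j)) :: complex)"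
  define Lr where "Lr = (\<Prod>j=1..r. of_nat (\<nu> j + l j) :: complex)"
  have GL: "Gamma (of_nat (\<nu> j + l j) :: complex) \<noteq> 0" if "j \<ge> 1" for j
    using l[OF that] by (auto simp: Gamma_eq_zero_iff of_nat_in_nonpos_Ints_iff simp del: of_nat_add)
  have nz: "Gr \<noteq> 0" "Gq \<noteq> 0" "Lr \<noteq> 0" "of_nat n \<noteq> (0 :: complex)"
    unfolding Gr_def Gq_def Lr_def using GL l n by (auto simp del: of_nat_add) (force dest: l)
  have P: "of_real (hard_edge_prefactor n \<nu> l q r) = (1 / of_nat n * Gr) / (Lr * Gq)"
    by (simp add: hard_edge_prefactor_def Gr_def Gq_def Lr_def add.commute flip: Gamma_complex_of_real)
  have A: "A = (-1) ^ n * (trunc_rGamma n \<sigma> * fact (n - 1) * of_nat n)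
      * ((\<Prod>j=1..r. trunc_Gamma (\<nu> j) (l j) \<sigma>) * Lr / Gr) * of_real y powr (- \<sigma> - 1)"
  proof -
    have "of_real (y / Y) powr (- \<sigma> - 1) = of_real y powr (- \<sigma> - 1) * of_real Y powr (\<sigma> + 1)"
      using powr_divide_pos[OF xy(2) Y, of "- \<sigma> - 1"] by (simp add: add.commute)
    also have "of_real Y powr (\<sigma> + 1) = of_nat n powr (\<sigma> + 1) * (\<Prod>j=1..r. of_nat (\<nu> j + l j) powr (\<sigma> + 1))"
    proof -
      have Yeq: "Y = real n * (\<Prod>j=1..r. L j)" by (simp add: Y_def L_def add.commute)
      have "(\<Prod>j=1..r. L j) > 0" using L by (intro prod_pos) auto
      then have "of_real Y powr (\<sigma> + 1) = of_real (real n) powr (\<sigma> + 1) * (\<Prod>j=1..r. of_real (L j) powr (\<sigma> + 1))"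
        unfolding Yeq using n L(1) powr_mult_pos[of "real n" "\<Prod>j=1..r. L j" "\<sigma> + 1"] powr_prod_pos[of "{1..r}" L "\<sigma> + 1"]
        by (simp del: of_real_of_nat_eq of_real_prod of_real_mult)
      then show ?thesis by (simp add: L_def)
    qed
    finally have y: "of_real (y / Y) powr (- \<sigma> - 1) = of_real y powr (- \<sigma> - 1)
        * (of_nat n powr (\<sigma> + 1) * (\<Prod>j=1..r. of_nat (\<nu> j + l j) powr (\<sigma> + 1)))" .
    have f1: "pochhammer (- \<sigma>) n * of_nat n powr (\<sigma> + 1) = trunc_rGamma n \<sigma> * fact (n - 1) * of_nat n"
    proof -
      have "of_nat n powr (\<sigma> + 1) = of_nat n * exp (\<sigma> * of_real (ln (real n)))"
        using n by (simp add: powr_add mult.commute) (simp add: powr_def Ln_of_nat)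
      then show ?thesis by (simp add: trunc_rGamma_def)
    qed
    have f2: "Gamma (of_nat (\<nu> j) + \<sigma>) / Gamma (of_nat (\<nu> j + l j) + \<sigma>) * of_nat (\<nu> j + l j) powr (\<sigma> + 1)
        = trunc_Gamma (\<nu> j) (l j) \<sigma> * of_nat (\<nu> j + l j) / Gamma (of_nat (\<nu> j + l j))" if "j \<in> {1..r}" for j
    proof -
      have nz: "of_nat (\<nu> j + l j) \<noteq> (0 :: complex)" using that l[of j] by (simp del: of_nat_add)
      have "of_nat (\<nu> j + l j) powr (- \<sigma>) * of_nat (\<nu> j + l j) powr (\<sigma> + 1) = (of_nat (\<nu> j + l j) powr 1 :: complex)"
        by (simp flip: powr_add del: of_nat_add)
      also have "\<dots> = of_nat (\<nu> j + l j)" using nz by (simp del: of_nat_add)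
      finally have e: "of_nat (\<nu> j + l j) powr (- \<sigma>) * of_nat (\<nu> j + l j) powr (\<sigma> + 1) = (of_nat (\<nu> j + l j) :: complex)" .
      have assoc: "D * u / G * v = D * w / G" if "u * v = w" for D u v w G :: complex
        using that by (auto simp: mult_ac)
      have ni: "\<sigma> + of_nat (\<nu> j) \<notin> \<int>\<^sub>\<le>\<^sub>0"
      proof
        assume "\<sigma> + of_nat (\<nu> j) \<in> \<int>\<^sub>\<le>\<^sub>0"
        then have "\<sigma> + of_nat (\<nu> j) - of_nat (\<nu> j) \<in> \<int>" by (intro Ints_diff nonpos_Ints_Int Ints_of_nat)
        with \<sigma>(2) show False by simp
      qed
      from assoc[OF e] show ?thesis
        using that l[of j] by (subst Gamma_ratio_trunc[OF ni]) auto
    qed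
    have "A = (-1) ^ n * (pochhammer (- \<sigma>) n * of_nat n powr (\<sigma> + 1))
        * (\<Prod>j=1..r. Gamma (of_nat (\<nu> j) + \<sigma>) / Gamma (of_nat (\<nu> j + l j) + \<sigma>) * of_nat (\<nu> j + l j) powr (\<sigma> + 1))
        * of_real y powr (- \<sigma> - 1)"
      unfolding A_def y prod_minus_pochhammer prod.distrib by (simp only: mult_ac)
    also have "(\<Prod>j=1..r. Gamma (of_nat (\<nu> j) + \<sigma>) / Gamma (of_nat (\<nu> j + l j) + \<sigma>) * of_nat (\<nu> j + l j) powr (\<sigma> + 1))
        = (\<Prod>j=1..r. trunc_Gamma (\<nu> j) (l j) \<sigma> * of_nat (\<nu> j + l j) / Gamma (of_nat (\<nu> j + l j)))"
      by (intro prod.cong refl f2)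
    also have "\<dots> = (\<Prod>j=1..r. trunc_Gamma (\<nu> j) (l j) \<sigma>) * Lr / Gr"
      by (simp only: prod.distrib prod_dividef Lr_def Gr_def)
    finally show ?thesis unfolding f1 .
  qed
  have PA: "of_real (hard_edge_prefactor n \<nu> l q r) * A
      = (-1) ^ n * fact (n - 1) * (trunc_rGamma n \<sigma> * (\<Prod>j=1..r. trunc_Gamma (\<nu> j) (l j) \<sigma>) * of_real y powr (- \<sigma> - 1)) / Gq"
  proof -
    have "(1 / N * G) / (Lr * Gq) * (e * (Q * F * N) * (D * Lr / G) * Z) = e * F * (Q * D * Z) / Gq"
      if "N \<noteq> 0" "G \<noteq> 0" for N G e Q F D Z :: complex
      using that nz by (simp add: field_simps)
    then show ?thesis unfolding P A using nz by blast
  qed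
  have hk: "h (of_nat k) = (\<Prod>j=1..q. pochhammer (of_nat (\<nu> j + l j)) k / of_nat (\<nu> j + l j) ^ k / Gamma (of_nat (\<nu> j + k)))
      * Gq * of_real x ^ k / of_nat n ^ k / (\<sigma> - of_nat k)" for k
  proof -
    have "of_real (x / X) powr of_nat k = (of_real (x / X) ^ k :: complex)"
      using X xy by (subst powr_nat') auto
    also have "\<dots> = of_real x ^ k / of_nat n ^ k / (\<Prod>j=1..q. of_nat (\<nu> j + l j) ^ k)"
      by (simp add: X_def power_divide power_mult_distrib prod_power_distrib add.commute)
    finally have p: "of_real (x / X) powr of_nat k = of_real x ^ k / of_nat n ^ k / (\<Prod>j=1..q. of_nat (\<nu> j + l j) ^ k :: complex)" .
    have g: "Gamma (of_nat (\<nu> j + l j) + of_nat k) * rGamma (of_nat (\<nu> j) + of_nat k)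
        = pochhammer (of_nat (\<nu> j + l j)) k / Gamma (of_nat (\<nu> j + k)) * (Gamma (of_nat (\<nu> j + l j)) :: complex)" if "j \<in> {1..q}" for j
    proof -
      have "of_nat (\<nu> j + l j) \<notin> (\<int>\<^sub>\<le>\<^sub>0 :: complex set)"
        using l[of j] that by (auto simp: of_nat_in_nonpos_Ints_iff simp del: of_nat_add)
      from pochhammer_Gamma[OF this, of k] show ?thesis
        using GL[of j] that by (simp add: rGamma_inverse_Gamma divide_inverse del: of_nat_add) (simp add: mult_ac)
    qed
    have "(\<Prod>j=1..q. Gamma (of_nat (\<nu> j + l j) + of_nat k) * rGamma (of_nat (\<nu> j) + of_nat k))
        = (\<Prod>j=1..q. pochhammer (of_nat (\<nu> j + l j)) k / Gamma (of_nat (\<nu> j + k)) * (Gamma (of_nat (\<nu> j + l j)) :: complex))"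
      by (intro prod.cong refl g)
    then show ?thesis
      unfolding h_def p Gq_def by (simp add: prod.distrib prod_dividef del: of_nat_add)
  qed
  have "of_real (hard_edge_prefactor n \<nu> l q r) * (A * h (of_nat k) * (-1) ^ (n - 1 - k) / (fact k * fact (n - 1 - k)))
    = trunc_rGamma n \<sigma> * (\<Prod>j=1..r. trunc_Gamma (\<nu> j) (l j) \<sigma>) * of_real y powr (- \<sigma> - 1)
      * (- (trunc_coeff n \<nu> l q k * of_real x ^ k / (\<sigma> - of_nat k)))" if k: "k < n" for k
  proof -
    define B where "B = trunc_rGamma n \<sigma> * (\<Prod>j=1..r. trunc_Gamma (\<nu> j) (l j) \<sigma>) * of_real y powr (- \<sigma> - 1)"
    define E where "E = (\<Prod>j=1..q. pochhammer (of_nat (\<nu> j + l j)) k / of_nat (\<nu> j + l j) ^ k / Gamma (of_nat (\<nu> j + k)) :: complex)"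
    have "(-1) ^ n * (-1) ^ (n - 1 - k) = (- ((-1) ^ k) :: complex)"
    proof -
      have "(-1) ^ n = (-1) ^ (n - 1 - k) * (- ((-1) ^ k) :: complex)"
        using k power_add[of "-1 :: complex" "n - 1 - k" "Suc k"] by simp
      then show ?thesis by (simp flip: power_mult_distrib)
    qed
    then have sgn: "(-1) ^ n * (u * (-1) ^ (n - 1 - k)) = - ((-1) ^ k) * (u :: complex)" for u
      by (simp add: mult_ac)
    have "of_real (hard_edge_prefactor n \<nu> l q r) * (A * h (of_nat k) * (-1) ^ (n - 1 - k) / (fact k * fact (n - 1 - k)))
        = (of_real (hard_edge_prefactor n \<nu> l q r) * A) * h (of_nat k) * (-1) ^ (n - 1 - k) / (fact k * fact (n - 1 - k))"
      by simp
    also have "\<dots> = (-1) ^ n * ((fact (n - 1) * B / Gq * (E * Gq * of_real x ^ k / of_nat n ^ k / (\<sigma> - of_nat k))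
        / (fact k * fact (n - 1 - k))) * (-1) ^ (n - 1 - k))"
      unfolding PA hk B_def[symmetric] E_def[symmetric] by simp
    also have "\<dots> = - ((-1) ^ k) * (fact (n - 1) * B / Gq * (E * Gq * of_real x ^ k / of_nat n ^ k / (\<sigma> - of_nat k))
        / (fact k * fact (n - 1 - k)))"
      by (rule sgn)
    also have "\<dots> = B * (- (trunc_coeff n \<nu> l q k * of_real x ^ k / (\<sigma> - of_nat k)))"
      using nz(2) k unfolding trunc_coeff_def E_def[symmetric] by (simp add: mult_ac)
    finally show ?thesis unfolding B_def .
  qed
  then show ?thesis
    unfolding int sum_distrib_left sum_negf[symmetric] by (intro sum.cong) auto
qed

text \<open>
  The functions of \<open>\<sigma>\<close> that remain when the integrals over \<open>\<zeta>\<close> have been evaluated, including the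
  prefactor in the truncated case.
\<close>

definition trunc_inner :: "nat \<Rightarrow> (nat \<Rightarrow> nat) \<Rightarrow> (nat \<Rightarrow> nat) \<Rightarrow> nat \<Rightarrow> nat \<Rightarrow> real \<Rightarrow> real \<Rightarrow> complex \<Rightarrow> complex"
  where "trunc_inner n \<nu> l q r x y \<sigma> = trunc_rGamma n \<sigma> * (\<Prod>j=1..r. trunc_Gamma (\<nu> j) (l j) \<sigma>) * of_real y powr (- \<sigma> - 1)
      * (- (\<Sum>k. trunc_coeff n \<nu> l q k * of_real x ^ k / (\<sigma> - of_nat k)))"

definition hard_inner :: "(nat \<Rightarrow> nat) \<Rightarrow> nat \<Rightarrow> nat \<Rightarrow> real \<Rightarrow> real \<Rightarrow> complex \<Rightarrow> complex"
  where "hard_inner \<nu> q r x y \<sigma> = rGamma (- \<sigma>) * (\<Prod>j=1..r. Gamma (\<sigma> + of_nat (\<nu> j))) * of_real y powr (- \<sigma> - 1)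
      * (- (\<Sum>k. hard_coeff \<nu> q k * of_real x ^ k / (\<sigma> - of_nat k)))"

lemma trunc_coeff_suminf:
  "(\<Sum>k. trunc_coeff n \<nu> l q k * of_real x ^ k / (\<sigma> - of_nat k)) = (\<Sum>k<n. trunc_coeff n \<nu> l q k * of_real x ^ k / (\<sigma> - of_nat k))"
  by (rule suminf_finite) (auto simp: trunc_coeff_def)

text \<open>
  The loop integral over \<open>\<zeta>\<close> is of Mellin--Barnes type: the integrand is \<open>\<Gamma>(- \<zeta>)\<close> times a function that
  is holomorphic on \<open>Re \<zeta> > - c\<close> and grows at most exponentially, since \<open>1 / \<Gamma>\<close> is bounded on
  right half-strips.
\<close>

lemma hard_zeta_integral:
  assumes \<nu>: "\<And>j. j \<ge> 1 \<Longrightarrow> \<nu> j \<ge> 1" and c: "0 < c'" "c' < c" "c < 1" and d: "\<delta>' > 0"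
    and \<sigma>: "Re \<sigma> \<le> - c" and xy: "x > 0" "y > 0"
  shows "1 / (2 * of_real pi * \<i>) * right_loop_integral (- c') \<delta>' (hard_integrand \<nu> q r x y \<sigma>) = hard_inner \<nu> q r x y \<sigma>"
proof -
  define A where "A = (\<Prod>j=1..r. Gamma (\<sigma> + of_nat (\<nu> j))) * rGamma (- \<sigma>) * of_real y powr (- \<sigma> - 1)"
  define h where "h = (\<lambda>\<zeta>. A * ((\<Prod>j=1..q. rGamma (\<zeta> + of_nat (\<nu> j))) * of_real x powr \<zeta> / (\<sigma> - \<zeta>)))"
  define \<kappa> where "\<kappa> = \<bar>ln x\<bar>"
  obtain K where K: "K \<ge> 0" "\<And>z. Re z \<ge> -1 \<Longrightarrow> \<bar>Im z\<bar> \<le> \<delta>' \<Longrightarrow> norm (rGamma z) \<le> K"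
    using rGamma_bounded_strip by metis
  have far: "norm (\<sigma> - z) \<ge> c - c'" if "Re z \<ge> - c'" for z
    using abs_Re_le_cmod[of "\<sigma> - z"] that \<sigma> by simp
  have bd: "norm (h z) \<le> norm A * (K ^ q * exp (2 * \<kappa>) / (c - c')) * exp (\<kappa> * Re z)" if z: "Re z \<ge> - c'" "\<bar>Im z\<bar> \<le> \<delta>'" for z
  proof -
    have "norm (\<Prod>j=1..q. rGamma (z + of_nat (\<nu> j))) \<le> (\<Prod>j=1..q. K)"
      unfolding prod_norm[symmetric] using z c by (intro prod_mono conjI K) auto
    then have 1: "norm (\<Prod>j=1..q. rGamma (z + of_nat (\<nu> j))) \<le> K ^ q" by simp
    \<comment> \<open>The constant 2 covers \<open>-1 < Re z < 0\<close>.\<close>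
    have "\<bar>Re z\<bar> \<le> Re z + 2" using z c by auto
    then have "\<kappa> * \<bar>Re z\<bar> \<le> \<kappa> * (Re z + 2)" unfolding \<kappa>_def by (intro mult_left_mono) auto
    then have 2: "norm (of_real x powr z) \<le> exp (2 * \<kappa>) * exp (\<kappa> * Re z)"
      using norm_powr_real_le[OF xy(1), of \<kappa> z] by (simp add: \<kappa>_def algebra_simps flip: exp_add) (meson exp_le_cancel_iff order_trans)
    have "norm (h z) \<le> norm A * (K ^ q * (exp (2 * \<kappa>) * exp (\<kappa> * Re z)) / (c - c'))"
      unfolding h_def norm_mult norm_divide using 1 2 far[OF z(1)] c K(1)
      by (intro mult_left_mono frac_le mult_mono) auto
    then show ?thesis by (simp add: mult_ac)
  qed
  have holo: "h holomorphic_on {z. Re z > - c}"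
    unfolding h_def using \<sigma> xy by (intro holomorphic_intros) auto
  have \<kappa>: "\<kappa> \<ge> 0" by (simp add: \<kappa>_def)
  have eq: "hard_integrand \<nu> q r x y \<sigma> = (\<lambda>\<zeta>. Gamma (- \<zeta>) * h \<zeta>)"
  proof
    fix \<zeta> :: complex
    have "(\<Prod>j=1..q. rGamma (\<zeta> + of_nat (\<nu> j))) = inverse (\<Prod>j=1..q. Gamma (\<zeta> + of_nat (\<nu> j)))"
      unfolding rGamma_inverse_Gamma using prod_inversef[of "\<lambda>j. Gamma (\<zeta> + of_nat (\<nu> j))" "{1..q}"] by (simp add: o_def)
    then show "hard_integrand \<nu> q r x y \<sigma> \<zeta> = Gamma (- \<zeta>) * h \<zeta>"
      by (simp add: hard_integrand_def h_def A_def rGamma_inverse_Gamma[of "- \<sigma>"] divide_inverse mult_ac)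
  qed
  have "(\<lambda>k. (-1) ^ k / fact k * h (of_nat k)) sums
    (- (1 / (2 * of_real pi * \<i>) * right_loop_integral (- c') \<delta>' (\<lambda>z. Gamma (- z) * h z)))"
    by (rule right_loop_Gamma_sums[OF c d holo bd \<kappa>])
  moreover have "(-1) ^ k / fact k * h (of_nat k) = A * (hard_coeff \<nu> q k * of_real x ^ k / (\<sigma> - of_nat k))" for k
  proof -
    have "of_real x powr of_nat k = (of_real x ^ k :: complex)" using xy by (subst powr_nat') auto
    moreover have "(\<Prod>j=1..q. rGamma (of_nat k + of_nat (\<nu> j))) = (\<Prod>j=1..q. 1 / Gamma (of_nat (\<nu> j + k)) :: complex)"
      by (intro prod.cong) (auto simp: rGamma_inverse_Gamma divide_inverse add.commute)
    ultimately show ?thesis by (simp add: h_def hard_coeff_def)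
  qed
  ultimately have s: "(\<lambda>k. A * (hard_coeff \<nu> q k * of_real x ^ k / (\<sigma> - of_nat k))) sums
    (- (1 / (2 * of_real pi * \<i>) * right_loop_integral (- c') \<delta>' (\<lambda>z. Gamma (- z) * h z)))" by simp
  have "summable (\<lambda>k. hard_coeff \<nu> q k * of_real x ^ k / (\<sigma> - of_nat k))"
  proof (rule pole_series(2)[where S="{\<sigma>}" and B=1 and M=x and c=c])
    show "norm (hard_coeff \<nu> q k) \<le> 1 ^ k / fact k" for k using norm_hard_coeff_le[OF \<nu>] by simp
    show "c \<le> norm (\<tau> - of_nat k)" if "\<tau> \<in> {\<sigma>}" for \<tau> k
      using that \<sigma> abs_Re_le_cmod[of "\<tau> - of_nat k"] by simp
  qed (use xy c in auto)
  from suminf_mult[OF this, of A] have "A * (\<Sum>k. hard_coeff \<nu> q k * of_real x ^ k / (\<sigma> - of_nat k))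
    = - (1 / (2 * of_real pi * \<i>) * right_loop_integral (- c') \<delta>' (\<lambda>z. Gamma (- z) * h z))"
    using sums_unique[OF s] by (rule trans[OF sym sym])
  then have "1 / (2 * of_real pi * \<i>) * right_loop_integral (- c') \<delta>' (\<lambda>z. Gamma (- z) * h z)
    = A * (- (\<Sum>k. hard_coeff \<nu> q k * of_real x ^ k / (\<sigma> - of_nat k)))"
    unfolding mult_minus_right by simp
  then show ?thesis
    unfolding eq hard_inner_def A_def by (simp only: mult_ac)
qed

section \<open>Convergence of the double integrals\<close>

text \<open>
  The factor \<open>\<bar>y\<^sup>-\<^sup>\<sigma>\<^sup>-\<^sup>1\<bar>\<close> grows at most like \<open>exp (- m Re \<sigma>)\<close> to the left. It is compensated by letting
  \<open>trunc_rGamma\<close> decay at rate \<open>m + 1\<close>; the remaining factors only have to stay bounded.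
\<close>

lemma double_integral_tendsto:
  fixes n :: "nat \<Rightarrow> nat" and l :: "nat \<Rightarrow> nat \<Rightarrow> nat" and \<nu> :: "nat \<Rightarrow> nat" and xs ys :: "nat \<Rightarrow> real"
  assumes \<nu>: "\<And>j. j \<ge> 1 \<Longrightarrow> \<nu> j \<ge> 1" and n: "filterlim n at_top sequentially" "\<And>\<alpha>. n \<alpha> \<ge> 1"
    and l: "\<And>j. j \<ge> 1 \<Longrightarrow> filterlim (l j) at_top sequentially" "\<And>j \<alpha>. j \<ge> 1 \<Longrightarrow> l j \<alpha> \<ge> 1"
    and nl: "\<forall>\<^sub>F \<alpha> in sequentially. \<forall>j\<in>{1..q}. n \<alpha> \<le> l j \<alpha>" and r: "r \<ge> 1"
    and c: "0 < c" "c < 1" and d: "\<delta> > 0"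
    and xs: "\<And>\<alpha>. xs \<alpha> > 0" "\<And>\<alpha>. \<bar>ln (xs \<alpha>)\<bar> \<le> m" and ys: "\<And>\<alpha>. ys \<alpha> > 0" "\<And>\<alpha>. \<bar>ln (ys \<alpha>)\<bar> \<le> m"
  shows "(\<lambda>\<alpha>. left_loop_integral (- c) \<delta> (trunc_inner (n \<alpha>) \<nu> (\<lambda>j. l j \<alpha>) q r (xs \<alpha>) (ys \<alpha>))
    - left_loop_integral (- c) \<delta> (hard_inner \<nu> q r (xs \<alpha>) (ys \<alpha>))) \<longlonglongrightarrow> 0"
proof -
  \<comment> \<open>\<open>M\<close> bounds the points \<open>xs\<close>, and \<open>C\<close> bounds both residue sums on the loop.\<close>
  define M where "M = exp m"
  have m: "m \<ge> 0" using xs(2)[of 0] by linarith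
  have xM: "0 \<le> xs \<alpha>" "xs \<alpha> \<le> M" for \<alpha>
  proof -
    have "ln (xs \<alpha>) \<le> m" using xs(2)[of \<alpha>] by simp
    then show "0 \<le> xs \<alpha>" "xs \<alpha> \<le> M" using xs(1)[of \<alpha>] by (simp_all add: M_def ln_le_cancel_iff ln_ge_iff less_imp_le) (metis exp_le_cancel_iff exp_ln)
  qed
  define B where "B = (2 ^ q :: real)"
  define C where "C = exp (B * M) / c"
  have B: "B \<ge> 1" by (simp add: B_def)
  let ?L = "left_loop (- c) \<delta>" and ?tc = "\<lambda>\<alpha>. trunc_coeff (n \<alpha>) \<nu> (\<lambda>j. l j \<alpha>) q"
  have Re: "Re \<sigma> \<le> - c" if "\<sigma> \<in> ?L" for \<sigma> using that by (auto simp: left_loop_def)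
  have far: "c \<le> norm (\<sigma> - of_nat k)" if "\<sigma> \<in> ?L" for \<sigma> k
    using abs_Re_le_cmod[of "\<sigma> - of_nat k"] Re[OF that] by simp
  have hc: "norm (hard_coeff \<nu> q k) \<le> B ^ k / fact k" for k
  proof -
    have "1 / fact k \<le> B ^ k / fact k" using B by (intro divide_right_mono one_le_power) auto
    from order_trans[OF norm_hard_coeff_le[OF \<nu>] this] show ?thesis by simp
  qed
  have tc: "\<forall>\<^sub>F \<alpha> in sequentially. \<forall>k. norm (?tc \<alpha> k) \<le> B ^ k / fact k"
    using nl
  proof eventually_elim
    case (elim \<alpha>)
    then show ?case unfolding B_def by (intro allI norm_trunc_coeff_le \<nu> n(2)) auto
  qed
  note ser = pole_series[where S="left_loop (- c) \<delta>", OF _ order_trans[OF zero_le_one B] xM c(1) far]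
  have J: "finite {1..r}" "{1..r} \<noteq> {}" using r by auto
  have \<nu>c: "- real (\<nu> j) < - c" if "j \<in> {1..r}" for j
  proof -
    have "real (\<nu> j) \<ge> 1" using \<nu>[of j] that by simp
    with c show ?thesis by linarith
  qed
  have \<nu>1: "\<nu> j \<ge> 1" if "j \<in> {1..r}" for j using \<nu>[of j] that by simp
  have l1: "filterlim (l j) at_top sequentially" if "j \<in> {1..r}" for j using l(1)[of j] that by simp
  have mc: "- c < 0" "m + 1 \<ge> 0" using m c by auto
  obtain K1 where K1: "K1 \<ge> 0" "\<forall>\<^sub>F k in sequentially. \<forall>\<sigma>\<in>?L. norm (trunc_rGamma k \<sigma>) \<le> K1 * exp ((m + 1) * Re \<sigma>)"
    using trunc_rGamma_loop_bound[OF mc(1) d mc(2)] .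
  obtain K1' where K1': "K1' \<ge> 0" "\<forall>\<sigma>\<in>?L. norm (rGamma (- \<sigma>)) \<le> K1' * exp ((m + 1) * Re \<sigma>)"
    using rGamma_loop_bound[OF mc(1) d mc(2)] .
  obtain K2 where K2: "K2 \<ge> 0" "\<forall>\<^sub>F \<alpha> in sequentially. \<forall>\<sigma>\<in>?L. norm (\<Prod>j=1..r. trunc_Gamma (\<nu> j) (l j \<alpha>) \<sigma>) \<le> K2 * exp (0 * Re \<sigma>)"
    using prod_trunc_Gamma_loop_bound[OF J \<nu>1 \<nu>c l1 d order_refl] .
  obtain K2' where K2': "K2' \<ge> 0" "\<forall>\<sigma>\<in>?L. norm (\<Prod>j=1..r. Gamma (\<sigma> + of_nat (\<nu> j))) \<le> K2' * exp (0 * Re \<sigma>)"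
    using prod_Gamma_loop_bound[OF J \<nu>1 \<nu>c d order_refl] .
  have comb: "norm (a * b * of_real (ys \<alpha>) powr (- \<sigma> - 1) * (- s)) \<le> k1 * k2 * exp m * C * exp (Re \<sigma>)"
    if "\<sigma> \<in> ?L" "norm a \<le> k1 * exp ((m + 1) * Re \<sigma>)" "norm b \<le> k2 * exp (0 * Re \<sigma>)" "norm s \<le> C" "k1 \<ge> 0" "k2 \<ge> 0"
    for a b s \<sigma> \<alpha> k1 k2
  proof -
    have "\<bar>Re (- \<sigma> - 1)\<bar> \<le> 1 - Re \<sigma>" using Re[OF that(1)] c by auto
    then have "m * \<bar>Re (- \<sigma> - 1)\<bar> \<le> m * (1 - Re \<sigma>)" using m by (intro mult_left_mono)
    with norm_powr_real_le[OF ys(1) ys(2), of \<alpha> "- \<sigma> - 1"]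
    have y: "norm (of_real (ys \<alpha>) powr (- \<sigma> - 1)) \<le> exp (m * (1 - Re \<sigma>))"
      by (meson exp_le_cancel_iff order_trans)
    have "norm (a * b * of_real (ys \<alpha>) powr (- \<sigma> - 1) * (- s))
        \<le> (k1 * exp ((m + 1) * Re \<sigma>)) * k2 * exp (m * (1 - Re \<sigma>)) * C"
      unfolding norm_mult norm_minus_cancel using that y by (intro mult_mono mult_nonneg_nonneg) auto
    also have "\<dots> = k1 * k2 * C * exp ((m + 1) * Re \<sigma> + m * (1 - Re \<sigma>))"
      by (simp only: exp_add mult_ac)
    also have "(m + 1) * Re \<sigma> + m * (1 - Re \<sigma>) = m + Re \<sigma>" by (simp add: algebra_simps)
    finally show ?thesis by (simp only: exp_add mult_ac)
  qed
  have ycont: "continuous_on ?L (\<lambda>\<sigma>. of_real (ys \<alpha>) powr (- \<sigma> - 1))" for \<alpha>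
    using ys(1)[of \<alpha>] by (intro continuous_intros) auto
  show ?thesis
  proof (rule left_loop_integral_diff_tendsto_0[OF d])
    show "\<forall>\<^sub>F \<alpha> in sequentially. continuous_on ?L (trunc_inner (n \<alpha>) \<nu> (\<lambda>j. l j \<alpha>) q r (xs \<alpha>) (ys \<alpha>))"
      using tc
    proof eventually_elim
      case (elim \<alpha>)
      then show ?case unfolding trunc_inner_def
        by (intro continuous_on_mult continuous_on_minus continuous_on_prod ycont continuous_on_trunc_rGamma
            continuous_on_trunc_Gamma d \<nu>c ser(4)) auto
    qed
    show "\<forall>\<^sub>F \<alpha> in sequentially. continuous_on ?L (hard_inner \<nu> q r (xs \<alpha>) (ys \<alpha>))"
      unfolding hard_inner_def
      by (intro always_eventually allI continuous_on_mult continuous_on_minus continuous_on_prod ycont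
            continuous_on_compose2[OF continuous_on_rGamma[of UNIV]] continuous_on_Gamma_loop d \<nu>c ser(4) hc)
         (auto intro!: continuous_intros)
    have "\<forall>\<^sub>F \<alpha> in sequentially. \<forall>\<sigma>\<in>?L. norm (trunc_rGamma (n \<alpha>) \<sigma>) \<le> K1 * exp ((m + 1) * Re \<sigma>)"
      using eventually_compose_filterlim[OF K1(2) n(1)] .
    then show "\<forall>\<^sub>F \<alpha> in sequentially. \<forall>\<sigma>\<in>?L. norm (trunc_inner (n \<alpha>) \<nu> (\<lambda>j. l j \<alpha>) q r (xs \<alpha>) (ys \<alpha>) \<sigma>)
        \<le> (K1 * K2 * exp m * C) * exp (Re \<sigma>)"
      using K2(2) tc
    proof eventually_elim
      case (elim \<alpha>)
      then show ?case unfolding trunc_inner_def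
        by (intro ballI comb K1(1) K2(1)) (auto intro!: ser(3) simp: C_def)
    qed
    show "\<forall>\<^sub>F \<alpha> in sequentially. \<forall>\<sigma>\<in>?L. norm (hard_inner \<nu> q r (xs \<alpha>) (ys \<alpha>) \<sigma>)
        \<le> (K1' * K2' * exp m * C) * exp (Re \<sigma>)"
      unfolding hard_inner_def
      by (intro always_eventually allI ballI comb K1'(1) K2'(1) bspec[OF K1'(2)] bspec[OF K2'(2)]) (auto intro!: ser(3) hc simp: C_def)
    fix \<sigma> assume \<sigma>: "\<sigma> \<in> ?L"
    define Y where "Y \<alpha> = of_real (ys \<alpha>) powr (- \<sigma> - 1)" for \<alpha>
    define u where "u \<alpha> = trunc_rGamma (n \<alpha>) \<sigma> * (\<Prod>j=1..r. trunc_Gamma (\<nu> j) (l j \<alpha>) \<sigma>)" for \<alpha>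
    define b where "b = rGamma (- \<sigma>) * (\<Prod>j=1..r. Gamma (\<sigma> + of_nat (\<nu> j)))"
    define s where "s \<alpha> = (\<Sum>k. ?tc \<alpha> k * of_real (xs \<alpha>) ^ k / (\<sigma> - of_nat k))" for \<alpha>
    define s' where "s' \<alpha> = (\<Sum>k. hard_coeff \<nu> q k * of_real (xs \<alpha>) ^ k / (\<sigma> - of_nat k))" for \<alpha>
    have u: "u \<longlonglongrightarrow> b"
      unfolding u_def b_def
    proof (intro tendsto_mult tendsto_prod)
      show "(\<lambda>\<alpha>. trunc_rGamma (n \<alpha>) \<sigma>) \<longlonglongrightarrow> rGamma (- \<sigma>)"
        by (rule filterlim_compose[OF trunc_rGamma_LIMSEQ[OF left_loop_uminus_notin_nonpos_Ints[OF mc(1) d \<sigma>]] n(1)])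
      show "(\<lambda>\<alpha>. trunc_Gamma (\<nu> j) (l j \<alpha>) \<sigma>) \<longlonglongrightarrow> Gamma (\<sigma> + of_nat (\<nu> j))" if "j \<in> {1..r}" for j
        by (rule filterlim_compose[OF trunc_Gamma_LIMSEQ[OF \<nu>1[OF that]] l1[OF that]])
    qed
    \<comment> \<open>Tannery's theorem for the difference of the two residue sums, whose terms share the factor \<open>xs \<alpha> ^ k\<close>.\<close>
    have s's: "(\<lambda>\<alpha>. s \<alpha> - s' \<alpha>) \<longlonglongrightarrow> 0"
    proof -
      define D where "D k \<alpha> = (?tc \<alpha> k - hard_coeff \<nu> q k) * of_real (xs \<alpha>) ^ k / (\<sigma> - of_nat k)" for k \<alpha>
      have "(\<lambda>\<alpha>. suminf (\<lambda>k. D k \<alpha>)) \<longlonglongrightarrow> suminf (\<lambda>k::nat. 0 :: complex)"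
      proof (rule tannerys_theorem[where M="\<lambda>k. 2 * ((B * M) ^ k / fact k / c)", THEN conjunct2, THEN conjunct2])
        show "(\<lambda>\<alpha>. D k \<alpha>) \<longlonglongrightarrow> 0" for k
        proof (rule Lim_null_comparison)
          have "norm (D k \<alpha>) \<le> norm (?tc \<alpha> k - hard_coeff \<nu> q k) * M ^ k / c" for \<alpha>
            unfolding D_def norm_divide norm_mult norm_power norm_of_real
            using xM[of \<alpha>] far[OF \<sigma>, of k] c by (intro frac_le mult_left_mono power_mono mult_nonneg_nonneg) auto
          then show "\<forall>\<^sub>F \<alpha> in sequentially. norm (D k \<alpha>) \<le> norm (?tc \<alpha> k - hard_coeff \<nu> q k) * M ^ k / c"
            by simp
          have "(\<lambda>\<alpha>. norm (?tc \<alpha> k - hard_coeff \<nu> q k) * M ^ k / c)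
              \<longlonglongrightarrow> norm (hard_coeff \<nu> q k - hard_coeff \<nu> q k) * M ^ k / c"
            using c by (intro tendsto_intros trunc_coeff_tendsto n l) auto
          then show "(\<lambda>\<alpha>. norm (?tc \<alpha> k - hard_coeff \<nu> q k) * M ^ k / c) \<longlonglongrightarrow> 0"
            by simp
        qed
        have "\<forall>\<^sub>F \<alpha> in sequentially. \<forall>k. norm (D k \<alpha>) \<le> 2 * ((B * M) ^ k / fact k / c)"
          using tc
        proof (eventually_elim, intro allI)
          fix \<alpha> k assume "\<forall>k. norm (?tc \<alpha> k) \<le> B ^ k / fact k"
          then have "norm (?tc \<alpha> k * of_real (xs \<alpha>) ^ k / (\<sigma> - of_nat k)) \<le> (B * M) ^ k / fact k / c"
            by (intro ser(1)[OF _ _ \<sigma>]) auto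
          moreover have "norm (hard_coeff \<nu> q k * of_real (xs \<alpha>) ^ k / (\<sigma> - of_nat k)) \<le> (B * M) ^ k / fact k / c"
            by (intro ser(1)[OF _ _ \<sigma>] hc)
          ultimately show "norm (D k \<alpha>) \<le> 2 * ((B * M) ^ k / fact k / c)"
            unfolding D_def left_diff_distrib diff_divide_distrib
            by (intro order_trans[OF norm_triangle_ineq4]) linarith
        qed
        then show "\<forall>\<^sub>F (k, \<alpha>) in at_top \<times>\<^sub>F sequentially. norm (D k \<alpha>) \<le> 2 * ((B * M) ^ k / fact k / c)"
          unfolding eventually_prod_filter by (intro exI[of _ "\<lambda>_. True"] exI[of _ "\<lambda>\<alpha>. \<forall>k. norm (D k \<alpha>) \<le> 2 * ((B * M) ^ k / fact k / c)"]) auto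
        show "summable (\<lambda>k. 2 * ((B * M) ^ k / fact k / c))"
          by (intro summable_mult summable_divide sums_summable[OF power_fact_sums_exp])
      qed simp
      then have "(\<lambda>\<alpha>. suminf (\<lambda>k. D k \<alpha>)) \<longlonglongrightarrow> 0" by simp
      moreover have "\<forall>\<^sub>F \<alpha> in sequentially. suminf (\<lambda>k. D k \<alpha>) = s \<alpha> - s' \<alpha>"
        using tc
      proof eventually_elim
        case (elim \<alpha>)
        then have "summable (\<lambda>k. ?tc \<alpha> k * of_real (xs \<alpha>) ^ k / (\<sigma> - of_nat k))"
          by (intro ser(2)[OF _ _ \<sigma>]) auto
        moreover have "summable (\<lambda>k. hard_coeff \<nu> q k * of_real (xs \<alpha>) ^ k / (\<sigma> - of_nat k))"
          by (intro ser(2)[OF _ _ \<sigma>] hc)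
        ultimately show ?case
          unfolding s_def s'_def D_def left_diff_distrib diff_divide_distrib by (rule suminf_diff[symmetric])
      qed
      ultimately show ?thesis by (rule Lim_transform_eventually)
    qed
    have Y: "norm (- Y \<alpha>) \<le> exp (m * \<bar>Re (- \<sigma> - 1)\<bar>)" for \<alpha>
      unfolding Y_def norm_minus_cancel by (rule norm_powr_real_le[OF ys])
    have s': "norm (s' \<alpha>) \<le> C" for \<alpha>
      unfolding s'_def C_def by (rule ser(3)[OF hc _ \<sigma>])
    have "(\<lambda>\<alpha>. u \<alpha> * (s \<alpha> - s' \<alpha>) + (u \<alpha> - b) * s' \<alpha>) \<longlonglongrightarrow> b * 0 + 0"
    proof (intro tendsto_add tendsto_mult u s's)
      show "(\<lambda>\<alpha>. (u \<alpha> - b) * s' \<alpha>) \<longlonglongrightarrow> 0"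
        by (rule lim_null_mult_right_bounded[OF _ always_eventually]) (use u s' in \<open>auto simp: LIM_zero_iff\<close>)
    qed
    then have "(\<lambda>\<alpha>. u \<alpha> * (s \<alpha> - s' \<alpha>) + (u \<alpha> - b) * s' \<alpha>) \<longlonglongrightarrow> 0" by simp
    then have "(\<lambda>\<alpha>. - Y \<alpha> * (u \<alpha> * (s \<alpha> - s' \<alpha>) + (u \<alpha> - b) * s' \<alpha>)) \<longlonglongrightarrow> 0"
      by (rule lim_null_mult_left_bounded[OF always_eventually, rotated]) (rule allI, rule Y)
    moreover have "trunc_inner (n \<alpha>) \<nu> (\<lambda>j. l j \<alpha>) q r (xs \<alpha>) (ys \<alpha>) \<sigma> - hard_inner \<nu> q r (xs \<alpha>) (ys \<alpha>) \<sigma>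
        = - Y \<alpha> * (u \<alpha> * (s \<alpha> - s' \<alpha>) + (u \<alpha> - b) * s' \<alpha>)" for \<alpha>
      unfolding trunc_inner_def hard_inner_def u_def[symmetric] b_def[symmetric] s_def[symmetric] s'_def[symmetric] Y_def[symmetric]
      by (simp add: algebra_simps)
    ultimately show "(\<lambda>\<alpha>. trunc_inner (n \<alpha>) \<nu> (\<lambda>j. l j \<alpha>) q r (xs \<alpha>) (ys \<alpha>) \<sigma> - hard_inner \<nu> q r (xs \<alpha>) (ys \<alpha>) \<sigma>) \<longlonglongrightarrow> 0"
      by simp
  qed
qed

section \<open>Convergence of the Meijer functions\<close>

lemma shift_left_loop: "\<eta> \<in> left_loop g d \<longleftrightarrow> \<eta> - 1 \<in> left_loop (g - 1) d"
  by (auto simp: left_loop_def)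

lemma norm_powr_uminus_le:
  assumes "z > 0" "\<bar>ln z\<bar> \<le> m" "Re \<eta> \<le> g"
  shows "norm (of_real z powr (- \<eta>)) \<le> exp (2 * m * \<bar>g\<bar>) * exp (- m * Re \<eta>)"
proof -
  have m: "m \<ge> 0" using assms(2) by linarith
  have "\<bar>Re (- \<eta>)\<bar> \<le> 2 * \<bar>g\<bar> - Re \<eta>" using assms(3) by auto
  then have "m * \<bar>Re (- \<eta>)\<bar> \<le> m * (2 * \<bar>g\<bar> - Re \<eta>)" using m by (intro mult_left_mono)
  also have "\<dots> = 2 * m * \<bar>g\<bar> + - m * Re \<eta>" by (simp add: algebra_simps)
  finally have "exp (m * \<bar>Re (- \<eta>)\<bar>) \<le> exp (2 * m * \<bar>g\<bar>) * exp (- m * Re \<eta>)"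
    unfolding exp_add[symmetric] exp_le_cancel_iff .
  with norm_powr_real_le[OF assms(1,2), of "- \<eta>"] show ?thesis by linarith
qed

text \<open>
  Decay at rate \<open>m + 1\<close> outweighs the growth of \<open>z\<^sup>-\<^sup>\<eta>\<close> and leaves \<open>exp (Re \<eta>)\<close>. The shift to
  \<open>\<eta> - 1\<close> is the one that turns the parameters \<open>\<nu>\<^sub>j - 1\<close> of the Meijer functions into \<open>\<nu>\<^sub>j\<close>.
\<close>

lemma norm_mult_powr_decay_le:
  assumes "norm P \<le> K * exp ((m + 1) * Re (\<eta> - 1))" "K \<ge> 0" "z > 0" "\<bar>ln z\<bar> \<le> m" "Re \<eta> \<le> g"
  shows "norm (P * of_real z powr (- \<eta>)) \<le> K * exp (- (m + 1)) * exp (2 * m * \<bar>g\<bar>) * exp (Re \<eta>)"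
proof -
  have "norm (P * of_real z powr (- \<eta>)) \<le> (K * exp ((m + 1) * Re (\<eta> - 1))) * (exp (2 * m * \<bar>g\<bar>) * exp (- m * Re \<eta>))"
    unfolding norm_mult by (intro mult_mono assms norm_powr_uminus_le) (use assms(2) in auto)
  also have "\<dots> = K * exp (2 * m * \<bar>g\<bar>) * exp ((m + 1) * Re (\<eta> - 1) + - m * Re \<eta>)"
    by (simp only: exp_add mult_ac)
  also have "(m + 1) * Re (\<eta> - 1) + - m * Re \<eta> = - (m + 1) + Re \<eta>" by (simp add: algebra_simps)
  finally show ?thesis by (simp only: exp_add mult_ac)
qed

lemma meijer_integral_tendsto:
  fixes l :: "'i \<Rightarrow> nat \<Rightarrow> nat" and \<nu> :: "'i \<Rightarrow> nat" and zs :: "nat \<Rightarrow> real"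
  assumes J: "finite J" "J \<noteq> {}" and \<nu>: "\<And>j. j \<in> J \<Longrightarrow> \<nu> j \<ge> 1" "\<And>j. j \<in> J \<Longrightarrow> 1 - real (\<nu> j) < g"
    and l: "\<And>j. j \<in> J \<Longrightarrow> filterlim (l j) at_top sequentially" and d: "d > 0"
    and zs: "\<And>\<alpha>. zs \<alpha> > 0" "\<And>\<alpha>. \<bar>ln (zs \<alpha>)\<bar> \<le> m"
  shows "(\<lambda>\<alpha>. left_loop_integral g d (\<lambda>\<eta>. (\<Prod>j\<in>J. trunc_Gamma (\<nu> j) (l j \<alpha>) (\<eta> - 1)) * of_real (zs \<alpha>) powr (- \<eta>))
    - left_loop_integral g d (\<lambda>\<eta>. (\<Prod>j\<in>J. Gamma (\<eta> - 1 + of_nat (\<nu> j))) * of_real (zs \<alpha>) powr (- \<eta>))) \<longlonglongrightarrow> 0"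
proof -
  have m: "m \<ge> 0" "m + 1 \<ge> 0" using zs(2)[of 0] by linarith+
  have \<nu>g: "- real (\<nu> j) < g - 1" if "j \<in> J" for j using \<nu>(2)[OF that] by linarith
  obtain K where K: "K \<ge> 0" "\<forall>\<^sub>F \<alpha> in sequentially. \<forall>\<sigma>\<in>left_loop (g - 1) d.
    norm (\<Prod>j\<in>J. trunc_Gamma (\<nu> j) (l j \<alpha>) \<sigma>) \<le> K * exp ((m + 1) * Re \<sigma>)"
    using prod_trunc_Gamma_loop_bound[OF J \<nu>(1) \<nu>g l d m(2)] .
  obtain K' where K': "K' \<ge> 0" "\<forall>\<sigma>\<in>left_loop (g - 1) d.
    norm (\<Prod>j\<in>J. Gamma (\<sigma> + of_nat (\<nu> j))) \<le> K' * exp ((m + 1) * Re \<sigma>)"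
    using prod_Gamma_loop_bound[OF J \<nu>(1) \<nu>g d m(2)] .
  have Re: "Re \<eta> \<le> g" if "\<eta> \<in> left_loop g d" for \<eta> using that by (auto simp: left_loop_def)
  have ycont: "continuous_on (left_loop g d) (\<lambda>\<eta>. of_real (zs \<alpha>) powr (- \<eta>))" for \<alpha>
    using zs(1)[of \<alpha>] by (intro continuous_intros) auto
  have sub: "(\<lambda>\<eta>. \<eta> - 1) ` left_loop g d \<subseteq> left_loop (g - 1) d"
    using shift_left_loop by blast
  have contT: "continuous_on (left_loop g d) (\<lambda>\<eta>. trunc_Gamma (\<nu> j) k (\<eta> - 1))"
    and contG: "continuous_on (left_loop g d) (\<lambda>\<eta>. Gamma (\<eta> - 1 + of_nat (\<nu> j)))" if "j \<in> J" for j k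
    using continuous_on_compose2[OF continuous_on_trunc_Gamma[OF d \<nu>g[OF that]] _ sub]
      continuous_on_compose2[OF continuous_on_Gamma_loop[OF d \<nu>g[OF that]] _ sub]
    by (simp_all add: continuous_intros)
  show ?thesis
  proof (rule left_loop_integral_diff_tendsto_0[OF d])
    show "\<forall>\<^sub>F \<alpha> in sequentially. continuous_on (left_loop g d)
        (\<lambda>\<eta>. (\<Prod>j\<in>J. trunc_Gamma (\<nu> j) (l j \<alpha>) (\<eta> - 1)) * of_real (zs \<alpha>) powr (- \<eta>))"
      by (rule always_eventually, rule allI, rule continuous_on_mult[OF continuous_on_prod[OF contT] ycont])
    show "\<forall>\<^sub>F \<alpha> in sequentially. continuous_on (left_loop g d)
        (\<lambda>\<eta>. (\<Prod>j\<in>J. Gamma (\<eta> - 1 + of_nat (\<nu> j))) * of_real (zs \<alpha>) powr (- \<eta>))"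
      by (rule always_eventually, rule allI, rule continuous_on_mult[OF continuous_on_prod[OF contG] ycont])
    show "\<forall>\<^sub>F \<alpha> in sequentially. \<forall>\<eta>\<in>left_loop g d.
        norm ((\<Prod>j\<in>J. trunc_Gamma (\<nu> j) (l j \<alpha>) (\<eta> - 1)) * of_real (zs \<alpha>) powr (- \<eta>))
        \<le> (K * exp (- (m + 1)) * exp (2 * m * \<bar>g\<bar>)) * exp (Re \<eta>)"
    proof (rule eventually_mono[OF K(2)], rule ballI)
      fix \<alpha> \<eta> assume "\<forall>\<sigma>\<in>left_loop (g - 1) d. norm (\<Prod>j\<in>J. trunc_Gamma (\<nu> j) (l j \<alpha>) \<sigma>) \<le> K * exp ((m + 1) * Re \<sigma>)"
        and \<eta>: "\<eta> \<in> left_loop g d"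
      then have "norm (\<Prod>j\<in>J. trunc_Gamma (\<nu> j) (l j \<alpha>) (\<eta> - 1)) \<le> K * exp ((m + 1) * Re (\<eta> - 1))"
        using sub by blast
      from norm_mult_powr_decay_le[OF this K(1) zs Re[OF \<eta>]]
      show "norm ((\<Prod>j\<in>J. trunc_Gamma (\<nu> j) (l j \<alpha>) (\<eta> - 1)) * of_real (zs \<alpha>) powr (- \<eta>))
        \<le> (K * exp (- (m + 1)) * exp (2 * m * \<bar>g\<bar>)) * exp (Re \<eta>)" .
    qed
    show "\<forall>\<^sub>F \<alpha> in sequentially. \<forall>\<eta>\<in>left_loop g d.
        norm ((\<Prod>j\<in>J. Gamma (\<eta> - 1 + of_nat (\<nu> j))) * of_real (zs \<alpha>) powr (- \<eta>))
        \<le> (K' * exp (- (m + 1)) * exp (2 * m * \<bar>g\<bar>)) * exp (Re \<eta>)"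
    proof (rule always_eventually, intro allI ballI)
      fix \<alpha> \<eta> assume \<eta>: "\<eta> \<in> left_loop g d"
      then have "norm (\<Prod>j\<in>J. Gamma (\<eta> - 1 + of_nat (\<nu> j))) \<le> K' * exp ((m + 1) * Re (\<eta> - 1))"
        using K'(2) sub by blast
      from norm_mult_powr_decay_le[OF this K'(1) zs Re[OF \<eta>]]
      show "norm ((\<Prod>j\<in>J. Gamma (\<eta> - 1 + of_nat (\<nu> j))) * of_real (zs \<alpha>) powr (- \<eta>))
        \<le> (K' * exp (- (m + 1)) * exp (2 * m * \<bar>g\<bar>)) * exp (Re \<eta>)" .
    qed
    fix \<eta> assume "\<eta> \<in> left_loop g d"
    have "(\<lambda>\<alpha>. (\<Prod>j\<in>J. trunc_Gamma (\<nu> j) (l j \<alpha>) (\<eta> - 1)) - (\<Prod>j\<in>J. Gamma (\<eta> - 1 + of_nat (\<nu> j)))) \<longlonglongrightarrow> 0"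
      by (intro LIM_zero tendsto_prod filterlim_compose[OF trunc_Gamma_LIMSEQ l] \<nu>(1))
    then have "(\<lambda>\<alpha>. ((\<Prod>j\<in>J. trunc_Gamma (\<nu> j) (l j \<alpha>) (\<eta> - 1)) - (\<Prod>j\<in>J. Gamma (\<eta> - 1 + of_nat (\<nu> j))))
        * of_real (zs \<alpha>) powr (- \<eta>)) \<longlonglongrightarrow> 0"
      by (rule lim_null_mult_right_bounded[OF _ always_eventually]) (rule allI, rule norm_powr_real_le[OF zs])
    then show "(\<lambda>\<alpha>. (\<Prod>j\<in>J. trunc_Gamma (\<nu> j) (l j \<alpha>) (\<eta> - 1)) * of_real (zs \<alpha>) powr (- \<eta>)
        - (\<Prod>j\<in>J. Gamma (\<eta> - 1 + of_nat (\<nu> j))) * of_real (zs \<alpha>) powr (- \<eta>)) \<longlonglongrightarrow> 0"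
      by (simp add: algebra_simps)
  qed
qed

text \<open>
  The loop and the line may cross the real axis at different points: first the loop is shifted, then
  it is opened up into the line.
\<close>

lemma Gamma_prod_left_loop_eq_vertical:
  fixes \<nu> :: "'i \<Rightarrow> nat"
  assumes J: "finite J" "J \<noteq> {}" and \<nu>: "\<And>j. j \<in> J \<Longrightarrow> \<nu> j \<ge> 1"
    and g: "\<And>j. j \<in> J \<Longrightarrow> 1 - real (\<nu> j) < g" "\<And>j. j \<in> J \<Longrightarrow> 1 - real (\<nu> j) < g'" and d: "d > 0" and z: "z > 0"
  defines "f \<equiv> \<lambda>\<eta>. (\<Prod>j\<in>J. Gamma (\<eta> - 1 + of_nat (\<nu> j))) * of_real z powr (- \<eta>)"
  shows "left_loop_integral g d f = vertical_line_integral g' f"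
proof -
  define m where "m = \<bar>ln z\<bar>"
  have m: "m \<ge> 0" "m + 1 \<ge> 0" by (auto simp: m_def)
  have holf: "f holomorphic_on T" if "\<And>\<eta> j. \<eta> \<in> T \<Longrightarrow> j \<in> J \<Longrightarrow> Im \<eta> \<noteq> 0 \<or> Re \<eta> > 1 - real (\<nu> j)" for T
    unfolding f_def
  proof (intro holomorphic_on_mult holomorphic_on_prod holomorphic_Gamma')
    fix j \<eta> assume a: "j \<in> J" "\<eta> \<in> T"
    show "\<eta> - 1 + of_nat (\<nu> j) \<notin> \<int>\<^sub>\<le>\<^sub>0"
    proof
      assume "\<eta> - 1 + of_nat (\<nu> j) \<in> \<int>\<^sub>\<le>\<^sub>0"
      then obtain k where "\<eta> - 1 + of_nat (\<nu> j) = - of_nat k" by (auto elim!: nonpos_Ints_cases')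
      then have "Re (\<eta> - 1 + of_nat (\<nu> j)) = - real k" "Im (\<eta> - 1 + of_nat (\<nu> j)) = 0" by simp_all
      with that[OF a(2,1)] show False by auto
    qed
  qed (use z in \<open>auto intro!: holomorphic_intros\<close>)
  have contl: "continuous_on (left_loop h d) f" if "\<And>j. j \<in> J \<Longrightarrow> 1 - real (\<nu> j) < h" for h
    using d that by (intro holomorphic_on_imp_continuous_on holf) (auto simp: left_loop_def)
  have bdl: "\<exists>K. \<forall>\<eta>\<in>left_loop h d. norm (f \<eta>) \<le> K * exp (Re \<eta>)" if h: "\<And>j. j \<in> J \<Longrightarrow> 1 - real (\<nu> j) < h" for h
  proof -
    have "- real (\<nu> j) < h - 1" if "j \<in> J" for j using h[OF that] by linarith
    from prod_Gamma_loop_bound[OF J \<nu> this d m(2)] obtain K where K: "K \<ge> 0" "\<forall>\<sigma>\<in>left_loop (h - 1) d.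
      norm (\<Prod>j\<in>J. Gamma (\<sigma> + of_nat (\<nu> j))) \<le> K * exp ((m + 1) * Re \<sigma>)" .
    show ?thesis
    proof (intro exI ballI)
      fix \<eta> assume \<eta>: "\<eta> \<in> left_loop h d"
      then have "norm (\<Prod>j\<in>J. Gamma (\<eta> - 1 + of_nat (\<nu> j))) \<le> K * exp ((m + 1) * Re (\<eta> - 1))"
        using bspec[OF K(2), of "\<eta> - 1"] shift_left_loop by blast
      from norm_mult_powr_decay_le[OF this K(1) z, of h] \<eta>
      show "norm (f \<eta>) \<le> (K * exp (- (m + 1)) * exp (2 * m * \<bar>h\<bar>)) * exp (Re \<eta>)"
        by (auto simp: f_def m_def left_loop_def)
    qed
  qed
  have shift: "left_loop_integral h' d f = left_loop_integral h d f"
    if "h \<le> h'" "\<And>j. j \<in> J \<Longrightarrow> 1 - real (\<nu> j) < h" for h h'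
  proof -
    have h': "1 - real (\<nu> j) < h'" if "j \<in> J" for j using \<open>h \<le> h'\<close> \<open>\<And>j. j \<in> J \<Longrightarrow> 1 - real (\<nu> j) < h\<close>[OF that] by linarith
    obtain K where K: "\<forall>\<eta>\<in>left_loop h' d. norm (f \<eta>) \<le> K * exp (Re \<eta>)" using bdl[OF h'] by blast
    show ?thesis
    proof (rule left_loop_integral_shift[OF d that(1) contl[OF that(2)] contl[OF h'] bspec[OF K]])
      show "f holomorphic_on {z. h \<le> Re z}"
        by (rule holf) (use that(2) in fastforce)
      show "cbox (Complex h (- d)) (Complex h' d) \<subseteq> {z. h \<le> Re z}"
        by (auto simp: in_cbox_complex_iff)
    qed (auto intro: convex_halfspace_Re_ge)
  qed
  have "left_loop_integral g d f = left_loop_integral g' d f"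
    using shift[of g g'] shift[of g' g] g by (cases "g \<le> g'") auto
  also have "\<dots> = vertical_line_integral g' f"
  proof -
    obtain K where K: "K \<ge> 0" "\<And>\<eta>. Re \<eta> \<le> g' \<Longrightarrow> \<bar>Im \<eta>\<bar> \<ge> d \<Longrightarrow>
      norm (\<Prod>j\<in>J. Gamma (\<eta> - 1 + of_nat (\<nu> j))) \<le> K * exp ((m + 1) * Re \<eta>) / (Im \<eta>)\<^sup>2"
      by (rule prod_Gamma_vertical_decay[OF J d m(2), of g' \<nu>]) blast
    have "norm (f \<eta>) \<le> (K * exp (2 * m * \<bar>g'\<bar>)) * exp (Re \<eta>) / (Im \<eta>)\<^sup>2" if "Re \<eta> \<le> g'" "\<bar>Im \<eta>\<bar> \<ge> d" for \<eta>
    proof -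
      have "norm (f \<eta>) \<le> (K * exp ((m + 1) * Re \<eta>) / (Im \<eta>)\<^sup>2) * (exp (2 * m * \<bar>g'\<bar>) * exp (- m * Re \<eta>))"
        unfolding f_def norm_mult using that K(1) z
        by (intro mult_mono K(2) norm_powr_uminus_le) (auto simp: m_def)
      also have "\<dots> = K * exp (2 * m * \<bar>g'\<bar>) * exp ((m + 1) * Re \<eta> + - m * Re \<eta>) / (Im \<eta>)\<^sup>2"
        by (simp only: exp_add mult_ac times_divide_eq_right times_divide_eq_left)
      also have "(m + 1) * Re \<eta> + - m * Re \<eta> = Re \<eta>" by (simp add: algebra_simps)
      finally show ?thesis .
    qed
    then show ?thesis
      using g by (intro left_loop_integral_eq_vertical_line_integral[OF d holf holf holomorphic_on_imp_continuous_on[OF holf]]) auto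
  qed
  finally show ?thesis .
qed

lemma prod_list_map_upt: "prod_list (map h [q+1..<r+1]) = (\<Prod>j\<in>{q+1..r}. h j :: complex)"
proof -
  have "prod_list (map h [q+1..<r+1]) = prod h (set [q+1..<r+1])"
    by (subst prod.distinct_set_conv_list) simp_all
  also have "set [q+1..<r+1] = {q+1..r}" by auto
  finally show ?thesis .
qed

text \<open>
  The quotient \<open>y' / x'\<close> of the rescaled variables is \<open>y / x\<close> divided by \<open>\<Prod> L\<^sub>j\<close> over \<open>q < j \<le> r\<close>. The
  hypothesis \<open>small\<close> places it below 1, where the Meijer function is given by the loop integral, and the
  powers of \<open>L\<^sub>j\<close> complete the Gamma quotients to Euler products.
\<close>

lemma truncated_meijer:
  fixes n q r :: nat and \<nu> l :: "nat \<Rightarrow> nat"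
  assumes \<nu>: "\<And>j. j \<ge> 1 \<Longrightarrow> \<nu> j \<ge> 1" and l: "\<And>j. j \<ge> 1 \<Longrightarrow> l j \<ge> 1" and n: "n \<ge> 1"
    and g: "\<And>j. j \<in> {q+1..r} \<Longrightarrow> 1 - real (\<nu> j) < g" and d: "d > 0" and qr: "q < r" and xy: "x > 0" "y > 0"
  defines "X \<equiv> real n * (\<Prod>j=1..q. real (l j) + real (\<nu> j))"
    and "Y \<equiv> real n * (\<Prod>j=1..r. real (l j) + real (\<nu> j))"
  assumes small: "y / x < (\<Prod>j\<in>{q+1..r}. real (\<nu> j + l j))"
  shows "of_real (hard_edge_prefactor n \<nu> l q r) * (1 / of_real (x / X) * meijer_G_p0_pp g d
           (map (\<lambda>j. real (\<nu> j) + real (l j) - 1) [q+1..<r+1])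
           (map (\<lambda>j. real (\<nu> j) - 1) [q+1..<r+1]) ((y / Y) / (x / X)))
    = 1 / of_real x * (1 / (2 * of_real pi * \<i>) * left_loop_integral g d
        (\<lambda>\<eta>. (\<Prod>j\<in>{q+1..r}. trunc_Gamma (\<nu> j) (l j) (\<eta> - 1)) * of_real (y / x) powr (- \<eta>)))"
proof -
  define L where "L j = real (\<nu> j + l j)" for j
  define J where "J = {q+1..r}"
  have L: "L j > 0" if "j \<ge> 1" for j using l[OF that] by (auto simp: L_def)
  have LJ: "L j > 0" if "j \<in> J" for j using L that by (auto simp: J_def)
  have Leq: "real (l j) + real (\<nu> j) = L j" for j by (simp add: L_def)
  have disj: "{1..r} = {1..q} \<union> J" "{1..q} \<inter> J = {}" "finite J" using qr by (auto simp: J_def)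
  have split: "prod h {1..r} = prod h {1..q} * prod h J" for h :: "nat \<Rightarrow> real"
    unfolding disj(1) by (rule prod.union_disjoint) (use disj in auto)
  have X: "X > 0" unfolding X_def Leq using n L by (intro mult_pos_pos prod_pos) auto
  define LJp where "LJp = prod L J"
  have LJp0: "LJp > 0" unfolding LJp_def using LJ by (intro prod_pos) auto
  have YX: "Y = X * LJp" unfolding X_def Y_def Leq LJp_def split by simp
  have z: "(y / Y) / (x / X) = (y / x) / LJp" using X by (simp add: YX field_simps)
  have z1: "(y / x) / LJp < 1" using small[folded L_def J_def] LJp0 unfolding LJp_def[symmetric]
    by (simp only: divide_less_eq_1_pos)
  define G where "G j = Gamma (real (\<nu> j + l j))" for j
  have G: "G j > 0" if "j \<ge> 1" for j using l[OF that] unfolding G_def by (intro Gamma_real_pos) auto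
  have P: "hard_edge_prefactor n \<nu> l q r / (x / X) = 1 / x * (\<Prod>j\<in>J. G j / L j)"
  proof -
    have "prod G {1..q} > 0" "prod L {1..q} > 0" using G L by (auto intro!: prod_pos)
    moreover have "prod L J > 0" using LJ by (intro prod_pos) auto
    moreover have "(1 / N * (a * b)) / ((e * f) * a) / (x / (N * e)) = 1 / x * (b / f)"
      if "N > 0" "a > 0" "e > 0" "f > 0" for N a b e f :: real
      using that xy by (simp add: field_simps)
    moreover have "Gamma (real (\<nu> j) + real (l j)) = G j" for j by (simp add: G_def)
    ultimately show ?thesis
      unfolding hard_edge_prefactor_def X_def Leq prod_dividef using n
      by (simp only: split)
  qed
  let ?as = "map (\<lambda>j. real (\<nu> j) + real (l j) - 1) [q+1..<r+1]" and ?bs = "map (\<lambda>j. real (\<nu> j) - 1) [q+1..<r+1]"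
  define W :: "complex \<Rightarrow> complex" where "W \<eta> = (\<Prod>(a, b)\<leftarrow>zip ?as ?bs. Gamma (of_real b + \<eta>) / Gamma (of_real a + \<eta>))" for \<eta>
  have integrand: "of_real (\<Prod>j\<in>J. G j / L j) * (W \<eta> * of_real ((y / x) / LJp) powr (- \<eta>))
      = (\<Prod>j\<in>J. trunc_Gamma (\<nu> j) (l j) (\<eta> - 1)) * of_real (y / x) powr (- \<eta>)"
    if \<eta>: "\<eta> \<in> left_loop g d" for \<eta>
  proof -
    have "W \<eta>
      = (\<Prod>j\<in>J. Gamma (of_nat (\<nu> j) + (\<eta> - 1)) / Gamma (of_nat (\<nu> j + l j) + (\<eta> - 1)))"
      unfolding W_def zip_map_map zip_same_conv_map map_map J_def prod_list_map_upt[symmetric]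
      by (simp add: o_def algebra_simps)
    also have "\<dots> = (\<Prod>j\<in>J. trunc_Gamma (\<nu> j) (l j) (\<eta> - 1) * of_real (L j) powr (1 - \<eta>) / of_real (G j))"
    proof (intro prod.cong refl)
      fix j assume j: "j \<in> J"
      have "- real (\<nu> j) < g - 1" using g[of j] j by (simp add: J_def)
      from left_loop_no_pole(2)[OF _ d this, of "\<eta> - 1"] \<eta>
      have ni: "\<eta> - 1 + of_nat (\<nu> j) \<notin> \<int>\<^sub>\<le>\<^sub>0" using shift_left_loop by blast
      show "Gamma (of_nat (\<nu> j) + (\<eta> - 1)) / Gamma (of_nat (\<nu> j + l j) + (\<eta> - 1))
          = trunc_Gamma (\<nu> j) (l j) (\<eta> - 1) * of_real (L j) powr (1 - \<eta>) / of_real (G j)"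
        using Gamma_ratio_trunc[OF ni, of "l j"] l[of j] j
        by (simp add: J_def L_def G_def flip: Gamma_complex_of_real)
    qed
    finally have pl: "W \<eta>
      = (\<Prod>j\<in>J. trunc_Gamma (\<nu> j) (l j) (\<eta> - 1) * of_real (L j) powr (1 - \<eta>) / of_real (G j))" .
    have pw: "of_real ((y / x) / LJp) powr (- \<eta>) = of_real (y / x) powr (- \<eta>) * (\<Prod>j\<in>J. of_real (L j) powr \<eta>)"
      using powr_divide_pos[OF _ LJp0, of "y / x" "- \<eta>"] xy powr_prod_pos[OF disj(3) LJ, where z=\<eta>]
      by (simp add: LJp_def)
    have cancel: "of_real (\<Prod>j\<in>J. G j / L j) * ((\<Prod>j\<in>J. trunc_Gamma (\<nu> j) (l j) (\<eta> - 1) * of_real (L j) powr (1 - \<eta>) / of_real (G j))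
        * (\<Prod>j\<in>J. of_real (L j) powr \<eta>)) = (\<Prod>j\<in>J. trunc_Gamma (\<nu> j) (l j) (\<eta> - 1))"
      unfolding of_real_prod prod.distrib[symmetric]
    proof (intro prod.cong refl)
      fix j assume j: "j \<in> J"
      have nz: "of_real (L j) \<noteq> (0 :: complex)" "of_real (G j) \<noteq> (0 :: complex)"
        using LJ[OF j] G[of j] j by (auto simp: J_def)
      have e: "of_real (L j) powr (1 - \<eta>) * of_real (L j) powr \<eta> = (of_real (L j) :: complex)"
        using nz by (simp flip: powr_add)
      have "Gj / Lj * (T * u / Gj * v) = T" if "Gj \<noteq> 0" "Lj \<noteq> 0" "u * v = Lj" for Gj Lj T u v :: complex
        using that by auto
      from this[OF nz(2,1) e] show "of_real (G j / L j) * (trunc_Gamma (\<nu> j) (l j) (\<eta> - 1) * of_real (L j) powr (1 - \<eta>) / of_real (G j)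
          * of_real (L j) powr \<eta>) = trunc_Gamma (\<nu> j) (l j) (\<eta> - 1)"
        unfolding of_real_divide .
    qed
    have assoc: "a * (b * (c * e)) = a * (b * e) * c" for a b c e :: complex by simp
    show ?thesis unfolding pl pw
      by (rule trans[OF assoc arg_cong2[where f="(*)", OF cancel refl]])
  qed
  have "(\<Prod>j\<in>J. G j / L j) > 0"
    using LJ G by (intro prod_pos divide_pos_pos) (auto simp: J_def)
  then have PJ: "of_real (\<Prod>j\<in>J. G j / L j) \<noteq> (0 :: complex)"
    unfolding of_real_eq_0_iff by linarith
  have pref: "of_real (hard_edge_prefactor n \<nu> l q r) * (1 / of_real (x / X) * w) = 1 / of_real x * (of_real (\<Prod>j\<in>J. G j / L j) * w)" for w :: complex
  proof -
    have "of_real (hard_edge_prefactor n \<nu> l q r) * (1 / of_real (x / X) * w) = of_real (hard_edge_prefactor n \<nu> l q r / (x / X)) * w"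
      by (simp del: of_real_prod)
    then show ?thesis unfolding P by (simp del: of_real_prod)
  qed
  have mei: "of_real (\<Prod>j\<in>J. G j / L j) * meijer_G_p0_pp g d ?as ?bs ((y / x) / LJp)
    = 1 / (2 * of_real pi * \<i>) * left_loop_integral g d (\<lambda>\<eta>. of_real (\<Prod>j\<in>J. G j / L j) *
        (W \<eta> * of_real ((y / x) / LJp) powr (- \<eta>)))"
    unfolding left_loop_integral_scale[OF PJ] meijer_G_p0_pp_def W_def using z1 by (simp del: of_real_prod)
  have cong: "left_loop_integral g d (\<lambda>\<eta>. of_real (\<Prod>j\<in>J. G j / L j) *
        (W \<eta> * of_real ((y / x) / LJp) powr (- \<eta>)))
      = left_loop_integral g d (\<lambda>\<eta>. (\<Prod>j\<in>J. trunc_Gamma (\<nu> j) (l j) (\<eta> - 1)) * of_real (y / x) powr (- \<eta>))"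
    by (rule left_loop_integral_cong[OF integrand d])
  show ?thesis
    unfolding z pref mei cong J_def[symmetric] ..
qed

section \<open>The hard-edge limit\<close>

text \<open>
  If uniformity fails for some \<open>e\<close>, then choosing a bad point for every index at which there is one
  gives a sequence of points along which the difference does not tend to zero.
\<close>

lemma uniform_limit_sequentiallyI_points:
  fixes f :: "nat \<Rightarrow> 'a \<Rightarrow> 'b :: real_normed_vector"
  assumes "\<And>p. (\<And>n. p n \<in> S) \<Longrightarrow> (\<lambda>n. f n (p n) - g (p n)) \<longlonglongrightarrow> 0"
  shows "uniform_limit S f g sequentially"
proof (cases "S = {}")
  case False
  then obtain s0 where s0: "s0 \<in> S" by blast
  show ?thesis
    unfolding uniform_limit_iff
  proof (intro allI impI)
    fix e :: real assume e: "e > 0"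
    define p where "p n = (if \<exists>x\<in>S. dist (f n x) (g x) \<ge> e then SOME x. x \<in> S \<and> dist (f n x) (g x) \<ge> e else s0)" for n
    have p: "p n \<in> S \<and> ((\<exists>x\<in>S. dist (f n x) (g x) \<ge> e) \<longrightarrow> dist (f n (p n)) (g (p n)) \<ge> e)" for n
    proof (cases "\<exists>x\<in>S. dist (f n x) (g x) \<ge> e")
      case True
      then have "\<exists>x. x \<in> S \<and> dist (f n x) (g x) \<ge> e" by blast
      from someI_ex[OF this] True show ?thesis by (simp add: p_def)
    qed (simp add: p_def s0)
    from assms[of p] p have "(\<lambda>n. f n (p n) - g (p n)) \<longlonglongrightarrow> 0" by blast
    from tendstoD[OF this e] show "\<forall>\<^sub>F n in sequentially. \<forall>x\<in>S. dist (f n x) (g x) < e"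
    proof eventually_elim
      case (elim n)
      then have "dist (f n (p n)) (g (p n)) < e" by (simp add: dist_norm)
      with p[of n] show ?case by (meson not_le)
    qed
  qed
qed simp

lemma much_less_imp_eventually_le:
  assumes "(\<lambda>\<alpha>. real (n \<alpha>)) \<lless> (\<lambda>\<alpha>. real (l \<alpha>))" and n: "\<And>\<alpha>. n \<alpha> \<ge> (1 :: nat)"
  shows "\<forall>\<^sub>F \<alpha> in sequentially. n \<alpha> \<le> l \<alpha>"
proof -
  from assms(1) obtain e where e: "0 < e" "\<forall>\<^sub>F \<alpha> in sequentially. real (n \<alpha>) powr (1 + e) \<le> real (l \<alpha>)"
    by (auto simp: much_less_def)
  from e(2) show ?thesis
  proof eventually_elim
    case (elim \<alpha>)
    have "real (n \<alpha>) powr 1 \<le> real (n \<alpha>) powr (1 + e)"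
      using n[of \<alpha>] e(1) by (intro powr_mono) auto
    with elim n[of \<alpha>] show ?case by simp
  qed
qed

theorem theorem2p4:
  fixes \<nu> :: "nat \<Rightarrow> nat" and n :: "nat \<Rightarrow> nat" and l :: "nat \<Rightarrow> nat \<Rightarrow> nat"
    and q r :: nat and A B :: "real set"
    and c \<delta> c' \<delta>' gT dT gH :: real and s t :: "nat \<Rightarrow> complex"
  assumes "\<nu> 0 = 1" and "\<And>j. j \<ge> 1 \<Longrightarrow> \<nu> j \<ge> 1"
    and "\<And>\<alpha>. n \<alpha> \<ge> 1" and "\<And>j \<alpha>. j \<ge> 1 \<Longrightarrow> l j \<alpha> \<ge> 1"
    and "filterlim n at_top sequentially"
    and "\<And>j. j \<ge> 1 \<Longrightarrow> filterlim (l j) at_top sequentially"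
    and "\<And>j. j \<ge> 1 \<Longrightarrow> (\<lambda>\<alpha>. real (n \<alpha>)) \<lless> (\<lambda>\<alpha>. real (l j \<alpha>))"
    and "q \<ge> 1" and "r \<ge> 1"
    and "sigma_contour c \<delta>" and "zeta_contour c c' \<delta>'"
    and "\<And>m. m \<ge> 1 \<Longrightarrow> zeta_rectangle c m (s m) (t m)"
    and "right_of_poles (map (\<lambda>j. real (\<nu> j) - 1) [q+1..<r+1]) gT" and "0 < dT"
    and "right_of_poles (map (\<lambda>j. real (\<nu> j) - 1) [q+1..<r+1]) gH"
    and "compact A" and "A \<subseteq> {0<..}" and "compact B" and "B \<subseteq> {0<..}"
  shows "uniform_limit (A \<times> B)
    (\<lambda>\<alpha> (x, y). of_real (hard_edge_prefactor (n \<alpha>) \<nu> (\<lambda>j. l j \<alpha>) q r)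
       * truncated_kernel gT dT c \<delta> (s (n \<alpha>)) (t (n \<alpha>)) (n \<alpha>) \<nu> (\<lambda>j. l j \<alpha>)
           (hard_edge_scaling (n \<alpha>) \<nu> (\<lambda>j. l j \<alpha>) (q, x))
           (hard_edge_scaling (n \<alpha>) \<nu> (\<lambda>j. l j \<alpha>) (r, y)))
    (\<lambda>(x, y). hard_edge_kernel gH c \<delta> c' \<delta>' \<nu> (q, x) (r, y))
    sequentially"
proof (rule uniform_limit_sequentiallyI_points)
  note \<nu>0 = assms(1) and \<nu> = assms(2) and n = assms(3,5) and l = assms(4,6)
  note nl = assms(7) and r = assms(9)
  have c: "0 < c" "c < 1" "0 < \<delta>" "0 < c'" "c' < c" "0 < \<delta>'"
    using assms(10,11) by (auto simp: sigma_contour_def zeta_contour_def)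
  have gT: "1 - real (\<nu> j) < gT" and gH: "1 - real (\<nu> j) < gH" if "j \<in> {q+1..r}" for j
  proof -
    have "real (\<nu> j) - 1 \<in> set (map (\<lambda>j. real (\<nu> j) - 1) [q+1..<r+1])"
      using that unfolding set_map set_upt by (intro image_eqI[of _ _ j]) auto
    with assms(13,15) have "- (real (\<nu> j) - 1) < gT" "- (real (\<nu> j) - 1) < gH"
      unfolding right_of_poles_def by blast+
    then show "1 - real (\<nu> j) < gT" "1 - real (\<nu> j) < gH" by linarith+
  qed
  have ev: "\<forall>\<^sub>F \<alpha> in sequentially. \<forall>j\<in>{1..q}. n \<alpha> \<le> l j \<alpha>"
    by (intro eventually_ball_finite ballI much_less_imp_eventually_le nl n(1)) auto
  obtain m where m: "\<And>x. x \<in> A \<union> B \<Longrightarrow> \<bar>ln x\<bar> \<le> m"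
  proof -
    have "continuous_on (A \<union> B) ln"
      using assms(17,19) by (intro continuous_on_ln continuous_on_id) auto
    then have "compact (ln ` (A \<union> B))"
      using assms(16,18) by (intro compact_continuous_image compact_Un)
    then show ?thesis
      using compact_imp_bounded[of "ln ` (A \<union> B)"] that by (auto simp: bounded_iff)
  qed
  fix p :: "nat \<Rightarrow> real \<times> real" assume p: "\<And>\<alpha>. p \<alpha> \<in> A \<times> B"
  define xs where "xs \<alpha> = fst (p \<alpha>)" for \<alpha>
  define ys where "ys \<alpha> = snd (p \<alpha>)" for \<alpha>
  have pe: "p \<alpha> = (xs \<alpha>, ys \<alpha>)" for \<alpha> by (simp add: xs_def ys_def)
  have AB: "xs \<alpha> \<in> A" "ys \<alpha> \<in> B" for \<alpha> using p[of \<alpha>] by (auto simp: pe)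
  have xs: "xs \<alpha> > 0" "\<bar>ln (xs \<alpha>)\<bar> \<le> m" and ys: "ys \<alpha> > 0" "\<bar>ln (ys \<alpha>)\<bar> \<le> m" for \<alpha>
    using AB[of \<alpha>] m assms(17,19) by auto
  have zs: "ys \<alpha> / xs \<alpha> > 0" "\<bar>ln (ys \<alpha> / xs \<alpha>)\<bar> \<le> 2 * m" for \<alpha>
    using xs[of \<alpha>] ys[of \<alpha>] by (auto simp: ln_div)
  define pre where "pre \<alpha> = (of_real (hard_edge_prefactor (n \<alpha>) \<nu> (\<lambda>j. l j \<alpha>) q r) :: complex)" for \<alpha>
  define DT where "DT \<alpha> = left_loop_integral (- c) \<delta> (trunc_inner (n \<alpha>) \<nu> (\<lambda>j. l j \<alpha>) q r (xs \<alpha>) (ys \<alpha>))" for \<alpha>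
  define DH where "DH \<alpha> = left_loop_integral (- c) \<delta> (hard_inner \<nu> q r (xs \<alpha>) (ys \<alpha>))" for \<alpha>
  define MT where "MT \<alpha> = left_loop_integral gT dT (\<lambda>\<eta>. (\<Prod>j\<in>{q+1..r}. trunc_Gamma (\<nu> j) (l j \<alpha>) (\<eta> - 1))
      * of_real (ys \<alpha> / xs \<alpha>) powr (- \<eta>))" for \<alpha>
  define MH where "MH \<alpha> = left_loop_integral gT dT (\<lambda>\<eta>. (\<Prod>j\<in>{q+1..r}. Gamma (\<eta> - 1 + of_nat (\<nu> j)))
      * of_real (ys \<alpha> / xs \<alpha>) powr (- \<eta>))" for \<alpha>
  have D: "(\<lambda>\<alpha>. DT \<alpha> - DH \<alpha>) \<longlonglongrightarrow> 0"
    unfolding DT_def DH_def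
    by (rule double_integral_tendsto[OF \<nu> n(2,1) l(2,1) ev r c(1-3) xs ys])
  have loop: "Re \<sigma> \<le> - c" "\<sigma> \<notin> \<int>" if "\<sigma> \<in> left_loop (- c) \<delta>" for \<sigma>
    using that left_loop_notin_Ints[OF c(1-3) that] by (auto simp: left_loop_def)
  define X where "X \<alpha> = real (n \<alpha>) * (\<Prod>j=1..q. real (l j \<alpha>) + real (\<nu> j))" for \<alpha>
  define Y where "Y \<alpha> = real (n \<alpha>) * (\<Prod>j=1..r. real (l j \<alpha>) + real (\<nu> j))" for \<alpha>
  \<comment> \<open>The inner integral of the truncated kernel at the rescaled points.\<close>
  define FT where "FT \<alpha> \<sigma> = 1 / (2 * of_real pi * \<i>) * contour_integral (rectpath (s (n \<alpha>)) (t (n \<alpha>))) (truncated_integrand (n \<alpha>) \<nu> (\<lambda>j. l j \<alpha>) q r (xs \<alpha> / X \<alpha>) (ys \<alpha> / Y \<alpha>) \<sigma>)" for \<alpha> \<sigma>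
  have pre0: "pre \<alpha> \<noteq> 0" for \<alpha>
  proof -
    have "Gamma (real (\<nu> j) + real (l j \<alpha>)) > 0" "real (l j \<alpha>) + real (\<nu> j) > 0" if "j \<ge> 1" for j
      using \<nu>[OF that] l(1)[OF that, of \<alpha>] by (auto intro!: Gamma_real_pos)
    then have "hard_edge_prefactor (n \<alpha>) \<nu> (\<lambda>j. l j \<alpha>) q r > 0"
      using n(1)[of \<alpha>] unfolding hard_edge_prefactor_def
      by (intro divide_pos_pos mult_pos_pos prod_pos) auto
    then show ?thesis unfolding pre_def of_real_eq_0_iff by linarith
  qed
  have dT: "pre \<alpha> * (1 / (2 * of_real pi * \<i>) * left_loop_integral (- c) \<delta> (FT \<alpha>)) = 1 / (2 * of_real pi * \<i>) * DT \<alpha>" for \<alpha>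
  proof -
    have "left_loop_integral (- c) \<delta> (\<lambda>\<sigma>. pre \<alpha> * FT \<alpha> \<sigma>) = DT \<alpha>"
      unfolding DT_def
    proof (rule left_loop_integral_cong[OF _ c(3)])
      fix \<sigma> assume \<sigma>: "\<sigma> \<in> left_loop (- c) \<delta>"
      show "pre \<alpha> * FT \<alpha> \<sigma> = trunc_inner (n \<alpha>) \<nu> (\<lambda>j. l j \<alpha>) q r (xs \<alpha>) (ys \<alpha>) \<sigma>"
        unfolding pre_def FT_def X_def Y_def trunc_inner_def trunc_coeff_suminf
        by (rule truncated_zeta_integral[where \<nu>=\<nu> and l="\<lambda>j. l j \<alpha>" and n="n \<alpha>" and s="s (n \<alpha>)" and t="t (n \<alpha>)"
              and x="xs \<alpha>" and y="ys \<alpha>", OF \<nu>0 \<nu> l(1) n(1) c(1,2) assms(12)[OF n(1)] loop[OF \<sigma>] xs(1) ys(1)])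
    qed
    then have "pre \<alpha> * left_loop_integral (- c) \<delta> (FT \<alpha>) = DT \<alpha>"
      unfolding left_loop_integral_scale[OF pre0] .
    then show ?thesis by (simp only: mult.left_commute[of "pre \<alpha>"])
  qed
  \<comment> \<open>Eventually the truncated Meijer function is evaluated below 1, since one of the factors \<open>L\<^sub>j\<close> tends to infinity.\<close>
  have small: "\<forall>\<^sub>F \<alpha> in sequentially. q < r \<longrightarrow> ys \<alpha> / xs \<alpha> < (\<Prod>j\<in>{q+1..r}. real (\<nu> j + l j \<alpha>))"
  proof -
    have "filterlim (\<lambda>\<alpha>. real (l r \<alpha>)) at_top sequentially"
      by (rule filterlim_compose[OF filterlim_real_sequentially l(2)[OF r]])
    then have "\<forall>\<^sub>F \<alpha> in sequentially. exp (2 * m) < real (l r \<alpha>)"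
      unfolding filterlim_at_top_dense by (rule spec)
    then show ?thesis
    proof eventually_elim
      case (elim \<alpha>)
      show ?case
      proof
        assume qr: "q < r"
        have "ln (ys \<alpha> / xs \<alpha>) \<le> 2 * m" using zs(2)[of \<alpha>] by linarith
        then have "exp (ln (ys \<alpha> / xs \<alpha>)) \<le> exp (2 * m)" by simp
        then have "ys \<alpha> / xs \<alpha> \<le> exp (2 * m)" unfolding exp_ln[OF zs(1)] .
        also have "\<dots> < real (\<nu> r + l r \<alpha>) * 1" using elim by simp
        also have "\<dots> \<le> real (\<nu> r + l r \<alpha>) * (\<Prod>j\<in>{q+1..r} - {r}. real (\<nu> j + l j \<alpha>))"
        proof (intro mult_left_mono prod_ge_1)
          fix j assume "j \<in> {q+1..r} - {r}"
          then show "1 \<le> real (\<nu> j + l j \<alpha>)" using \<nu>[of j] by simp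
        qed simp
        also have "\<dots> = (\<Prod>j\<in>{q+1..r}. real (\<nu> j + l j \<alpha>))"
          using qr by (subst prod.remove[of "{q+1..r}" r]) auto
        finally show "ys \<alpha> / xs \<alpha> < (\<Prod>j\<in>{q+1..r}. real (\<nu> j + l j \<alpha>))" .
      qed
    qed
  qed
  have KT: "\<forall>\<^sub>F \<alpha> in sequentially. pre \<alpha> * truncated_kernel gT dT c \<delta> (s (n \<alpha>)) (t (n \<alpha>)) (n \<alpha>) \<nu> (\<lambda>j. l j \<alpha>)
           (hard_edge_scaling (n \<alpha>) \<nu> (\<lambda>j. l j \<alpha>) (q, xs \<alpha>))
           (hard_edge_scaling (n \<alpha>) \<nu> (\<lambda>j. l j \<alpha>) (r, ys \<alpha>))
      = - (if r > q then 1 / of_real (xs \<alpha>) * (1 / (2 * of_real pi * \<i>) * MT \<alpha>) else 0) + 1 / (2 * of_real pi * \<i>) * DT \<alpha>"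
    (is "\<forall>\<^sub>F \<alpha> in sequentially. _ * ?KT \<alpha> = ?KT' \<alpha>")
    using small
  proof eventually_elim
    case (elim \<alpha>)
    have mei: "pre \<alpha> * (1 / of_real (xs \<alpha> / X \<alpha>) * meijer_G_p0_pp gT dT
           (map (\<lambda>j. real (\<nu> j) + real (l j \<alpha>) - 1) [q+1..<r+1])
           (map (\<lambda>j. real (\<nu> j) - 1) [q+1..<r+1]) ((ys \<alpha> / Y \<alpha>) / (xs \<alpha> / X \<alpha>)))
        = 1 / of_real (xs \<alpha>) * (1 / (2 * of_real pi * \<i>) * MT \<alpha>)" if qr: "q < r"
      unfolding pre_def X_def Y_def MT_def
      by (rule truncated_meijer[where \<nu>=\<nu> and l="\<lambda>j. l j \<alpha>" and n="n \<alpha>"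
            and x="xs \<alpha>" and y="ys \<alpha>", OF \<nu> l(1) n(1) gT assms(14) qr xs(1) ys(1) elim[rule_format, OF qr]])
    have "pre \<alpha> * (- (if r > q then w else 0) + v) = - (if r > q then w' else 0) + v'"
      if "q < r \<Longrightarrow> pre \<alpha> * w = w'" "pre \<alpha> * v = v'" for w v w' v'
      using that by (auto simp: algebra_simps)
    from this[OF mei dT]
    show ?case unfolding hard_edge_scaling.simps truncated_kernel.simps FT_def X_def Y_def truncated_integrand_def[abs_def] .
  qed
  have KH: "hard_edge_kernel gH c \<delta> c' \<delta>' \<nu> (q, xs \<alpha>) (r, ys \<alpha>)
      = - (if r > q then 1 / of_real (xs \<alpha>) * (1 / (2 * of_real pi * \<i>) * MH \<alpha>) else 0) + 1 / (2 * of_real pi * \<i>) * DH \<alpha>" for \<alpha>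
  proof -
    have "meijer_G_p0_0p gH (map (\<lambda>j. real (\<nu> j) - 1) [q+1..<r+1]) (ys \<alpha> / xs \<alpha>) = 1 / (2 * of_real pi * \<i>) * MH \<alpha>" if "q < r"
    proof -
      have J: "finite {q+1..r}" "{q+1..r} \<noteq> {}" using that by auto
      have \<nu>J: "\<nu> j \<ge> 1" if "j \<in> {q+1..r}" for j using \<nu>[of j] that by simp
      have "(\<Prod>b\<leftarrow>map (\<lambda>j. real (\<nu> j) - 1) [q+1..<r+1]. Gamma (of_real b + \<eta>)) = (\<Prod>j\<in>{q+1..r}. Gamma (\<eta> - 1 + of_nat (\<nu> j)))" for \<eta> :: complex
        unfolding map_map prod_list_map_upt[symmetric] by (simp add: o_def algebra_simps)
      then show ?thesis
        unfolding meijer_G_p0_0p_def MH_def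
        using Gamma_prod_left_loop_eq_vertical[OF J \<nu>J gT gH assms(14) zs(1)] by simp
    qed
    moreover have "left_loop_integral (- c) \<delta> (\<lambda>\<sigma>. 1 / (2 * of_real pi * \<i>) * right_loop_integral (- c') \<delta>' (hard_integrand \<nu> q r (xs \<alpha>) (ys \<alpha>) \<sigma>)) = DH \<alpha>"
      unfolding DH_def
      by (rule left_loop_integral_cong[OF hard_zeta_integral[OF \<nu> c(4,5,2,6) loop(1) xs(1) ys(1)] c(3)])
    ultimately show ?thesis unfolding hard_edge_kernel.simps hard_integrand_def[abs_def] by simp
  qed
  have M: "(\<lambda>\<alpha>. if r > q then 1 / of_real (xs \<alpha>) * (1 / (2 * of_real pi * \<i>) * (MT \<alpha> - MH \<alpha>)) else 0) \<longlonglongrightarrow> 0"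
  proof (cases "q < r")
    case True
    have J: "finite {q+1..r}" "{q+1..r} \<noteq> {}" using True by auto
    have \<nu>J: "\<nu> j \<ge> 1" and lJ: "filterlim (l j) at_top sequentially" if "j \<in> {q+1..r}" for j
      using \<nu>[of j] l(2)[of j] that by simp_all
    have "(\<lambda>\<alpha>. MT \<alpha> - MH \<alpha>) \<longlonglongrightarrow> 0"
      unfolding MT_def MH_def
      by (rule meijer_integral_tendsto[OF J \<nu>J gT lJ assms(14) zs])
    then have "(\<lambda>\<alpha>. 1 / (2 * of_real pi * \<i>) * (MT \<alpha> - MH \<alpha>)) \<longlonglongrightarrow> 0"
      by (rule tendsto_mult_right_zero)
    then have "(\<lambda>\<alpha>. 1 / of_real (xs \<alpha>) * (1 / (2 * of_real pi * \<i>) * (MT \<alpha> - MH \<alpha>))) \<longlonglongrightarrow> 0"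
    proof (rule lim_null_mult_left_bounded[OF always_eventually, rotated], intro allI)
      fix \<alpha>
      have "norm (of_real (xs \<alpha>) powr (- 1) :: complex) \<le> exp (m * \<bar>Re (- 1)\<bar>)"
        by (rule norm_powr_real_le[OF xs])
      then show "norm (1 / of_real (xs \<alpha>) :: complex) \<le> exp m"
        using xs(1)[of \<alpha>] by (simp add: powr_minus divide_inverse)
    qed
    with True show ?thesis by simp
  qed simp
  have "(\<lambda>\<alpha>. - (if r > q then 1 / of_real (xs \<alpha>) * (1 / (2 * of_real pi * \<i>) * (MT \<alpha> - MH \<alpha>)) else 0)
      + 1 / (2 * of_real pi * \<i>) * (DT \<alpha> - DH \<alpha>)) \<longlonglongrightarrow> - 0 + 1 / (2 * of_real pi * \<i>) * 0"
    by (intro tendsto_add tendsto_minus M tendsto_mult tendsto_const D)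
  then have "(\<lambda>\<alpha>. - (if r > q then 1 / of_real (xs \<alpha>) * (1 / (2 * of_real pi * \<i>) * (MT \<alpha> - MH \<alpha>)) else 0)
      + 1 / (2 * of_real pi * \<i>) * (DT \<alpha> - DH \<alpha>)) \<longlonglongrightarrow> 0" by simp
  then show "(\<lambda>\<alpha>. (case p \<alpha> of (x, y) \<Rightarrow> of_real (hard_edge_prefactor (n \<alpha>) \<nu> (\<lambda>j. l j \<alpha>) q r)
       * truncated_kernel gT dT c \<delta> (s (n \<alpha>)) (t (n \<alpha>)) (n \<alpha>) \<nu> (\<lambda>j. l j \<alpha>)
           (hard_edge_scaling (n \<alpha>) \<nu> (\<lambda>j. l j \<alpha>) (q, x))
           (hard_edge_scaling (n \<alpha>) \<nu> (\<lambda>j. l j \<alpha>) (r, y)))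
       - (case p \<alpha> of (x, y) \<Rightarrow> hard_edge_kernel gH c \<delta> c' \<delta>' \<nu> (q, x) (r, y))) \<longlonglongrightarrow> 0"
    unfolding pe prod.case pre_def[symmetric] KH
  proof (rule Lim_transform_eventually[OF _ eventually_mono[OF KT]])
    fix \<alpha> assume "pre \<alpha> * ?KT \<alpha> = ?KT' \<alpha>"
    then show "- (if r > q then 1 / of_real (xs \<alpha>) * (1 / (2 * of_real pi * \<i>) * (MT \<alpha> - MH \<alpha>)) else 0)
        + 1 / (2 * of_real pi * \<i>) * (DT \<alpha> - DH \<alpha>)
      = pre \<alpha> * ?KT \<alpha> - (- (if r > q then 1 / of_real (xs \<alpha>) * (1 / (2 * of_real pi * \<i>) * MH \<alpha>) else 0)
        + 1 / (2 * of_real pi * \<i>) * DH \<alpha>)"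
      by (auto simp: right_diff_distrib)
  qed
qed

end
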